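(* Assume that $G:\mathbb{R}\times X\times X\to X$ is continuous, that $p:\mathbb{R}\times X\to X$ satisfies $\|p(t,u)-p(s,v)\|\le L_p(|s-t|+\|u-v\|)$ for some $L_p\ge0$ and $\|p(s,u)\|\le C_1\|u\|+C_2$ for some $C_1,C_2\ge0$ and all arguments, and that (A1), (A2), (A3) hold. If additionally $\|G(t,u,v)\|\le k_1(t)(\|u\|+\|v\|)+k_2(t)$ for all $(t,u,v)$, where $k_1,k_2$ are locally integrable on $[a,\infty)$, then for every $\varphi\in C$ the problem $\frac{du}{dt}+Au=B(t,u_t)$, $t\ge a$, $u_a=\varphi$, has a global mild solution, i.e. a continuous $u:[a-r,\infty)\to X$ which is a mild solution on $[a-r,T]$ for every $T>a$.
   Context: Let $X$ be a Banach space with norm $\|\cdot\|$, $r>0$, $a\in\mathbb{R}$, and $C=C([-r,0];X)$ with the supremum norm $\|\cdot\|_C$. For a continuous $u$ defined on $[a-r,b]$ and $t\in[a,b]$, $u_t(\theta)=u(t+\theta)$, $\theta\in[-r,0]$. Let $A$ be the infinitesimal generator of a compact $C_0$-semigroup $\{e^{-At}\}_{t\ge0}$ on $X$ with $\|e^{-At}\|\le e^{\omega t}$, $t\ge0$, for a fixed $\omega\in\mathbb{R}$. The nonlinearity is $B(t,\psi)=G(t,\psi(0),F(t,\psi))$ with $F(t,\psi)=\int_{-r}^0 p(t,\psi(\theta))\,dg(\theta,t,\psi)$ (Stieltjes integral in $\theta$), $g:[-r,0]\times\mathbb{R}\times C\to\mathbb{R}$. (A1): for every $(t,\varphi)$,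 $g(\cdot,t,\varphi)$ has bounded variation on $[-r,0]$ with $V_{-r}^0g(\cdot,t,\varphi)\le M_{Vg}$, a constant independent of $(t,\varphi)$. Write $g=g_d+g_c$, $g_d(\cdot,t,\varphi)$ the jump (step-function) part and $g_c=g_{ac}+g_s$ the continuous part (absolutely continuous plus singular continuous) of $g(\cdot,t,\varphi)$. (A2): for each $\theta$, $(t,\varphi)\mapsto g_c(\theta,t,\varphi)$ is continuous on $\mathbb{R}\times C$. (A3): the jump points of $g_d(\cdot,t,\varphi)$ are $\theta_k=-\eta_k(t,\varphi)$ with jumps $h_k(t,\varphi)=g_d(\theta_k+0,t,\varphi)-g_d(\theta_k-0,t,\varphi)$, where $\eta_k:\mathbb{R}\times C\to[0,r]$ and $h_k:\mathbb{R}\times C\to\mathbb{R}$ are continuous, and $\sum_k h_k(t,\varphi)$ converges absolutely and uniformly on bounded subsets of $\mathbb{R}\times C$. A mild solution on $[a-r,T]$ is $u\in C([a-r,T];X)$ with $u_a=\varphi$ and $u(t)=e^{-A(t-a)}\varphi(0)+\int_a^te^{-A(t-s)}B(s,u_s)\,ds$ for $t\in[a,T]$. *)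

theory Defs
  imports "HOL-Analysis.Analysis"
begin

section \<open>The phase space C = C([-r,0];X) (functions real => X, only values on [-r,0] matter)\<close>

definition Cspace :: "real \<Rightarrow> (real \<Rightarrow> 'x::real_normed_vector) set" where
  "Cspace r = {\<psi>. continuous_on {-r..0} \<psi>}"

definition Cnorm :: "real \<Rightarrow> (real \<Rightarrow> 'x::real_normed_vector) \<Rightarrow> real" where
  "Cnorm r \<psi> = (SUP \<theta>\<in>{-r..0}. norm (\<psi> \<theta>))"

definition contC :: "real \<Rightarrow> (real \<Rightarrow> (real \<Rightarrow> 'x::real_normed_vector) \<Rightarrow> 'y::metric_space) \<Rightarrow> bool" where
  "contC r \<Phi> \<longleftrightarrow> (\<forall>t \<phi>. \<phi> \<in> Cspace r \<longrightarrow> (\<forall>\<epsilon>>0. \<exists>\<delta>>0. \<forall>s \<psi>. \<psi> \<in> Cspace r \<and> \<bar>s - t\<bar> < \<delta>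
       \<and> Cnorm r (\<lambda>\<theta>. \<psi> \<theta> - \<phi> \<theta>) < \<delta> \<longrightarrow> dist (\<Phi> s \<psi>) (\<Phi> t \<phi>) < \<epsilon>))"

definition is_partition :: "real \<Rightarrow> real \<Rightarrow> nat \<Rightarrow> (nat \<Rightarrow> real) \<Rightarrow> bool" where
  "is_partition a b n x \<longleftrightarrow> x 0 = a \<and> x n = b \<and> (\<forall>i<n. x i \<le> x (Suc i))"

definition variation_sums :: "(real \<Rightarrow> real) \<Rightarrow> real \<Rightarrow> real \<Rightarrow> real set" where
  "variation_sums f a b = {(\<Sum>i<n. \<bar>f (x (Suc i)) - f (x i)\<bar>) | n x. is_partition a b n x}"

definition has_bounded_variation :: "(real \<Rightarrow> real) \<Rightarrow> real \<Rightarrow> real \<Rightarrow> bool" where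
  "has_bounded_variation f a b \<longleftrightarrow> bdd_above (variation_sums f a b)"

definition total_variation :: "(real \<Rightarrow> real) \<Rightarrow> real \<Rightarrow> real \<Rightarrow> real" where
  "total_variation f a b = Sup (variation_sums f a b)"

definition has_RS_integral ::
  "(real \<Rightarrow> 'x::real_normed_vector) \<Rightarrow> (real \<Rightarrow> real) \<Rightarrow> real \<Rightarrow> real \<Rightarrow> 'x \<Rightarrow> bool" where
  "has_RS_integral f g a b I \<longleftrightarrow> (\<forall>\<epsilon>>0. \<exists>\<delta>>0. \<forall>n x \<xi>. is_partition a b n x
      \<and> (\<forall>i<n. x (Suc i) - x i < \<delta> \<and> x i \<le> \<xi> i \<and> \<xi> i \<le> x (Suc i))
      \<longrightarrow> norm ((\<Sum>i<n. (g (x (Suc i)) - g (x i)) *\<^sub>R f (\<xi> i)) - I) < \<epsilon>)"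

definition RS_integral ::
  "(real \<Rightarrow> 'x::real_normed_vector) \<Rightarrow> (real \<Rightarrow> real) \<Rightarrow> real \<Rightarrow> real \<Rightarrow> 'x" where
  "RS_integral f g a b = (THE I. has_RS_integral f g a b I)"

definition ext_clamp :: "(real \<Rightarrow> real) \<Rightarrow> real \<Rightarrow> real \<Rightarrow> real \<Rightarrow> real" where
  "ext_clamp f a b x = f (max a (min b x))"

definition jump_part :: "(real \<Rightarrow> real) \<Rightarrow> real \<Rightarrow> real \<Rightarrow> real \<Rightarrow> real" where
  "jump_part f a b x =
     (let e = ext_clamp f a b in
        infsum (\<lambda>y. Lim (at_right y) e - e y) {a..<x} + infsum (\<lambda>y. e y - Lim (at_left y) e) {a..x})"

definition cont_part :: "(real \<Rightarrow> real) \<Rightarrow> real \<Rightarrow> real \<Rightarrow> real \<Rightarrow> real" where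
  "cont_part f a b x = f x - jump_part f a b x"

definition jump_at :: "(real \<Rightarrow> real) \<Rightarrow> real \<Rightarrow> real \<Rightarrow> real \<Rightarrow> real" where
  "jump_at f a b x = Lim (at_right x) (ext_clamp f a b) - Lim (at_left x) (ext_clamp f a b)"

definition compact_C0_semigroup :: "(real \<Rightarrow> 'x::banach \<Rightarrow>\<^sub>L 'x) \<Rightarrow> real \<Rightarrow> bool" where
  "compact_C0_semigroup T \<omega> \<longleftrightarrow>
     T 0 = id_blinfun
   \<and> (\<forall>s\<ge>0. \<forall>t\<ge>0. T (s + t) = T s o\<^sub>L T t)
   \<and> (\<forall>x. continuous_on {0..} (\<lambda>t. blinfun_apply (T t) x))
   \<and> (\<forall>t\<ge>0. norm (T t) \<le> exp (\<omega> * t))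
   \<and> (\<forall>t>0. compact (closure (blinfun_apply (T t) ` cball 0 1)))"

text \<open>Mild solution on [a-r,Tend] of du/dt + Au = B(t,u_t), u_a = phi, where T t = e^{-At}.\<close>
definition mild_solution_on ::
  "(real \<Rightarrow> 'x::banach \<Rightarrow>\<^sub>L 'x) \<Rightarrow> (real \<Rightarrow> (real \<Rightarrow> 'x) \<Rightarrow> 'x) \<Rightarrow> real \<Rightarrow> real \<Rightarrow> real
    \<Rightarrow> (real \<Rightarrow> 'x) \<Rightarrow> (real \<Rightarrow> 'x) \<Rightarrow> bool" where
  "mild_solution_on T B r a Tend \<phi> u \<longleftrightarrow>
     continuous_on {a - r..Tend} u
   \<and> (\<forall>\<theta>\<in>{-r..0}. u (a + \<theta>) = \<phi> \<theta>)
   \<and> (\<forall>t\<in>{a..Tend}. ((\<lambda>s. blinfun_apply (T (t - s)) (B s (\<lambda>\<theta>. u (s + \<theta>))))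
          has_integral (u t - blinfun_apply (T (t - a)) (\<phi> 0))) {a..t})"

end

theory Submission
  imports Defs
begin

text \<open>
  The Stieltjes integral splits along \<open>g = g\<^sub>c + g\<^sub>d\<close> into an integral against the continuous part and the
  series \<open>\<Sum>k. h\<^sub>k(t,\<psi>) p(t,\<psi>(-\<eta>\<^sub>k(t,\<psi>)))\<close>. The first term is continuous in \<open>(t,\<psi>)\<close> because Riemann sums
  approximate the integral uniformly when the variations are uniformly bounded (Helly), the second one by
  uniform convergence of the series. Hence \<open>B\<close> is continuous and of linear growth with a locally
  integrable coefficient.

  Schauder's theorem is avoided by Tonelli's scheme: replacing \<open>u\<^sub>s\<close> by \<open>u\<^sub>s\<^sub>-\<^sub>d\<close> on the right-hand side makes
  the equation explicitly solvable on successive intervals of length \<open>d > 0\<close>. As \<open>d\<close> tends to 0 these solutions are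
  locally bounded by a Gronwall argument, pointwise relatively compact because
  \<open>w(t) = T(\<epsilon>) w(t - \<epsilon>) + O(\<integral>k)\<close> with \<open>T(\<epsilon>)\<close> compact, and therefore equicontinuous. A subsequence
  converges locally uniformly, and its limit solves the integral equation by dominated convergence.
\<close>

section \<open>Riemann--Stieltjes integrals against functions of bounded variation\<close>

text \<open>Helly's argument cannot be applied to \<open>g\<close> itself: the jump points move with
  (t, \<psi>), so \<open>g\<close> need not be pointwise continuous in these variables even though
  the integral is. Pointwise continuity is available for the continuous part only, so the jump part
  is integrated exactly, as a sum of point masses, several of which may sit at the same point or at
  an endpoint. Helly's argument for the continuous part needs a variation bound independent of (t,
  \<psi>); it is \<open>2 * M\<close>, since subtracting the jump part at most doubles the bound.
  \<open>B\<close> is merely continuous, so no contraction is available and compactness has to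
  replace it. The coefficient \<open>k\<close> is integrable but possibly unbounded, so the
  contribution of a short time interval is measured by the increment of the indefinite integral of
  \<open>k\<close>, not by its length. The semigroup is assumed to be only strongly continuous in
  time; equicontinuity uses that strong continuity is uniform on compact sets.\<close>

text \<open>Bounded variation enters only through some \<open>v\<close> whose increments dominate those of \<open>f\<close>;
  the cumulative variation of \<open>f\<close> is such a function.\<close>

definition var_dom :: "(real \<Rightarrow> real) \<Rightarrow> (real \<Rightarrow> real) \<Rightarrow> real \<Rightarrow> real \<Rightarrow> bool" where
  "var_dom f v a b \<longleftrightarrow> (\<forall>x y. a \<le> x \<longrightarrow> x \<le> y \<longrightarrow> y \<le> b \<longrightarrow> \<bar>f y - f x\<bar> \<le> v y - v x)"

lemma var_domD: "var_dom f v a b \<Longrightarrow> a \<le> x \<Longrightarrow> x \<le> y \<Longrightarrow> y \<le> b \<Longrightarrow> \<bar>f y - f x\<bar> \<le> v y - v x"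
  by (auto simp: var_dom_def)

lemma var_dom_diff:
  "var_dom f v a b \<Longrightarrow> var_dom f' v' a b \<Longrightarrow> var_dom (\<lambda>x. f x - f' x) (\<lambda>x. v x + v' x) a b"
  unfolding var_dom_def by (smt (verit))

text \<open>Appending \<open>y\<close> to a partition of [a, x] turns a variation sum
  \<open>S\<close> into \<open>S + \<bar>f y - f x\<bar>\<close>; passing to suprema shows that the
  cumulative variation dominates the increments.\<close>

lemma bounded_variation_imp_var_dom:
  assumes bv: "has_bounded_variation f a b" and ab: "a \<le> b"
  obtains v where "var_dom f v a b" "v b - v a \<le> total_variation f a b"
proof -
  have app: "S + \<bar>f y - f x\<bar> \<in> variation_sums f a y"
    if S: "S \<in> variation_sums f a x" and xy: "x \<le> y" for S x y
  proof -
    obtain n X where nX: "is_partition a x n X" "S = (\<Sum>i<n. \<bar>f (X (Suc i)) - f (X i)\<bar>)"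
      using S unfolding variation_sums_def by auto
    have "is_partition a y (Suc n) (X(Suc n := y))"
      using nX(1) xy by (auto simp: is_partition_def less_Suc_eq)
    moreover have "S + \<bar>f y - f x\<bar> = (\<Sum>i<Suc n. \<bar>f ((X(Suc n := y)) (Suc i)) - f ((X(Suc n := y)) i)\<bar>)"
      using nX by (auto simp: is_partition_def)
    ultimately show ?thesis unfolding variation_sums_def by blast
  qed
  have ne: "variation_sums f a x \<noteq> {}" if "a \<le> x" for x
  proof -
    have "is_partition a x 1 (\<lambda>i. if i = 0 then a else x)" using that by (auto simp: is_partition_def)
    then show ?thesis unfolding variation_sums_def by blast
  qed
  have bdd: "bdd_above (variation_sums f a x)" if "x \<le> b" for x
  proof -
    obtain K where K: "\<And>S. S \<in> variation_sums f a b \<Longrightarrow> S \<le> K"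
      using bv unfolding has_bounded_variation_def bdd_above_def by auto
    have "S \<le> K" if "S \<in> variation_sums f a x" for S
      using K[OF app[OF that \<open>x \<le> b\<close>]] by linarith
    then show ?thesis by (auto simp: bdd_above_def)
  qed
  define v where "v x = Sup (variation_sums f a x)" for x
  have "\<bar>f y - f x\<bar> \<le> v y - v x" if "a \<le> x" "x \<le> y" "y \<le> b" for x y
  proof -
    have "v x \<le> v y - \<bar>f y - f x\<bar>"
      unfolding v_def
    proof (rule cSup_least[OF ne[OF that(1)]])
      fix S assume "S \<in> variation_sums f a x"
      from cSup_upper[OF app[OF this that(2)] bdd[OF that(3)]]
      show "S \<le> Sup (variation_sums f a y) - \<bar>f y - f x\<bar>" by linarith
    qed
    then show ?thesis by linarith
  qed
  then have "var_dom f v a b" by (auto simp: var_dom_def)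
  \<comment> \<open>The partition without cells gives the variation sum 0 over [a, a]. This lower
    bound suffices, because \<open>v b\<close> is the total variation by definition.\<close>
  moreover have "0 \<le> v a"
  proof -
    have "is_partition a a 0 (\<lambda>i. a)" by (auto simp: is_partition_def)
    then have "0 \<in> variation_sums f a a"
      unfolding variation_sums_def by (auto intro!: exI[of _ "0::nat"])
    then show ?thesis unfolding v_def by (rule cSup_upper[OF _ bdd[OF ab]])
  qed
  then have "v b - v a \<le> total_variation f a b"
    by (simp add: v_def total_variation_def)
  ultimately show ?thesis by (rule that)
qed

section \<open>Tagged partitions and Stieltjes sums\<close>

lemma partition_mono:
  assumes "is_partition a b n x" "i \<le> j" "j \<le> n"
  shows "x i \<le> x j"
  using assms(2,3)
proof (induction j rule: dec_induct)
  case (step m)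
  then show ?case using assms(1) unfolding is_partition_def by (meson Suc_le_lessD Suc_leD order_trans)
qed simp

lemma partition_bounds:
  assumes "is_partition a b n x" "i \<le> n"
  shows "a \<le> x i" "x i \<le> b"
  using partition_mono[OF assms(1), of 0 i] partition_mono[OF assms(1), of i n] assms
  by (auto simp: is_partition_def)

definition fine_tagged :: "real \<Rightarrow> real \<Rightarrow> real \<Rightarrow> nat \<Rightarrow> (nat \<Rightarrow> real) \<Rightarrow> (nat \<Rightarrow> real) \<Rightarrow> bool" where
  "fine_tagged a b \<delta> n x \<xi> \<longleftrightarrow> is_partition a b n x
      \<and> (\<forall>i<n. x (Suc i) - x i < \<delta> \<and> x i \<le> \<xi> i \<and> \<xi> i \<le> x (Suc i))"

definition RS_sum ::
  "(real \<Rightarrow> 'x::real_normed_vector) \<Rightarrow> (real \<Rightarrow> real) \<Rightarrow> nat \<Rightarrow> (nat \<Rightarrow> real) \<Rightarrow> (nat \<Rightarrow> real) \<Rightarrow> 'x" where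
  "RS_sum f g n x \<xi> = (\<Sum>i<n. (g (x (Suc i)) - g (x i)) *\<^sub>R f (\<xi> i))"

lemma has_RS_integral_alt:
  "has_RS_integral f g a b I \<longleftrightarrow>
    (\<forall>\<epsilon>>0. \<exists>\<delta>>0. \<forall>n x \<xi>. fine_tagged a b \<delta> n x \<xi> \<longrightarrow> norm (RS_sum f g n x \<xi> - I) < \<epsilon>)"
  unfolding has_RS_integral_def fine_tagged_def RS_sum_def ..

lemma fine_tagged_mono: "fine_tagged a b \<delta> n x \<xi> \<Longrightarrow> \<delta> \<le> \<delta>' \<Longrightarrow> fine_tagged a b \<delta>' n x \<xi>"
  unfolding fine_tagged_def by fastforce

lemma fine_tagged_tag:
  assumes "fine_tagged a b \<delta> n x \<xi>" "i < n"
  shows "\<xi> i \<in> {a..b}"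
  using partition_bounds[of a b n x i] partition_bounds[of a b n x "Suc i"] assms
  unfolding fine_tagged_def by (auto intro: order_trans)

definition uniform_points :: "real \<Rightarrow> real \<Rightarrow> nat \<Rightarrow> nat \<Rightarrow> real" where
  "uniform_points a b N i = a + real i * (b - a) / real (Suc N)"

lemma uniform_fine_tagged:
  assumes "a \<le> b" "(b - a) / real (Suc N) < \<delta>"
  shows "fine_tagged a b \<delta> (Suc N) (uniform_points a b N) (uniform_points a b N)"
proof -
  have step: "uniform_points a b N (Suc i) - uniform_points a b N i = (b - a) / real (Suc N)" for i
    unfolding uniform_points_def of_nat_Suc[of i]
    by (simp add: distrib_right add_divide_distrib)
  have "0 \<le> (b - a) / real (Suc N)" using assms by simp
  then have "uniform_points a b N i \<le> uniform_points a b N (Suc i)" for i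
    using step[of i] by linarith
  then show ?thesis
    using assms(2) step unfolding fine_tagged_def is_partition_def
    by (auto simp: uniform_points_def[of a b N 0] uniform_points_def[of a b N "Suc N"])
qed

lemma eventually_mesh_small:
  assumes "(\<delta>::real) > 0"
  shows "eventually (\<lambda>N. c / real (Suc N) < \<delta>) sequentially"
proof -
  have "(\<lambda>N. c / real (Suc N)) \<longlonglongrightarrow> 0"
    using lim_const_over_n[of c] by (rule LIMSEQ_Suc)
  from order_tendstoD(2)[OF this assms] show ?thesis .
qed

lemma fine_tagged_exists:
  assumes "a \<le> b" "\<delta> > 0"
  obtains n x \<xi> where "fine_tagged a b \<delta> n x \<xi>"
  using eventually_happens'[OF sequentially_bot eventually_mesh_small[OF assms(2), of "b - a"]]
    uniform_fine_tagged[OF assms(1)] by blast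

lemma norm_RS_sum_le:
  assumes dom: "var_dom g v a b" and part: "fine_tagged a b \<delta> n x \<xi>"
    and C: "\<And>s. s \<in> {a..b} \<Longrightarrow> norm (f s) \<le> C" and ab: "a \<le> b"
  shows "norm (RS_sum f g n x \<xi>) \<le> C * (v b - v a)"
proof -
  have P: "is_partition a b n x" using part by (simp add: fine_tagged_def)
  have "norm (RS_sum f g n x \<xi>) \<le> (\<Sum>i<n. C * (v (x (Suc i)) - v (x i)))"
    unfolding RS_sum_def
  proof (rule sum_norm_le)
    fix i assume "i \<in> {..<n}"
    then have i: "i < n" by simp
    have "\<bar>g (x (Suc i)) - g (x i)\<bar> \<le> v (x (Suc i)) - v (x i)"
      using i P partition_bounds[OF P, of i] partition_bounds[OF P, of "Suc i"]
      by (intro var_domD[OF dom]) (auto simp: is_partition_def)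
    moreover have "norm (f (\<xi> i)) \<le> C" using C fine_tagged_tag[OF part i] by blast
    ultimately show "norm ((g (x (Suc i)) - g (x i)) *\<^sub>R f (\<xi> i)) \<le> C * (v (x (Suc i)) - v (x i))"
      using mult_mono[of "\<bar>g (x (Suc i)) - g (x i)\<bar>" "v (x (Suc i)) - v (x i)" "norm (f (\<xi> i))" C]
      by (simp add: mult.commute)
  qed
  also have "\<dots> = C * (v (x n) - v (x 0))"
    by (simp add: sum_distrib_left[symmetric] sum_lessThan_telescope[of "\<lambda>i. v (x i)"])
  finally show ?thesis using P by (simp add: is_partition_def)
qed

text \<open>Both sums are written over the pairs of cells of the two partitions, so that no common
  refinement is needed: clamping to the \<open>j\<close>-th cell splits the increments of \<open>g\<close>.\<close>

lemma RS_sum_diff_le: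
  fixes f :: "real \<Rightarrow> 'x::real_normed_vector"
  assumes dom: "var_dom g v a b"
    and X: "fine_tagged a b \<delta> n x \<xi>" and Y: "fine_tagged a b \<delta> m y \<zeta>"
    and osc: "\<And>s t. s \<in> {a..b} \<Longrightarrow> t \<in> {a..b} \<Longrightarrow> \<bar>s - t\<bar> < 2 * \<delta> \<Longrightarrow> norm (f s - f t) \<le> \<epsilon>"
  shows "norm (RS_sum f g n x \<xi> - RS_sum f g m y \<zeta>) \<le> \<epsilon> * (v b - v a)"
proof -
  have PX: "is_partition a b n x" and PY: "is_partition a b m y"
    using X Y by (auto simp: fine_tagged_def)
  define cl where "cl j s = max (y j) (min (y (Suc j)) s)" for j s
  \<comment> \<open>\<open>cl j\<close> projects onto the j-th cell of \<open>y\<close>, so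
    \<open>\<Delta> k i j\<close> is the increment of \<open>k\<close> over the common part of cell
    i of \<open>x\<close> and cell j of \<open>y\<close>, and 0 if the two do not overlap.\<close>
  define \<Delta> where "\<Delta> k i j = k (cl j (x (Suc i))) - k (cl j (x i))" for k :: "real \<Rightarrow> real" and i j
  have y_le: "y j \<le> y (Suc j)" "a \<le> y j" "y (Suc j) \<le> b" if "j < m" for j
    using that PY partition_bounds[OF PY, of j] partition_bounds[OF PY, of "Suc j"]
    by (auto simp: is_partition_def)
  have x_le: "x i \<le> x (Suc i)" "a \<le> x i" "x (Suc i) \<le> b" if "i < n" for i
    using that PX partition_bounds[OF PX, of i] partition_bounds[OF PX, of "Suc i"]
    by (auto simp: is_partition_def)
  \<comment> \<open>Each summand is the increment of \<open>k\<close> over the part of the j-th cell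
    that lies to the left of \<open>s\<close>, so the sum telescopes from \<open>a\<close> to
    \<open>s\<close>.\<close>
  have split_one: "(\<Sum>j<m. k (cl j s) - k (y j)) = k s - k a" if "s \<in> {a..b}" for s and k :: "real \<Rightarrow> real"
  proof -
    have "(\<Sum>j<m. k (cl j s) - k (y j)) = (\<Sum>j<m. k (min s (y (Suc j))) - k (min s (y j)))"
    proof (intro sum.cong refl)
      fix j assume "j \<in> {..<m}"
      then have "y j \<le> y (Suc j)" using y_le by simp
      then show "k (cl j s) - k (y j) = k (min s (y (Suc j))) - k (min s (y j))"
        unfolding cl_def by (auto simp: min_def max_def)
    qed
    also have "\<dots> = k (min s (y m)) - k (min s (y 0))" by (rule sum_lessThan_telescope)
    finally show ?thesis using that PY by (auto simp: is_partition_def)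
  qed
  have row: "(\<Sum>j<m. \<Delta> k i j) = k (x (Suc i)) - k (x i)" if "i < n" for k i
  proof -
    have "(\<Sum>j<m. \<Delta> k i j) = (\<Sum>j<m. k (cl j (x (Suc i))) - k (y j)) - (\<Sum>j<m. k (cl j (x i)) - k (y j))"
      unfolding \<Delta>_def sum_subtractf by simp
    also have "\<dots> = k (x (Suc i)) - k (x i)"
      using x_le[OF that] by (subst (1 2) split_one) auto
    finally show ?thesis .
  qed
  have col: "(\<Sum>i<n. \<Delta> k i j) = k (y (Suc j)) - k (y j)" if "j < m" for k j
  proof -
    have "(\<Sum>i<n. \<Delta> k i j) = k (cl j (x n)) - k (cl j (x 0))"
      unfolding \<Delta>_def by (rule sum_lessThan_telescope)
    moreover have "cl j (x n) = y (Suc j)" "cl j (x 0) = y j"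
      using PX y_le[OF that] by (auto simp: cl_def is_partition_def)
    ultimately show ?thesis by simp
  qed
  have sx: "RS_sum f g n x \<xi> = (\<Sum>i<n. \<Sum>j<m. \<Delta> g i j *\<^sub>R f (\<xi> i))"
    unfolding RS_sum_def by (intro sum.cong refl) (simp add: row[symmetric] scaleR_left.sum)
  have "RS_sum f g m y \<zeta> = (\<Sum>j<m. \<Sum>i<n. \<Delta> g i j *\<^sub>R f (\<zeta> j))"
    unfolding RS_sum_def by (intro sum.cong refl) (simp add: col[symmetric] scaleR_left.sum)
  then have sy: "RS_sum f g m y \<zeta> = (\<Sum>i<n. \<Sum>j<m. \<Delta> g i j *\<^sub>R f (\<zeta> j))"
    by (subst sum.swap)
  have "norm (RS_sum f g n x \<xi> - RS_sum f g m y \<zeta>)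
      = norm (\<Sum>i<n. \<Sum>j<m. \<Delta> g i j *\<^sub>R (f (\<xi> i) - f (\<zeta> j)))"
    unfolding sx sy by (simp add: sum_subtractf scaleR_right_diff_distrib)
  also have "\<dots> \<le> (\<Sum>i<n. \<Sum>j<m. \<epsilon> * \<Delta> v i j)"
  proof (intro sum_norm_le)
    fix i j assume "i \<in> {..<n}" "j \<in> {..<m}"
    then have i: "i < n" and j: "j < m" by auto
    have le: "cl j (x i) \<le> cl j (x (Suc i))" using x_le[OF i] by (auto simp: cl_def)
    show "norm (\<Delta> g i j *\<^sub>R (f (\<xi> i) - f (\<zeta> j))) \<le> \<epsilon> * \<Delta> v i j"
    proof (cases "cl j (x i) = cl j (x (Suc i))")
      case True
      then show ?thesis by (simp add: \<Delta>_def)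
    next
      case False
      \<comment> \<open>Distinct clamped endpoints mean that the two cells overlap. Both are shorter
        than \<open>\<delta>\<close>, which is where the \<open>2 * \<delta>\<close> in
        \<open>osc\<close> comes from.\<close>
      then have 1: "x i < y (Suc j)" "y j < x (Suc i)"
        using le y_le[OF j] x_le[OF i] unfolding cl_def by (auto simp: min_def max_def split: if_splits)
      have 2: "x (Suc i) - x i < \<delta>" "x i \<le> \<xi> i" "\<xi> i \<le> x (Suc i)"
        "y (Suc j) - y j < \<delta>" "y j \<le> \<zeta> j" "\<zeta> j \<le> y (Suc j)"
        using X Y i j by (auto simp: fine_tagged_def)
      have "norm (f (\<xi> i) - f (\<zeta> j)) \<le> \<epsilon>"
        using 1 2 by (intro osc fine_tagged_tag[OF X i] fine_tagged_tag[OF Y j]) linarith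
      moreover have "\<bar>\<Delta> g i j\<bar> \<le> \<Delta> v i j"
        unfolding \<Delta>_def using y_le[OF j] x_le[OF i] by (intro var_domD[OF dom] le) (auto simp: cl_def)
      ultimately show ?thesis
        using mult_mono[of "\<bar>\<Delta> g i j\<bar>" "\<Delta> v i j" "norm (f (\<xi> i) - f (\<zeta> j))" \<epsilon>]
        by (simp add: mult.commute)
    qed
  qed
  also have "\<dots> = \<epsilon> * (\<Sum>i<n. v (x (Suc i)) - v (x i))"
    by (simp add: sum_distrib_left[symmetric] row)
  also have "\<dots> = \<epsilon> * (v b - v a)"
    using PX by (simp add: sum_lessThan_telescope[of "\<lambda>i. v (x i)"] is_partition_def)
  finally show ?thesis .
qed

text \<open>The bound depends only on the oscillation of \<open>f\<close> at scale
  \<open>\<delta>\<close> and on the variation, not on how fast the sums for this particular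
  \<open>g\<close> converge: the given sum is compared with one that is near \<open>I\<close> and
  has mesh below \<open>\<delta>\<close> as well. This uniformity is what a limit over varying
  integrators requires.\<close>

lemma RS_sum_integral_diff_le:
  fixes f :: "real \<Rightarrow> 'x::real_normed_vector"
  assumes I: "has_RS_integral f g a b I" and dom: "var_dom g v a b" and ab: "a \<le> b" and \<delta>: "\<delta> > 0"
    and X: "fine_tagged a b \<delta> n x \<xi>"
    and osc: "\<And>s t. s \<in> {a..b} \<Longrightarrow> t \<in> {a..b} \<Longrightarrow> \<bar>s - t\<bar> < 2 * \<delta> \<Longrightarrow> norm (f s - f t) \<le> \<epsilon>"
  shows "norm (RS_sum f g n x \<xi> - I) \<le> \<epsilon> * (v b - v a)"
proof (rule field_le_epsilon)
  fix e :: real assume "e > 0"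
  then obtain d where d: "d > 0" "\<And>n x \<xi>. fine_tagged a b d n x \<xi> \<Longrightarrow> norm (RS_sum f g n x \<xi> - I) < e"
    using I unfolding has_RS_integral_alt by meson
  obtain m y \<zeta> where Y: "fine_tagged a b (min d \<delta>) m y \<zeta>"
    using fine_tagged_exists[OF ab, of "min d \<delta>"] d(1) \<delta> by auto
  have "norm (RS_sum f g m y \<zeta> - I) < e" by (rule d(2)) (rule fine_tagged_mono[OF Y], simp)
  moreover have "norm (RS_sum f g n x \<xi> - RS_sum f g m y \<zeta>) \<le> \<epsilon> * (v b - v a)"
    by (rule RS_sum_diff_le[OF dom X fine_tagged_mono[OF Y] osc]) auto
  ultimately show "norm (RS_sum f g n x \<xi> - I) \<le> \<epsilon> * (v b - v a) + e"
    using norm_triangle_ineq[of "RS_sum f g n x \<xi> - RS_sum f g m y \<zeta>" "RS_sum f g m y \<zeta> - I"] by simp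
qed

section \<open>The Stieltjes integral: uniqueness, bounds, existence and limits\<close>

lemma has_RS_integral_unique:
  assumes "has_RS_integral f g a b I" "has_RS_integral f g a b I'" "a \<le> b"
  shows "I = I'"
proof (rule ccontr)
  assume "I \<noteq> I'"
  then have e: "norm (I - I') / 2 > 0" by simp
  obtain d where d: "d > 0" "\<And>n x \<xi>. fine_tagged a b d n x \<xi> \<Longrightarrow> norm (RS_sum f g n x \<xi> - I) < norm (I - I') / 2"
    using assms(1) e unfolding has_RS_integral_alt by meson
  obtain d' where d': "d' > 0" "\<And>n x \<xi>. fine_tagged a b d' n x \<xi> \<Longrightarrow> norm (RS_sum f g n x \<xi> - I') < norm (I - I') / 2"
    using assms(2) e unfolding has_RS_integral_alt by meson
  obtain m y \<zeta> where Y: "fine_tagged a b (min d d') m y \<zeta>"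
    using fine_tagged_exists[OF assms(3), of "min d d'"] d(1) d'(1) by auto
  have "norm (RS_sum f g m y \<zeta> - I) < norm (I - I') / 2" "norm (RS_sum f g m y \<zeta> - I') < norm (I - I') / 2"
    by (rule d(2), rule fine_tagged_mono[OF Y], simp) (rule d'(2), rule fine_tagged_mono[OF Y], simp)
  then show False
    using norm_triangle_ineq4[of "RS_sum f g m y \<zeta> - I'" "RS_sum f g m y \<zeta> - I"] by simp
qed

lemma RS_integral_eqI:
  assumes "has_RS_integral f g a b I" "a \<le> b"
  shows "RS_integral f g a b = I"
  unfolding RS_integral_def using assms has_RS_integral_unique by blast

lemma has_RS_integral_bound:
  assumes I: "has_RS_integral f g a b I" and dom: "var_dom g v a b" and ab: "a \<le> b"
    and C: "\<And>s. s \<in> {a..b} \<Longrightarrow> norm (f s) \<le> C"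
  shows "norm I \<le> C * (v b - v a)"
proof (rule field_le_epsilon)
  fix e :: real assume "e > 0"
  then obtain d where d: "d > 0" "\<And>n x \<xi>. fine_tagged a b d n x \<xi> \<Longrightarrow> norm (RS_sum f g n x \<xi> - I) < e"
    using I unfolding has_RS_integral_alt by meson
  obtain m y \<zeta> where Y: "fine_tagged a b d m y \<zeta>"
    using fine_tagged_exists[OF ab d(1)] by auto
  show "norm I \<le> C * (v b - v a) + e"
    using norm_RS_sum_le[where f = f, OF dom Y C ab] d(2)[OF Y] norm_triangle_ineq4[of "RS_sum f g m y \<zeta>" "RS_sum f g m y \<zeta> - I"]
    by simp
qed

lemma has_RS_integral_add:
  assumes "has_RS_integral f g a b I" "has_RS_integral f g' a b I'"
  shows "has_RS_integral f (\<lambda>x. g x + g' x) a b (I + I')"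
  unfolding has_RS_integral_alt
proof (intro allI impI)
  fix e :: real assume "e > 0"
  then have e: "e / 2 > 0" by simp
  obtain d where d: "d > 0" "\<And>n x \<xi>. fine_tagged a b d n x \<xi> \<Longrightarrow> norm (RS_sum f g n x \<xi> - I) < e / 2"
    using assms(1) e unfolding has_RS_integral_alt by meson
  obtain d' where d': "d' > 0" "\<And>n x \<xi>. fine_tagged a b d' n x \<xi> \<Longrightarrow> norm (RS_sum f g' n x \<xi> - I') < e / 2"
    using assms(2) e unfolding has_RS_integral_alt by meson
  have "norm (RS_sum f (\<lambda>x. g x + g' x) n x \<xi> - (I + I')) < e" if Y: "fine_tagged a b (min d d') n x \<xi>" for n x \<xi>
  proof -
    have "norm (RS_sum f g n x \<xi> - I) < e / 2" "norm (RS_sum f g' n x \<xi> - I') < e / 2"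
      by (rule d(2), rule fine_tagged_mono[OF Y], simp) (rule d'(2), rule fine_tagged_mono[OF Y], simp)
    moreover have "RS_sum f (\<lambda>x. g x + g' x) n x \<xi> = RS_sum f g n x \<xi> + RS_sum f g' n x \<xi>"
      by (simp add: RS_sum_def sum.distrib[symmetric] algebra_simps)
    ultimately show ?thesis
      using norm_triangle_ineq[of "RS_sum f g n x \<xi> - I" "RS_sum f g' n x \<xi> - I'"] by (simp add: algebra_simps)
  qed
  then show "\<exists>\<delta>>0. \<forall>n x \<xi>. fine_tagged a b \<delta> n x \<xi> \<longrightarrow> norm (RS_sum f (\<lambda>x. g x + g' x) n x \<xi> - (I + I')) < e"
    using d(1) d'(1) by (intro exI[of _ "min d d'"]) auto
qed

lemma uniform_oscillation:
  fixes f :: "real \<Rightarrow> 'x::real_normed_vector"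
  assumes "continuous_on {a..b} f" "\<epsilon> > 0"
  obtains \<delta> where "\<delta> > 0" "\<And>s t. s \<in> {a..b} \<Longrightarrow> t \<in> {a..b} \<Longrightarrow> \<bar>s - t\<bar> < 2 * \<delta> \<Longrightarrow> norm (f s - f t) \<le> \<epsilon>"
proof -
  have "uniformly_continuous_on {a..b} f"
    using assms(1) by (intro compact_uniformly_continuous) auto
  then obtain d where d: "d > 0" "\<And>s t. s \<in> {a..b} \<Longrightarrow> t \<in> {a..b} \<Longrightarrow> dist t s < d \<Longrightarrow> dist (f t) (f s) < \<epsilon>"
    using assms(2) unfolding uniformly_continuous_on_def by meson
  show ?thesis
    by (rule that[of "d / 2"]) (use d in \<open>auto simp: dist_norm intro: less_imp_le\<close>)
qed

lemma has_RS_integral_exists: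
  fixes f :: "real \<Rightarrow> 'x::banach"
  assumes f: "continuous_on {a..b} f" and dom: "var_dom g v a b" and ab: "a \<le> b"
  obtains I where "has_RS_integral f g a b I"
proof -
  define S where "S N = RS_sum f g (Suc N) (uniform_points a b N) (uniform_points a b N)" for N
  have V: "0 \<le> v b - v a" using var_domD[OF dom, of a b] ab by auto
  have small: "\<exists>\<delta>>0. \<forall>n x \<xi> m y \<zeta>. fine_tagged a b \<delta> n x \<xi> \<longrightarrow> fine_tagged a b \<delta> m y \<zeta> \<longrightarrow>
     norm (RS_sum f g n x \<xi> - RS_sum f g m y \<zeta>) < e" if "e > 0" for e
  proof -
    \<comment> \<open>Adding 1 keeps the denominator positive when the variation is zero and makes
      the resulting inequality strict.\<close>
    have e': "e / (2 * (v b - v a + 1)) > 0" using that V by simp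
    from uniform_oscillation[OF f e'] obtain \<delta> where \<delta>: "\<delta> > 0"
      "\<And>s t. s \<in> {a..b} \<Longrightarrow> t \<in> {a..b} \<Longrightarrow> \<bar>s - t\<bar> < 2 * \<delta> \<Longrightarrow> norm (f s - f t) \<le> e / (2 * (v b - v a + 1))"
      by metis
    have lt: "e / (2 * (v b - v a + 1)) * (v b - v a) < e"
    proof -
      have "e * (v b - v a) < e * (2 * (v b - v a + 1))"
        using V that by (intro mult_strict_left_mono) auto
      then show ?thesis using V by (simp add: divide_less_eq)
    qed
    show ?thesis
    proof (intro exI[of _ \<delta>] conjI allI impI)
      fix n x \<xi> m y \<zeta> assume "fine_tagged a b \<delta> n x \<xi>" "fine_tagged a b \<delta> m y \<zeta>"
      from RS_sum_diff_le[where f = f, OF dom this \<delta>(2)] lt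
      show "norm (RS_sum f g n x \<xi> - RS_sum f g m y \<zeta>) < e" by linarith
    qed (rule \<delta>(1))
  qed
  have "Cauchy S"
  proof (rule CauchyI)
    fix e :: real assume "e > 0"
    from small[OF this] obtain \<delta> where \<delta>: "\<delta> > 0" "\<And>n x \<xi> m y \<zeta>. fine_tagged a b \<delta> n x \<xi> \<Longrightarrow> fine_tagged a b \<delta> m y \<zeta> \<Longrightarrow>
     norm (RS_sum f g n x \<xi> - RS_sum f g m y \<zeta>) < e" by meson
    obtain M where "\<And>N. N \<ge> M \<Longrightarrow> (b - a) / real (Suc N) < \<delta>"
      using eventually_mesh_small[OF \<delta>(1), of "b - a"] unfolding eventually_sequentially by auto
    then show "\<exists>M. \<forall>m\<ge>M. \<forall>n\<ge>M. norm (S m - S n) < e"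
      unfolding S_def using \<delta>(2) uniform_fine_tagged[OF ab] by blast
  qed
  then obtain I where I: "S \<longlonglongrightarrow> I" using convergent_eq_Cauchy by blast
  have "has_RS_integral f g a b I"
    unfolding has_RS_integral_alt
  proof (intro allI impI)
    fix e :: real assume "e > 0"
    then have "e / 2 > 0" by simp
    from small[OF this] obtain \<delta> where \<delta>: "\<delta> > 0" "\<And>n x \<xi> m y \<zeta>. fine_tagged a b \<delta> n x \<xi> \<Longrightarrow> fine_tagged a b \<delta> m y \<zeta> \<Longrightarrow>
     norm (RS_sum f g n x \<xi> - RS_sum f g m y \<zeta>) < e / 2" by meson
    have "norm (RS_sum f g n x \<xi> - I) < e" if "fine_tagged a b \<delta> n x \<xi>" for n x \<xi>
    proof -
      have "norm (RS_sum f g n x \<xi> - I) \<le> e / 2"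
      proof (rule tendsto_upperbound)
        show "(\<lambda>N. norm (RS_sum f g n x \<xi> - S N)) \<longlonglongrightarrow> norm (RS_sum f g n x \<xi> - I)"
          by (intro tendsto_intros I)
        show "\<forall>\<^sub>F N in sequentially. norm (RS_sum f g n x \<xi> - S N) \<le> e / 2"
          using eventually_mesh_small[OF \<delta>(1), of "b - a"]
          by eventually_elim (use \<delta>(2)[OF that] uniform_fine_tagged[OF ab] in \<open>auto simp: S_def intro: less_imp_le\<close>)
      qed simp
      then show ?thesis using \<open>e > 0\<close> by linarith
    qed
    then show "\<exists>\<delta>>0. \<forall>n x \<xi>. fine_tagged a b \<delta> n x \<xi> \<longrightarrow> norm (RS_sum f g n x \<xi> - I) < e"
      using \<delta>(1) by blast
  qed
  then show ?thesis by (rule that)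
qed

text \<open>One tagged partition is fixed for the limit and for the tail of the sequence. Its sums
  approximate all these integrals with errors controlled by \<open>M\<close>, and for a fixed
  partition the sums converge because only finitely many values of \<open>gs n\<close> and
  \<open>F n\<close> enter.\<close>

lemma has_RS_integral_limit:
  fixes f :: "real \<Rightarrow> 'x::real_normed_vector"
  assumes ab: "a \<le> b" and f: "continuous_on {a..b} f" and unif: "uniform_limit {a..b} F f sequentially"
    and dom: "var_dom g v a b" and doms: "\<And>n. var_dom (gs n) (vs n) a b"
    and V: "v b - v a \<le> M" "\<And>n. vs n b - vs n a \<le> M"
    and lim: "\<And>x. x \<in> {a..b} \<Longrightarrow> (\<lambda>n. gs n x) \<longlonglongrightarrow> g x"
    and I: "has_RS_integral f g a b I" and Is: "\<And>n. has_RS_integral (F n) (gs n) a b (Is n)"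
  shows "Is \<longlonglongrightarrow> I"
proof (rule tendstoI)
  fix e0 :: real assume e0: "e0 > 0"
  have M0: "0 \<le> M" using V(1) var_domD[OF dom, of a b] ab by auto
  \<comment> \<open>The three errors below add up to less than \<open>e + e * M + 3 * e * M\<close>,
    which is below \<open>e * (5 * (M + 1))\<close>.\<close>
  define e where "e = e0 / (5 * (M + 1))"
  have e: "e > 0" using e0 M0 by (simp add: e_def)
  from uniform_oscillation[OF f e] obtain \<delta> where \<delta>: "\<delta> > 0"
    "\<And>s t. s \<in> {a..b} \<Longrightarrow> t \<in> {a..b} \<Longrightarrow> \<bar>s - t\<bar> < 2 * \<delta> \<Longrightarrow> norm (f s - f t) \<le> e" by metis
  obtain n x \<xi> where X: "fine_tagged a b \<delta> n x \<xi>" using fine_tagged_exists[OF ab \<delta>(1)] by auto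
  have P: "is_partition a b n x" using X by (simp add: fine_tagged_def)
  have 1: "norm (RS_sum f g n x \<xi> - I) \<le> e * M"
    using RS_sum_integral_diff_le[OF I dom ab \<delta>(1) X \<delta>(2)] V(1) e
    by (meson order_trans mult_left_mono less_imp_le)
  have "(\<lambda>N. RS_sum (F N) (gs N) n x \<xi>) \<longlonglongrightarrow> RS_sum f g n x \<xi>"
    unfolding RS_sum_def
  proof (intro tendsto_intros lim)
    fix i assume "i \<in> {..<n}"
    then have i: "i < n" by simp
    show "x (Suc i) \<in> {a..b}" "x i \<in> {a..b}"
      using i partition_bounds[OF P, of i] partition_bounds[OF P, of "Suc i"] by auto
    show "(\<lambda>N. F N (\<xi> i)) \<longlonglongrightarrow> f (\<xi> i)"
      by (rule tendsto_uniform_limitI[OF unif fine_tagged_tag[OF X i]])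
  qed
  from tendstoD[OF this e] have 2: "\<forall>\<^sub>F N in sequentially. dist (RS_sum (F N) (gs N) n x \<xi>) (RS_sum f g n x \<xi>) < e" .
  have "\<forall>\<^sub>F N in sequentially. \<forall>s\<in>{a..b}. dist (F N s) (f s) < e"
    using unif e by (simp add: uniform_limit_iff)
  with 2 show "\<forall>\<^sub>F N in sequentially. dist (Is N) I < e0"
  proof eventually_elim
    case (elim N)
    \<comment> \<open>The oscillation \<open>e\<close> of \<open>f\<close> plus two errors of
      uniform approximation.\<close>
    have osc: "norm (F N s - F N t) \<le> 3 * e" if "s \<in> {a..b}" "t \<in> {a..b}" "\<bar>s - t\<bar> < 2 * \<delta>" for s t
    proof -
      have "norm (F N s - f s) < e" "norm (F N t - f t) < e" using elim(2) that by (auto simp: dist_norm)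
      moreover have "F N s - F N t = (F N s - f s) + (f s - f t) - (F N t - f t)" by simp
      ultimately show ?thesis using \<delta>(2)[OF that]
        by (smt (verit) norm_triangle_ineq norm_triangle_ineq4)
    qed
    have "norm (RS_sum (F N) (gs N) n x \<xi> - Is N) \<le> 3 * e * (vs N b - vs N a)"
      by (rule RS_sum_integral_diff_le[OF Is doms ab \<delta>(1) X osc])
    also have "\<dots> \<le> 3 * e * M" using V(2) e by (simp add: mult_left_mono)
    finally have 3: "norm (RS_sum (F N) (gs N) n x \<xi> - Is N) \<le> 3 * e * M" .
    have "Is N - I = (RS_sum (F N) (gs N) n x \<xi> - RS_sum f g n x \<xi>) + (RS_sum f g n x \<xi> - I) - (RS_sum (F N) (gs N) n x \<xi> - Is N)"
      by simp
    then have "norm (Is N - I) < e + e * M + 3 * e * M"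
      using 1 3 elim(1) norm_triangle_ineq norm_triangle_ineq4 unfolding dist_norm
      by (smt (verit))
    also have "\<dots> < e0"
    proof -
      have "e * (5 * (M + 1)) = e0" using M0 by (simp add: e_def)
      moreover have "0 \<le> e * M" using e M0 by simp
      ultimately show ?thesis using e by (simp add: algebra_simps)
    qed
    finally show ?case by (simp add: dist_norm)
  qed
qed

section \<open>The jump part\<close>

text \<open>A criterion for recognising an indefinite integral \<open>H\<close>: if on short cells
  its increment misses the Stieltjes term by at most \<open>\<epsilon>\<close> times the increment
  of some \<open>V\<close>, then summing over the cells telescopes both \<open>H\<close> and
  \<open>V\<close>.\<close>

lemma has_RS_integral_telescope:
  assumes est: "\<And>\<epsilon>. \<epsilon> > 0 \<Longrightarrow> \<exists>\<delta>>0. \<forall>x z \<xi>. a \<le> x \<and> x \<le> \<xi> \<and> \<xi> \<le> z \<and> z \<le> b \<and> z - x < \<delta> \<longrightarrow>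
        norm (H z - H x - (g z - g x) *\<^sub>R f \<xi>) \<le> \<epsilon> * (V z - V x)"
    and V: "0 \<le> V b - V a"
  shows "has_RS_integral f g a b (H b - H a)"
  unfolding has_RS_integral_alt
proof (intro allI impI)
  fix e :: real assume e: "e > 0"
  define e' where "e' = e / (2 * (V b - V a + 1))"
  have e': "e' > 0" using e V by (simp add: e'_def)
  have lt: "e' * (V b - V a) < e"
  proof -
    have "e * (V b - V a) < e * (2 * (V b - V a + 1))"
      using V e by (intro mult_strict_left_mono) auto
    then show ?thesis using V by (simp add: e'_def divide_less_eq)
  qed
  obtain \<delta> where \<delta>: "\<delta> > 0" "\<And>x z \<xi>. a \<le> x \<Longrightarrow> x \<le> \<xi> \<Longrightarrow> \<xi> \<le> z \<Longrightarrow> z \<le> b \<Longrightarrow> z - x < \<delta> \<Longrightarrow>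
        norm (H z - H x - (g z - g x) *\<^sub>R f \<xi>) \<le> e' * (V z - V x)"
    using est[OF e'] by blast
  have "norm (RS_sum f g n x \<xi> - (H b - H a)) < e" if X: "fine_tagged a b \<delta> n x \<xi>" for n x \<xi>
  proof -
    have P: "is_partition a b n x" using X by (simp add: fine_tagged_def)
    have "H b - H a = (\<Sum>i<n. H (x (Suc i)) - H (x i))"
      using P by (simp add: sum_lessThan_telescope[of "\<lambda>i. H (x i)"] is_partition_def)
    then have "norm (RS_sum f g n x \<xi> - (H b - H a))
        = norm (\<Sum>i<n. H (x (Suc i)) - H (x i) - (g (x (Suc i)) - g (x i)) *\<^sub>R f (\<xi> i))"
      by (simp add: RS_sum_def sum_subtractf norm_minus_commute)
    also have "\<dots> \<le> (\<Sum>i<n. e' * (V (x (Suc i)) - V (x i)))"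
    proof (rule sum_norm_le)
      fix i assume "i \<in> {..<n}"
      then show "norm (H (x (Suc i)) - H (x i) - (g (x (Suc i)) - g (x i)) *\<^sub>R f (\<xi> i)) \<le> e' * (V (x (Suc i)) - V (x i))"
        using X partition_bounds[OF P, of i] partition_bounds[OF P, of "Suc i"]
        by (intro \<delta>(2)) (auto simp: fine_tagged_def)
    qed
    also have "\<dots> = e' * (V b - V a)"
      using P by (simp add: sum_distrib_left[symmetric] sum_lessThan_telescope[of "\<lambda>i. V (x i)"] is_partition_def)
    finally show ?thesis using lt by linarith
  qed
  then show "\<exists>\<delta>>0. \<forall>n x \<xi>. fine_tagged a b \<delta> n x \<xi> \<longrightarrow> norm (RS_sum f g n x \<xi> - (H b - H a)) < e"
    using \<delta>(1) by blast
qed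

text \<open>\<open>c\<close> stands for right jumps and \<open>d\<close> for left jumps. A right
  jump at \<open>x\<close> is felt only after \<open>x\<close>, a left jump already at
  \<open>x\<close>, which explains the two kinds of half-open intervals.\<close>

lemma infsum_increment:
  fixes c d :: "real \<Rightarrow> 'y::banach"
  assumes c: "c summable_on UNIV" and d: "d summable_on UNIV" and xz: "x \<le> z"
  shows "(infsum c {..<z} + infsum d {..z}) - (infsum c {..<x} + infsum d {..x})
      = infsum c {x..<z} + infsum d {x<..z}"
proof -
  have s: "c summable_on A" "d summable_on A" for A
    using summable_on_subset_banach[OF c] summable_on_subset_banach[OF d] by auto
  have "{..<z} = {..<x} \<union> {x..<z}" "{..z} = {..x} \<union> {x<..z}" using xz by auto
  moreover have "infsum c ({..<x} \<union> {x..<z}) = infsum c {..<x} + infsum c {x..<z}"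
    by (intro infsum_Un_disjoint s) auto
  moreover have "infsum d ({..x} \<union> {x<..z}) = infsum d {..x} + infsum d {x<..z}"
    by (intro infsum_Un_disjoint s) auto
  ultimately show ?thesis by simp
qed

lemma abs_summable_scaleR_bounded:
  fixes c :: "'i \<Rightarrow> real" and F :: "'i \<Rightarrow> 'x::real_normed_vector"
  assumes "c summable_on S" "\<And>y. y \<in> S \<Longrightarrow> norm (F y) \<le> K"
  shows "(\<lambda>y. norm (c y *\<^sub>R F y)) summable_on S"
proof -
  have "(\<lambda>y. K * c y) summable_on S" using assms(1) by (rule summable_on_cmult_right)
  then have Kc: "(\<lambda>y. norm (K * c y)) summable_on S"
    by (rule iffD1[OF summable_on_iff_abs_summable_on_real])
  show ?thesis
  proof (rule Infinite_Sum.abs_summable_on_comparison_test[OF Kc])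
    fix y assume "y \<in> S"
    with assms(2) have "norm (F y) \<le> \<bar>K\<bar>" by fastforce
    then show "norm (c y *\<^sub>R F y) \<le> norm (K * c y)"
      using mult_right_mono[of "norm (F y)" "\<bar>K\<bar>" "\<bar>c y\<bar>"] by (simp add: abs_mult mult.commute)
  qed
qed

text \<open>In one cell of a partition, \<open>S\<close> holds the jump points, \<open>c\<close> the
  jumps, \<open>F\<close> the integrand and \<open>q\<close> its value at the tag.\<close>

lemma norm_infsum_scaleR_diff_le:
  fixes c :: "'i \<Rightarrow> real" and F :: "'i \<Rightarrow> 'x::banach"
  assumes c: "c summable_on S" and K: "\<And>y. y \<in> S \<Longrightarrow> norm (F y) \<le> K"
    and q: "\<And>y. y \<in> S \<Longrightarrow> norm (F y - q) \<le> \<epsilon>"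
  shows "norm (infsum (\<lambda>y. c y *\<^sub>R F y) S - infsum c S *\<^sub>R q) \<le> \<epsilon> * infsum (\<lambda>y. \<bar>c y\<bar>) S"
proof -
  have 1: "((\<lambda>y. c y *\<^sub>R F y) has_sum infsum (\<lambda>y. c y *\<^sub>R F y) S) S"
    using abs_summable_summable[OF abs_summable_scaleR_bounded[OF c K]] by simp
  have 2: "((\<lambda>y. c y *\<^sub>R q) has_sum infsum c S *\<^sub>R q) S"
    using has_sum_bounded_linear[OF bounded_linear_scaleR_left has_sum_infsum[OF c]] .
  have abs: "(\<lambda>y. \<bar>c y\<bar>) summable_on S"
    using c summable_on_iff_abs_summable_on_real[of c S] by simp
  show ?thesis
  proof (rule norm_infsum_le)
    show "((\<lambda>y. c y *\<^sub>R F y + - (c y *\<^sub>R q)) has_sum (infsum (\<lambda>y. c y *\<^sub>R F y) S - infsum c S *\<^sub>R q)) S"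
      using has_sum_add[OF 1, of "\<lambda>y. - (c y *\<^sub>R q)" "- (infsum c S *\<^sub>R q)"] 2
      by (simp add: has_sum_uminus)
    show "((\<lambda>y. \<epsilon> * \<bar>c y\<bar>) has_sum (\<epsilon> * infsum (\<lambda>y. \<bar>c y\<bar>) S)) S"
      by (intro has_sum_cmult_right has_sum_infsum abs)
    show "norm (c y *\<^sub>R F y + - (c y *\<^sub>R q)) \<le> \<epsilon> * \<bar>c y\<bar>" if "y \<in> S" for y
    proof -
      have "c y *\<^sub>R F y + - (c y *\<^sub>R q) = c y *\<^sub>R (F y - q)" by (simp add: scaleR_right_diff_distrib)
      then show ?thesis using mult_right_mono[OF q[OF that], of "\<bar>c y\<bar>"] by (simp add: mult.commute)
    qed
  qed
qed

text \<open>The points \<open>q k\<close> may coincide, so the left-hand side collects masses by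
  location and the right-hand side by index. The exchange of the two summations is Fubini for a
  double family supported on the graph of \<open>q\<close>.\<close>

lemma infsum_point_masses:
  fixes h q :: "nat \<Rightarrow> real" and F :: "real \<Rightarrow> 'x::banach"
  assumes h: "summable (\<lambda>k. \<bar>h k\<bar>)" and q: "\<And>k. q k \<in> A" and K: "\<And>y. y \<in> A \<Longrightarrow> norm (F y) \<le> K"
  shows "infsum (\<lambda>y. (\<Sum>k. if y = q k then h k else 0) *\<^sub>R F y) A = (\<Sum>k. h k *\<^sub>R F (q k))"
proof -
  define m where "m k y = (if y = q k then h k *\<^sub>R F y else 0)" for k y
  have hF: "summable (\<lambda>k. norm (h k *\<^sub>R F (q k)))"
  proof (rule summable_comparison_test[OF _ summable_mult[OF h, of K]])
    show "\<exists>N. \<forall>n\<ge>N. norm (norm (h n *\<^sub>R F (q n))) \<le> K * \<bar>h n\<bar>"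
      using mult_right_mono[OF K[OF q] abs_ge_zero] by (intro exI[of _ 0]) (simp add: mult.commute)
  qed
  have hFs: "(\<lambda>k. h k *\<^sub>R F (q k)) summable_on UNIV" by (rule norm_summable_imp_summable_on[OF hF])
  have "(\<lambda>(k, y). m k y) summable_on UNIV \<times> A"
  proof -
    \<comment> \<open>On the graph the first coordinate determines the point, so summability of the
      double family is that of the absolutely convergent series.\<close>
    have "(\<lambda>(k, y). m k y) summable_on (\<lambda>k. (k, q k)) ` UNIV"
      by (subst summable_on_reindex) (auto simp: inj_on_def o_def m_def hFs)
    moreover have "(\<lambda>(k, y). m k y) summable_on UNIV \<times> A \<longleftrightarrow> (\<lambda>(k, y). m k y) summable_on (\<lambda>k. (k, q k)) ` UNIV"
      by (rule summable_on_cong_neutral) (use q in \<open>auto simp: m_def\<close>)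
    ultimately show ?thesis by simp
  qed
  then have swap: "(\<Sum>\<^sub>\<infinity>k. \<Sum>\<^sub>\<infinity>y\<in>A. m k y) = (\<Sum>\<^sub>\<infinity>y\<in>A. \<Sum>\<^sub>\<infinity>k. m k y)" by (rule infsum_swap_banach)
  have "(\<Sum>\<^sub>\<infinity>y\<in>A. m k y) = h k *\<^sub>R F (q k)" for k
  proof -
    have "(\<Sum>\<^sub>\<infinity>y\<in>A. m k y) = (\<Sum>\<^sub>\<infinity>y\<in>{q k}. m k y)"
      by (rule infsum_cong_neutral) (use q in \<open>auto simp: m_def\<close>)
    then show ?thesis by (simp add: m_def)
  qed
  moreover have "(\<Sum>\<^sub>\<infinity>k. m k y) = (\<Sum>k. if y = q k then h k else 0) *\<^sub>R F y" for y
  proof -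
    have sy: "summable (\<lambda>k. norm (if y = q k then h k else 0))"
      by (rule summable_comparison_test[OF _ h]) (auto intro!: exI[of _ 0])
    then have "((\<lambda>k. if y = q k then h k else 0) has_sum (\<Sum>k. if y = q k then h k else 0)) UNIV"
      by (intro norm_summable_imp_has_sum summable_sums summable_norm_cancel[OF sy])
    from has_sum_bounded_linear[OF bounded_linear_scaleR_left[of "F y"] this]
    have "((\<lambda>k. (if y = q k then h k else 0) *\<^sub>R F y) has_sum (\<Sum>k. if y = q k then h k else 0) *\<^sub>R F y) UNIV" .
    moreover have "(\<lambda>k. (if y = q k then h k else 0) *\<^sub>R F y) = (\<lambda>k. m k y)" by (auto simp: m_def)
    ultimately show ?thesis by (simp add: infsumI)
  qed
  moreover have "(\<Sum>\<^sub>\<infinity>k. h k *\<^sub>R F (q k)) = (\<Sum>k. h k *\<^sub>R F (q k))"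
    by (intro infsumI norm_summable_imp_has_sum hF summable_sums summable_norm_cancel[OF hF])
  ultimately show ?thesis using swap by simp
qed

section \<open>One-sided jumps of a function of bounded variation\<close>

lemma mono_imp_one_sided_limits:
  fixes h :: "real \<Rightarrow> real"
  assumes "mono h"
  shows "(h \<longlongrightarrow> Lim (at_right y) h) (at_right y)" "(h \<longlongrightarrow> Lim (at_left y) h) (at_left y)"
proof -
  have "(h \<longlongrightarrow> Inf (h ` ({y<..} \<inter> UNIV))) (at y within ({y<..} \<inter> UNIV))"
    by (rule Lim_right_bound[where K = "h y"]) (auto intro: monoD[OF assms])
  then have l: "(h \<longlongrightarrow> Inf (h ` {y<..})) (at_right y)" by simp
  with tendsto_Lim[OF trivial_limit_at_right_real l]
  show "(h \<longlongrightarrow> Lim (at_right y) h) (at_right y)" by simp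
  have "(h \<longlongrightarrow> Sup (h ` ({..<y} \<inter> UNIV))) (at y within ({..<y} \<inter> UNIV))"
    by (rule Lim_left_bound[where K = "h y"]) (auto intro: monoD[OF assms])
  then have l: "(h \<longlongrightarrow> Sup (h ` {..<y})) (at_left y)" by simp
  with tendsto_Lim[OF trivial_limit_at_left_real l]
  show "(h \<longlongrightarrow> Lim (at_left y) h) (at_left y)" by simp
qed

text \<open>Both functions are extended beyond [a, b] by their endpoint values, as
  \<open>jump_at\<close> and \<open>jump_part\<close> do for \<open>f\<close>. Jumps at the
  endpoints are then one-sided, and there are none outside [a, b].\<close>

locale bv_function =
  fixes f v :: "real \<Rightarrow> real" and a b :: real
  assumes ab: "a < b" and dom: "var_dom f v a b"
begin

definition e where "e = ext_clamp f a b"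
definition w where "w = ext_clamp v a b"
definition right_jump where "right_jump y = Lim (at_right y) e - e y"
definition left_jump where "left_jump y = e y - Lim (at_left y) e"
definition wr where "wr y = Lim (at_right y) w"
definition wl where "wl y = Lim (at_left y) w"
text \<open>The full jump of the monotone function \<open>w\<close> at \<open>y\<close>. It
  dominates the two one-sided jumps of \<open>e\<close> together, and monotonicity lets its sums be
  estimated by telescoping.\<close>

definition D where "D y = wr y - wl y"

lemma e_le: "x \<le> y \<Longrightarrow> \<bar>e y - e x\<bar> \<le> w y - w x"
  unfolding e_def w_def ext_clamp_def using ab by (intro var_domD[OF dom]) auto

lemma mono_w: "mono w"
  using e_le by (intro monoI) fastforce

lemma tendsto_w: "(w \<longlongrightarrow> wr y) (at_right y)" "(w \<longlongrightarrow> wl y) (at_left y)"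
  using mono_imp_one_sided_limits[OF mono_w] by (auto simp: wr_def wl_def)

text \<open>Jordan decomposition: \<open>e\<close> is the difference of the monotone functions
  \<open>e + w\<close> and \<open>w\<close>, so the limits named by \<open>Lim\<close> in the jumps
  really exist.\<close>

lemma tendsto_e: "(e \<longlongrightarrow> e y + right_jump y) (at_right y)" "(e \<longlongrightarrow> e y - left_jump y) (at_left y)"
proof -
  have m: "mono (\<lambda>x. e x + w x)" using e_le by (intro monoI) (smt (verit))
  have "((\<lambda>x. e x + w x - w x) \<longlongrightarrow> Lim (at_right y) (\<lambda>x. e x + w x) - wr y) (at_right y)"
    by (intro tendsto_diff mono_imp_one_sided_limits[OF m] tendsto_w)
  then have l: "(e \<longlongrightarrow> Lim (at_right y) (\<lambda>x. e x + w x) - wr y) (at_right y)" by simp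
  with tendsto_Lim[OF trivial_limit_at_right_real l]
  show "(e \<longlongrightarrow> e y + right_jump y) (at_right y)" by (simp add: right_jump_def)
  have "((\<lambda>x. e x + w x - w x) \<longlongrightarrow> Lim (at_left y) (\<lambda>x. e x + w x) - wl y) (at_left y)"
    by (intro tendsto_diff mono_imp_one_sided_limits[OF m] tendsto_w)
  then have l: "(e \<longlongrightarrow> Lim (at_left y) (\<lambda>x. e x + w x) - wl y) (at_left y)" by simp
  with tendsto_Lim[OF trivial_limit_at_left_real l]
  show "(e \<longlongrightarrow> e y - left_jump y) (at_left y)" by (simp add: left_jump_def)
qed

lemma wr_le: "x < z \<Longrightarrow> wr x \<le> w z"
  by (rule tendsto_upperbound[OF tendsto_w(1) eventually_mono[OF eventually_at_right_real]])
    (auto intro: monoD[OF mono_w])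

lemma le_wl: "x < z \<Longrightarrow> w x \<le> wl z"
  by (rule tendsto_lowerbound[OF tendsto_w(2) eventually_mono[OF eventually_at_left_real]])
    (auto intro: monoD[OF mono_w])

lemma wr_le_wl: "x < z \<Longrightarrow> wr x \<le> wl z"
  using wr_le[of x "(x + z) / 2"] le_wl[of "(x + z) / 2" z] by simp

lemma abs_right_jump_le: "\<bar>right_jump y\<bar> \<le> wr y - w y"
proof -
  have "((\<lambda>x. \<bar>e x - e y\<bar>) \<longlongrightarrow> \<bar>e y + right_jump y - e y\<bar>) (at_right y)"
    by (intro tendsto_intros tendsto_e)
  moreover have "((\<lambda>x. w x - w y) \<longlongrightarrow> wr y - w y) (at_right y)"
    by (intro tendsto_intros tendsto_w)
  moreover have "\<forall>\<^sub>F x in at_right y. \<bar>e x - e y\<bar> \<le> w x - w y"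
    by (rule eventually_mono[OF eventually_at_right_real[of y "y + 1"]]) (auto intro: e_le)
  ultimately have "\<bar>e y + right_jump y - e y\<bar> \<le> wr y - w y"
    by (intro tendsto_le[OF trivial_limit_at_right_real])
  then show ?thesis by simp
qed

lemma abs_left_jump_le: "\<bar>left_jump y\<bar> \<le> w y - wl y"
proof -
  have "((\<lambda>x. \<bar>e y - e x\<bar>) \<longlongrightarrow> \<bar>e y - (e y - left_jump y)\<bar>) (at_left y)"
    by (intro tendsto_intros tendsto_e)
  moreover have "((\<lambda>x. w y - w x) \<longlongrightarrow> w y - wl y) (at_left y)"
    by (intro tendsto_intros tendsto_w)
  moreover have "\<forall>\<^sub>F x in at_left y. \<bar>e y - e x\<bar> \<le> w y - w x"
    by (rule eventually_mono[OF eventually_at_left_real[of "y - 1" y]]) (auto intro: e_le)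
  ultimately have "\<bar>e y - (e y - left_jump y)\<bar> \<le> w y - wl y"
    by (intro tendsto_le[OF trivial_limit_at_left_real])
  then show ?thesis by simp
qed

lemma abs_jumps_le: "\<bar>right_jump y\<bar> + \<bar>left_jump y\<bar> \<le> D y"
  using abs_right_jump_le[of y] abs_left_jump_le[of y] by (simp add: D_def)

lemma D_nonneg: "0 \<le> D y"
  using abs_jumps_le[of y] by linarith

text \<open>Induction on the largest point \<open>y\<close>: the points below it contribute at most
  \<open>wl y - wr x\<close>, the jump at \<open>y\<close> raises this to
  \<open>wr y - wr x\<close>, and \<open>w\<close> does not decrease between \<open>y\<close> and
  \<open>z\<close>. Excluding the jumps of \<open>w\<close> at \<open>x\<close> and \<open>z\<close>
  from the bound makes it tend to 0 when the interval shrinks to one of its endpoints.\<close>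

lemma sum_D_le:
  assumes "finite F" "F \<subseteq> {x<..<z}" "x < z"
  shows "sum D F \<le> wl z - wr x"
  using assms
proof (induction F arbitrary: z rule: finite_linorder_max_induct)
  case empty
  then show ?case using wr_le_wl by simp
next
  case (insert y F)
  have y: "x < y" "y < z" using insert.prems by auto
  have "sum D F \<le> wl y - wr x"
    using insert.hyps insert.prems y by (intro insert.IH) auto
  moreover have "y \<notin> F" using insert.hyps by auto
  ultimately show ?case using insert.hyps wr_le_wl[OF y(2)] by (simp add: D_def)
qed

text \<open>\<open>w\<close> is constant on each side of [a, b], so any interval enclosing
  \<open>F\<close> sees no more than the increment over [a, b]. A bound independent of
  \<open>F\<close> makes the jumps a summable family indexed by all reals.\<close>

lemma sum_D_le_variation:
  assumes "finite F"
  shows "sum D F \<le> v b - v a"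
proof -
  obtain B where B: "B > 0" "\<And>y. y \<in> F \<Longrightarrow> norm y < B"
    using finite_imp_bounded[OF assms] unfolding bounded_pos_less by blast
  define x z where "x = - B" and "z = B"
  have xz: "F \<subseteq> {x<..<z}" "x < z" using B by (force simp: x_def z_def abs_less_iff)+
  have "sum D F \<le> wl z - wr x" by (rule sum_D_le[OF assms xz])
  also have "\<dots> \<le> w z - w x"
    using abs_right_jump_le[of x] abs_left_jump_le[of z] by linarith
  also have "\<dots> \<le> w b - w a"
  proof -
    have "w z \<le> w b" "w a \<le> w x"
    proof -
      have "w z = w (max a (min b z))" "w x = w (max a (min b x))"
        using ab by (auto simp: w_def ext_clamp_def)
      then show "w z \<le> w b" "w a \<le> w x" using monoD[OF mono_w] ab by auto
    qed
    then show ?thesis by linarith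
  qed
  finally show ?thesis using ab by (simp add: w_def ext_clamp_def)
qed

lemma summable_D: "D summable_on A"
  by (rule nonneg_bdd_above_summable_on) (auto simp: bdd_above_def D_nonneg intro: sum_D_le_variation)

lemma infsum_D_le: "infsum D A \<le> v b - v a"
  by (rule infsum_le_finite_sums[OF summable_D]) (rule sum_D_le_variation)

lemma summable_jumps: "(\<lambda>y. \<bar>right_jump y\<bar>) summable_on A" "(\<lambda>y. \<bar>left_jump y\<bar>) summable_on A"
  "right_jump summable_on A" "left_jump summable_on A"
proof -
  have D: "(\<lambda>y. norm (D y)) summable_on A"
    by (rule iffD1[OF summable_on_iff_abs_summable_on_real summable_D])
  have "(\<lambda>y. norm (right_jump y)) summable_on A" "(\<lambda>y. norm (left_jump y)) summable_on A"
  proof -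
    have "norm (right_jump y) \<le> norm (D y)" "norm (left_jump y) \<le> norm (D y)" for y
      using abs_jumps_le[of y] by auto
    then show "(\<lambda>y. norm (right_jump y)) summable_on A" "(\<lambda>y. norm (left_jump y)) summable_on A"
      using Infinite_Sum.abs_summable_on_comparison_test[OF D] by blast+
  qed
  then show "(\<lambda>y. \<bar>right_jump y\<bar>) summable_on A" "(\<lambda>y. \<bar>left_jump y\<bar>) summable_on A" "right_jump summable_on A" "left_jump summable_on A"
    using iffD2[OF summable_on_iff_abs_summable_on_real] by auto
qed

lemma infsum_abs_jumps_le:
  assumes "S \<subseteq> U" "S' \<subseteq> U"
  shows "infsum (\<lambda>y. \<bar>right_jump y\<bar>) S + infsum (\<lambda>y. \<bar>left_jump y\<bar>) S' \<le> infsum D U"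
proof -
  have "infsum (\<lambda>y. \<bar>right_jump y\<bar>) S \<le> infsum (\<lambda>y. \<bar>right_jump y\<bar>) U" "infsum (\<lambda>y. \<bar>left_jump y\<bar>) S' \<le> infsum (\<lambda>y. \<bar>left_jump y\<bar>) U"
    using assms by (intro infsum_mono_neutral summable_jumps; auto)+
  moreover have "infsum (\<lambda>y. \<bar>right_jump y\<bar>) U + infsum (\<lambda>y. \<bar>left_jump y\<bar>) U = infsum (\<lambda>y. \<bar>right_jump y\<bar> + \<bar>left_jump y\<bar>) U"
    by (intro infsum_add[symmetric] summable_jumps)
  moreover have "infsum (\<lambda>y. \<bar>right_jump y\<bar> + \<bar>left_jump y\<bar>) U \<le> infsum D U"
    by (intro infsum_mono summable_on_add summable_jumps summable_D abs_jumps_le)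
  ultimately show ?thesis by linarith
qed

lemma abs_infsum_jumps_le:
  assumes "S \<subseteq> U" "S' \<subseteq> U"
  shows "\<bar>infsum right_jump S + infsum left_jump S'\<bar> \<le> infsum D U"
proof -
  have "\<bar>infsum right_jump S\<bar> \<le> infsum (\<lambda>y. \<bar>right_jump y\<bar>) S" "\<bar>infsum left_jump S'\<bar> \<le> infsum (\<lambda>y. \<bar>left_jump y\<bar>) S'"
    using norm_infsum_bound[of right_jump S] norm_infsum_bound[of left_jump S'] summable_jumps by auto
  with infsum_abs_jumps_le[OF assms] show ?thesis by linarith
qed

lemma right_jump_zero:
  assumes "y < a \<or> b \<le> y"
  shows "right_jump y = 0"
proof -
  have "\<forall>\<^sub>F x in at_right y. e x = e y"
    using assms
  proof
    assume "y < a"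
    then show ?thesis using ab
      by (intro eventually_mono[OF eventually_at_right_real[of y a]]) (auto simp: e_def ext_clamp_def)
  next
    assume "b \<le> y"
    then show ?thesis using ab
      by (intro eventually_mono[OF eventually_at_right_real[of y "y + 1"]]) (auto simp: e_def ext_clamp_def)
  qed
  then have "(e \<longlongrightarrow> e y) (at_right y)" by (rule tendsto_eventually)
  from tendsto_Lim[OF trivial_limit_at_right_real this] show ?thesis by (simp add: right_jump_def)
qed

lemma left_jump_zero:
  assumes "y \<le> a \<or> b < y"
  shows "left_jump y = 0"
proof -
  have "\<forall>\<^sub>F x in at_left y. e x = e y"
    using assms
  proof
    assume "b < y"
    then show ?thesis using ab
      by (intro eventually_mono[OF eventually_at_left_real[of b y]]) (auto simp: e_def ext_clamp_def)
  next
    assume "y \<le> a"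
    then show ?thesis using ab
      by (intro eventually_mono[OF eventually_at_left_real[of "y - 1" y]]) (auto simp: e_def ext_clamp_def)
  qed
  then have "(e \<longlongrightarrow> e y) (at_left y)" by (rule tendsto_eventually)
  from tendsto_Lim[OF trivial_limit_at_left_real this] show ?thesis by (simp add: left_jump_def)
qed

section \<open>The jump part and integration against it\<close>

text \<open>Starting the sums at minus infinity instead of \<open>a\<close> changes nothing, as
  there are no jumps before \<open>a\<close>, and gives one increment formula for all
  \<open>x \<le> z\<close>.\<close>

definition J where "J x = infsum right_jump {..<x} + infsum left_jump {..x}"

definition JV where "JV x = infsum (\<lambda>y. \<bar>right_jump y\<bar>) {..<x} + infsum (\<lambda>y. \<bar>left_jump y\<bar>) {..x}"

lemma jump_part_eq: "jump_part f a b = J"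
proof
  fix x
  have "infsum right_jump {a..<x} = infsum right_jump {..<x}" "infsum left_jump {a..x} = infsum left_jump {..x}"
    by (intro infsum_cong_neutral; auto simp: right_jump_zero left_jump_zero)+
  then show "jump_part f a b x = J x"
    by (simp add: jump_part_def J_def Let_def e_def[symmetric] right_jump_def[symmetric] left_jump_def[symmetric])
qed

lemma J_diff: "x \<le> z \<Longrightarrow> J z - J x = infsum right_jump {x..<z} + infsum left_jump {x<..z}"
  unfolding J_def by (intro infsum_increment summable_jumps)

lemma JV_diff: "x \<le> z \<Longrightarrow> JV z - JV x = infsum (\<lambda>y. \<bar>right_jump y\<bar>) {x..<z} + infsum (\<lambda>y. \<bar>left_jump y\<bar>) {x<..z}"
  unfolding JV_def by (intro infsum_increment summable_jumps)

lemma JV_bound: "x \<le> z \<Longrightarrow> JV z - JV x \<le> v b - v a"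
  using JV_diff[of x z] infsum_abs_jumps_le[of "{x..<z}" UNIV "{x<..z}"] infsum_D_le[of UNIV] by auto

lemma JV_mono: "x \<le> z \<Longrightarrow> 0 \<le> JV z - JV x"
  using JV_diff[of x z] by (auto intro!: add_nonneg_nonneg infsum_nonneg)

lemma var_dom_J: "var_dom J JV a b"
proof -
  have "\<bar>J z - J x\<bar> \<le> JV z - JV x" if "x \<le> z" for x z
    using norm_infsum_bound[of right_jump "{x..<z}"] norm_infsum_bound[of left_jump "{x<..z}"] summable_jumps
      J_diff[OF that] JV_diff[OF that] by auto
  then show ?thesis by (auto simp: var_dom_def)
qed

lemma J_clamp: "ext_clamp J a b = J"
proof
  fix x
  consider "x < a" | "x \<in> {a..b}" | "b < x" by force
  then show "ext_clamp J a b x = J x"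
  proof cases
    case 1
    have "infsum right_jump {x..<a} = 0" "infsum left_jump {x<..a} = 0"
      by (intro infsum_0; auto simp: right_jump_zero left_jump_zero)+
    then show ?thesis using 1 ab J_diff[of x a] by (simp add: ext_clamp_def)
  next
    case 2
    then show ?thesis by (simp add: ext_clamp_def)
  next
    case 3
    have "infsum right_jump {b..<x} = 0" "infsum left_jump {b<..x} = 0"
      by (intro infsum_0; auto simp: right_jump_zero left_jump_zero)+
    then show ?thesis using 3 ab J_diff[of b x] by (simp add: ext_clamp_def)
  qed
qed

lemma infsum_D_interval_le: "x < z \<Longrightarrow> infsum D {x<..<z} \<le> wl z - wr x"
  by (rule infsum_le_finite_sums[OF summable_D]) (rule sum_D_le)

text \<open>Just after \<open>y\<close>, the increment of \<open>J\<close> is the right jump at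
  \<open>y\<close> plus jumps at later points. These weigh at most \<open>wl z' - wr y\<close>,
  which is small once \<open>w z'\<close> is close to the right limit \<open>wr y\<close>.\<close>

lemma tendsto_J_right: "(J \<longlongrightarrow> J y + right_jump y) (at_right y)"
proof (rule tendstoI)
  fix \<epsilon> :: real assume "\<epsilon> > 0"
  then have "\<forall>\<^sub>F x in at_right y. w x < wr y + \<epsilon>" by (intro order_tendstoD(2)[OF tendsto_w(1)]) simp
  then have "\<forall>\<^sub>F x in at_right y. w x < wr y + \<epsilon> \<and> y < x"
    by (intro eventually_conj eventually_at_right_less)
  from eventually_happens'[OF trivial_limit_at_right_real this]
  obtain z' where z': "w z' < wr y + \<epsilon>" "y < z'" by auto
  show "\<forall>\<^sub>F x in at_right y. dist (J x) (J y + right_jump y) < \<epsilon>"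
    using eventually_at_right_real[OF z'(2)]
  proof eventually_elim
    case (elim z)
    have "{y..<z} = {y} \<union> {y<..<z}" using elim by auto
    then have "infsum right_jump {y..<z} = right_jump y + infsum right_jump {y<..<z}"
      using infsum_Un_disjoint[of right_jump "{y}" "{y<..<z}"] summable_jumps by auto
    then have "J z - (J y + right_jump y) = infsum right_jump {y<..<z} + infsum left_jump {y<..z}"
      using J_diff[of y z] elim by simp
    moreover have "\<bar>infsum right_jump {y<..<z} + infsum left_jump {y<..z}\<bar> \<le> infsum D {y<..<z'}"
      using elim by (intro abs_infsum_jumps_le) auto
    ultimately have "dist (J z) (J y + right_jump y) \<le> infsum D {y<..<z'}"
      by (simp only: dist_real_def)
    also have "\<dots> \<le> wl z' - wr y" by (rule infsum_D_interval_le[OF z'(2)])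
    also have "\<dots> < \<epsilon>" using z'(1) abs_left_jump_le[of z'] by linarith
    finally show ?case .
  qed
qed

lemma tendsto_J_left: "(J \<longlongrightarrow> J y - left_jump y) (at_left y)"
proof (rule tendstoI)
  fix \<epsilon> :: real assume "\<epsilon> > 0"
  then have "\<forall>\<^sub>F x in at_left y. wl y - \<epsilon> < w x" by (intro order_tendstoD(1)[OF tendsto_w(2)]) simp
  then have "\<forall>\<^sub>F x in at_left y. wl y - \<epsilon> < w x \<and> x \<in> {y - 1<..<y}"
    by (intro eventually_conj eventually_at_left_real) auto
  from eventually_happens'[OF trivial_limit_at_left_real this]
  obtain z' where z': "wl y - \<epsilon> < w z'" "z' < y" by auto
  show "\<forall>\<^sub>F x in at_left y. dist (J x) (J y - left_jump y) < \<epsilon>"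
    using eventually_at_left_real[OF z'(2)]
  proof eventually_elim
    case (elim z)
    have "{z<..y} = {z<..<y} \<union> {y}" using elim by auto
    then have "infsum left_jump {z<..y} = infsum left_jump {z<..<y} + left_jump y"
      using infsum_Un_disjoint[of left_jump "{z<..<y}" "{y}"] summable_jumps by auto
    then have "J z - (J y - left_jump y) = - (infsum right_jump {z..<y} + infsum left_jump {z<..<y})"
      using J_diff[of z y] elim by simp
    moreover have "\<bar>infsum right_jump {z..<y} + infsum left_jump {z<..<y}\<bar> \<le> infsum D {z'<..<y}"
      using elim by (intro abs_infsum_jumps_le) auto
    ultimately have "dist (J z) (J y - left_jump y) \<le> infsum D {z'<..<y}"
      by (simp only: dist_real_def abs_minus_cancel)
    also have "\<dots> \<le> wl y - wr z'" by (rule infsum_D_interval_le[OF z'(2)])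
    also have "\<dots> < \<epsilon>" using z'(1) abs_right_jump_le[of z'] by linarith
    finally show ?case .
  qed
qed

text \<open>Identifies the weights that arise from summing one-sided jumps with the quantity about
  which the hypothesis on jumps speaks.\<close>

lemma jump_at_jump_part: "jump_at (jump_part f a b) a b y = right_jump y + left_jump y"
  unfolding jump_at_def jump_part_eq J_clamp
  by (simp add: tendsto_Lim[OF trivial_limit_at_right_real tendsto_J_right]
      tendsto_Lim[OF trivial_limit_at_left_real tendsto_J_left])

text \<open>The factor 2 arises because the variation of the jump part is bounded by that of
  \<open>v\<close> once more.\<close>

lemma cont_part_variation:
  shows "var_dom (cont_part f a b) (\<lambda>x. v x + JV x) a b"
    and "(v b + JV b) - (v a + JV a) \<le> 2 * (v b - v a)"
proof -
  have "cont_part f a b = (\<lambda>x. f x - J x)" by (auto simp: cont_part_def jump_part_eq)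
  then show "var_dom (cont_part f a b) (\<lambda>x. v x + JV x) a b"
    using var_dom_diff[OF dom var_dom_J] by simp
  show "(v b + JV b) - (v a + JV a) \<le> 2 * (v b - v a)"
    using JV_bound[of a b] ab by simp
qed

lemma has_RS_integral_jump_part:
  fixes F :: "real \<Rightarrow> 'x::banach"
  assumes F: "continuous_on {a..b} F"
  shows "has_RS_integral F (jump_part f a b) a b
    (infsum (\<lambda>y. jump_at (jump_part f a b) a b y *\<^sub>R F y) {a..b})"
proof -
  \<comment> \<open>The extension is bounded on the whole line, so that sums over unbounded
    half-lines such as those in \<open>J\<close> make sense for the weighted jumps too.\<close>
  define F' where "F' y = F (max a (min b y))" for y
  have F'_eq: "F' y = F y" if "y \<in> {a..b}" for y using that by (auto simp: F'_def)
  obtain K where K: "\<And>y. norm (F' y) \<le> K"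
  proof -
    have "bounded (F ` {a..b})" using F by (intro compact_imp_bounded compact_continuous_image) auto
    then obtain K where "\<And>y. y \<in> {a..b} \<Longrightarrow> norm (F y) \<le> K" unfolding bounded_iff by blast
    then show ?thesis using ab by (intro that[of K]) (auto simp: F'_def)
  qed
  have s: "(\<lambda>y. right_jump y *\<^sub>R F' y) summable_on S" "(\<lambda>y. left_jump y *\<^sub>R F' y) summable_on S" for S
    by (rule abs_summable_summable[OF abs_summable_scaleR_bounded[OF summable_jumps(3) K]])
      (rule abs_summable_summable[OF abs_summable_scaleR_bounded[OF summable_jumps(4) K]])
  \<comment> \<open>The candidate for the indefinite integral: \<open>J\<close> with each jump
    weighted by the integrand at its location.\<close>
  define H where "H x = infsum (\<lambda>y. right_jump y *\<^sub>R F' y) {..<x} + infsum (\<lambda>y. left_jump y *\<^sub>R F' y) {..x}" for x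
  have H_diff: "H z - H x = infsum (\<lambda>y. right_jump y *\<^sub>R F' y) {x..<z} + infsum (\<lambda>y. left_jump y *\<^sub>R F' y) {x<..z}" if "x \<le> z" for x z
    unfolding H_def using that by (intro infsum_increment s)
  have "has_RS_integral F J a b (H b - H a)"
  proof (rule has_RS_integral_telescope[where V = JV])
    show "0 \<le> JV b - JV a" using JV_mono ab by simp
    fix \<epsilon> :: real assume "\<epsilon> > 0"
    from uniform_oscillation[OF F this] obtain \<delta> where \<delta>: "\<delta> > 0"
      "\<And>s t. s \<in> {a..b} \<Longrightarrow> t \<in> {a..b} \<Longrightarrow> \<bar>s - t\<bar> < 2 * \<delta> \<Longrightarrow> norm (F s - F t) \<le> \<epsilon>" by metis
    have "norm (H z - H x - (J z - J x) *\<^sub>R F \<xi>) \<le> \<epsilon> * (JV z - JV x)"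
      if x: "a \<le> x" "x \<le> \<xi>" "\<xi> \<le> z" "z \<le> b" "z - x < \<delta>" for x z \<xi>
    proof -
      have xz: "x \<le> z" using x by simp
      have q: "norm (F' y - F \<xi>) \<le> \<epsilon>" if "y \<in> {x..z}" for y
      proof -
        have "y \<in> {a..b}" "\<xi> \<in> {a..b}" "\<bar>y - \<xi>\<bar> < 2 * \<delta>" using x that \<delta>(1) by auto
        then show ?thesis using \<delta>(2) F'_eq by simp
      qed
      have "norm (H z - H x - (J z - J x) *\<^sub>R F \<xi>)
          = norm ((infsum (\<lambda>y. right_jump y *\<^sub>R F' y) {x..<z} - infsum right_jump {x..<z} *\<^sub>R F \<xi>)
          + (infsum (\<lambda>y. left_jump y *\<^sub>R F' y) {x<..z} - infsum left_jump {x<..z} *\<^sub>R F \<xi>))"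
        unfolding H_diff[OF xz] J_diff[OF xz] by (simp add: algebra_simps)
      also have "\<dots> \<le> \<epsilon> * infsum (\<lambda>y. \<bar>right_jump y\<bar>) {x..<z} + \<epsilon> * infsum (\<lambda>y. \<bar>left_jump y\<bar>) {x<..z}"
        by (intro norm_triangle_mono norm_infsum_scaleR_diff_le[where K = K] summable_jumps K q) auto
      also have "\<dots> = \<epsilon> * (JV z - JV x)" unfolding JV_diff[OF xz] by (simp add: distrib_left)
      finally show ?thesis .
    qed
    then show "\<exists>\<delta>>0. \<forall>x z \<xi>. a \<le> x \<and> x \<le> \<xi> \<and> \<xi> \<le> z \<and> z \<le> b \<and> z - x < \<delta> \<longrightarrow>
        norm (H z - H x - (J z - J x) *\<^sub>R F \<xi>) \<le> \<epsilon> * (JV z - JV x)"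
      using \<delta>(1) by blast
  qed
  also have "H b - H a = infsum (\<lambda>y. jump_at (jump_part f a b) a b y *\<^sub>R F y) {a..b}"
  proof -
    \<comment> \<open>The missing endpoints may be added because there is no right jump at
      \<open>b\<close> and no left jump at \<open>a\<close>.\<close>
    have "infsum (\<lambda>y. right_jump y *\<^sub>R F' y) {a..<b} = infsum (\<lambda>y. right_jump y *\<^sub>R F' y) {a..b}"
      "infsum (\<lambda>y. left_jump y *\<^sub>R F' y) {a<..b} = infsum (\<lambda>y. left_jump y *\<^sub>R F' y) {a..b}"
      by (intro infsum_cong_neutral; auto simp: right_jump_zero left_jump_zero)+
    then have "H b - H a = infsum (\<lambda>y. right_jump y *\<^sub>R F' y + left_jump y *\<^sub>R F' y) {a..b}"
      using H_diff[of a b] ab infsum_add[OF s(1) s(2)] by simp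
    also have "\<dots> = infsum (\<lambda>y. jump_at (jump_part f a b) a b y *\<^sub>R F y) {a..b}"
      by (intro infsum_cong) (simp add: F'_eq jump_at_jump_part scaleR_left_distrib)
    finally show ?thesis .
  qed
  finally show ?thesis by (simp add: jump_part_eq)
qed

end

section \<open>Mild solutions for continuous right-hand sides of linear growth\<close>

definition seq_contC :: "real \<Rightarrow> (real \<Rightarrow> (real \<Rightarrow> 'x::real_normed_vector) \<Rightarrow> 'y::metric_space) \<Rightarrow> bool" where
  "seq_contC r \<Phi> \<longleftrightarrow> (\<forall>t \<psi> s \<psi>s. \<psi> \<in> Cspace r \<longrightarrow> (\<forall>n. \<psi>s n \<in> Cspace r) \<longrightarrow> s \<longlonglongrightarrow> t \<longrightarrow>
      (\<lambda>n. Cnorm r (\<lambda>\<theta>. \<psi>s n \<theta> - \<psi> \<theta>)) \<longlonglongrightarrow> 0 \<longrightarrow> (\<lambda>n. \<Phi> (s n) (\<psi>s n)) \<longlonglongrightarrow> \<Phi> t \<psi>)"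

lemma seq_contCD:
  assumes "seq_contC r \<Phi>" "\<psi> \<in> Cspace r" "\<And>n. \<psi>s n \<in> Cspace r" "s \<longlonglongrightarrow> t"
    "(\<lambda>n. Cnorm r (\<lambda>\<theta>. \<psi>s n \<theta> - \<psi> \<theta>)) \<longlonglongrightarrow> 0"
  shows "(\<lambda>n. \<Phi> (s n) (\<psi>s n)) \<longlonglongrightarrow> \<Phi> t \<psi>"
  using assms unfolding seq_contC_def by blast

lemma Cspace_diff: "\<psi> \<in> Cspace r \<Longrightarrow> \<psi>' \<in> Cspace r \<Longrightarrow> (\<lambda>\<theta>. \<psi> \<theta> - \<psi>' \<theta>) \<in> Cspace r"
  unfolding Cspace_def by (auto intro: continuous_intros)

lemma norm_le_Cnorm:
  assumes "\<psi> \<in> Cspace r" "\<theta> \<in> {-r..0}"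
  shows "norm (\<psi> \<theta>) \<le> Cnorm r \<psi>"
proof -
  have "compact ((\<lambda>\<theta>. norm (\<psi> \<theta>)) ` {-r..0})"
    using assms(1) unfolding Cspace_def by (intro compact_continuous_image continuous_intros) auto
  then have "bdd_above ((\<lambda>\<theta>. norm (\<psi> \<theta>)) ` {-r..0})"
    by (intro bounded_imp_bdd_above compact_imp_bounded)
  then show ?thesis unfolding Cnorm_def using assms(2) by (rule cSUP_upper[rotated])
qed

lemma Cnorm_le:
  assumes "0 \<le> r" "\<And>\<theta>. \<theta> \<in> {-r..0} \<Longrightarrow> norm (\<psi> \<theta>) \<le> c"
  shows "Cnorm r \<psi> \<le> c"
  unfolding Cnorm_def using assms by (intro cSUP_least) auto

lemma Cnorm_nonneg: "0 \<le> r \<Longrightarrow> \<psi> \<in> Cspace r \<Longrightarrow> 0 \<le> Cnorm r \<psi>"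
  using norm_le_Cnorm[of \<psi> r 0] by (auto intro: order_trans[OF norm_ge_zero])

lemma contC_imp_seq_contC:
  assumes "contC r \<Phi>" "0 \<le> r"
  shows "seq_contC r \<Phi>"
  unfolding seq_contC_def
proof (intro allI impI tendstoI)
  fix t :: real and \<psi> :: "real \<Rightarrow> 'a" and s :: "nat \<Rightarrow> real" and \<psi>s :: "nat \<Rightarrow> real \<Rightarrow> 'a" and e :: real
  assume *: "\<psi> \<in> Cspace r" "\<forall>n. \<psi>s n \<in> Cspace r" "s \<longlonglongrightarrow> t"
    "(\<lambda>n. Cnorm r (\<lambda>\<theta>. \<psi>s n \<theta> - \<psi> \<theta>)) \<longlonglongrightarrow> 0" "0 < e"
  obtain \<delta> where \<delta>: "\<delta> > 0" "\<And>s \<psi>'. \<psi>' \<in> Cspace r \<Longrightarrow> \<bar>s - t\<bar> < \<delta> \<Longrightarrow>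
      Cnorm r (\<lambda>\<theta>. \<psi>' \<theta> - \<psi> \<theta>) < \<delta> \<Longrightarrow> dist (\<Phi> s \<psi>') (\<Phi> t \<psi>) < e"
    using assms *(1,5) unfolding contC_def by meson
  show "\<forall>\<^sub>F n in sequentially. dist (\<Phi> (s n) (\<psi>s n)) (\<Phi> t \<psi>) < e"
    using tendstoD[OF *(3) \<delta>(1)] order_tendstoD(2)[OF *(4) \<delta>(1)]
    by eventually_elim (use *(2) \<delta>(2) in \<open>auto simp: dist_real_def\<close>)
qed

text \<open>Elements of \<open>Cspace r\<close> are functions on the whole line and
  \<open>Cnorm\<close> is only a seminorm on them. Continuity forces \<open>\<Phi>\<close> to ignore
  values outside [-r, 0]: the constant sequence \<open>\<psi>'\<close> converges to
  \<open>\<psi>\<close> at distance 0.\<close>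

lemma seq_contC_cong:
  assumes "seq_contC r \<Phi>" "\<psi> \<in> Cspace r" "\<psi>' \<in> Cspace r" "0 \<le> r"
    and eq: "\<And>\<theta>. \<theta> \<in> {-r..0} \<Longrightarrow> \<psi>' \<theta> = \<psi> \<theta>"
  shows "\<Phi> t \<psi>' = \<Phi> t \<psi>"
proof -
  have "Cnorm r (\<lambda>\<theta>. \<psi>' \<theta> - \<psi> \<theta>) = 0"
    using eq by (intro antisym Cnorm_le Cnorm_nonneg Cspace_diff assms) auto
  then have "(\<lambda>n::nat. \<Phi> t \<psi>') \<longlonglongrightarrow> \<Phi> t \<psi>"
    using seq_contCD[OF assms(1,2), of "\<lambda>_. \<psi>'" "\<lambda>_. t" t] assms(3) by simp
  then show ?thesis by (rule LIMSEQ_unique[OF tendsto_const])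
qed

lemma Cspace_segment: "continuous_on UNIV u \<Longrightarrow> (\<lambda>\<theta>. u (s + \<theta>)) \<in> Cspace r"
  unfolding Cspace_def by (auto intro!: continuous_on_compose2[of UNIV u] continuous_intros)

text \<open>Convergence that is uniform near each point becomes uniform on the window [-r, 0] by
  compactness: bad offsets \<theta> would accumulate at some \<open>l\<close>, contradicting
  \<open>conv\<close> at \<open>t + l\<close>. With a constant sequence \<open>v\<close> this gives
  continuity of segments in time.\<close>

lemma Cnorm_segment_tendsto:
  fixes u :: "real \<Rightarrow> 'x::real_normed_vector"
  assumes conv: "\<And>x \<epsilon>. \<epsilon> > 0 \<Longrightarrow> \<exists>N \<delta>. \<delta> > 0 \<and> (\<forall>n\<ge>N. \<forall>y. \<bar>y - x\<bar> < \<delta> \<longrightarrow> norm (v n y - u x) < \<epsilon>)"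
    and u: "continuous_on UNIV u" and v: "\<And>n. continuous_on UNIV (v n)" and s: "s \<longlonglongrightarrow> t" and r: "0 \<le> r"
  shows "(\<lambda>n. Cnorm r (\<lambda>\<theta>. v n (s n + \<theta>) - u (t + \<theta>))) \<longlonglongrightarrow> 0"
proof (rule tendstoI)
  fix e :: real assume e: "e > 0"
  have "\<exists>N. \<forall>n\<ge>N. \<forall>\<theta>\<in>{-r..0}. norm (v n (s n + \<theta>) - u (t + \<theta>)) < e / 2"
  proof (rule ccontr)
    assume "\<not> ?thesis"
    then have "\<forall>j. \<exists>n \<theta>. n \<ge> j \<and> \<theta> \<in> {-r..0} \<and> e / 2 \<le> norm (v n (s n + \<theta>) - u (t + \<theta>))"
      by (meson not_le)
    then obtain n \<theta> where n: "\<And>j. n j \<ge> j" "\<And>j. \<theta> j \<in> {-r..0}"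
      "\<And>j. e / 2 \<le> norm (v (n j) (s (n j) + \<theta> j) - u (t + \<theta> j))" by metis
    have "compact {-r..0}" by simp
    then obtain l \<rho> where l: "l \<in> {-r..0}" "strict_mono \<rho>" "(\<theta> \<circ> \<rho>) \<longlonglongrightarrow> l"
      using n(2) unfolding compact_def by meson
    define m where "m j = n (\<rho> j)" for j
    have m: "filterlim m at_top sequentially"
    proof (rule filterlim_at_top_mono[OF filterlim_ident])
      show "\<forall>\<^sub>F j in sequentially. j \<le> m j"
        using n(1) seq_suble[OF l(2)] order_trans unfolding m_def by (intro always_eventually) blast
    qed
    obtain N \<delta> where N: "\<delta> > 0" "\<And>n y. n \<ge> N \<Longrightarrow> \<bar>y - (t + l)\<bar> < \<delta> \<Longrightarrow> norm (v n y - u (t + l)) < e / 4"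
      using conv[of "e / 4" "t + l"] e by auto
    have "(\<lambda>j. s (m j) + \<theta> (\<rho> j)) \<longlonglongrightarrow> t + l"
      using l(3) by (intro tendsto_add filterlim_compose[OF s m]) (simp add: o_def)
    from tendstoD[OF this N(1)] have 1: "\<forall>\<^sub>F j in sequentially. \<bar>s (m j) + \<theta> (\<rho> j) - (t + l)\<bar> < \<delta>"
      by (simp add: dist_real_def)
    have "isCont u (t + l)" using u by (simp add: continuous_on_eq_continuous_at)
    moreover have "(\<lambda>j. t + \<theta> (\<rho> j)) \<longlonglongrightarrow> t + l" using l(3) by (intro tendsto_add) (auto simp: o_def)
    ultimately have "(\<lambda>j. u (t + \<theta> (\<rho> j))) \<longlonglongrightarrow> u (t + l)" by (rule isCont_tendsto_compose)
    then have 2: "\<forall>\<^sub>F j in sequentially. dist (u (t + \<theta> (\<rho> j))) (u (t + l)) < e / 4"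
      by (rule tendstoD) (use e in simp)
    have 3: "\<forall>\<^sub>F j in sequentially. N \<le> m j" using m by (simp add: filterlim_at_top)
    from eventually_conj[OF 1 eventually_conj[OF 2 3]]
    obtain j where j: "\<bar>s (m j) + \<theta> (\<rho> j) - (t + l)\<bar> < \<delta>" "dist (u (t + \<theta> (\<rho> j))) (u (t + l)) < e / 4" "N \<le> m j"
      using eventually_happens'[OF sequentially_bot] by blast
    have "norm (v (m j) (s (m j) + \<theta> (\<rho> j)) - u (t + l)) < e / 4" using N(2) j by blast
    moreover have "norm (u (t + \<theta> (\<rho> j)) - u (t + l)) < e / 4" using j(2) by (simp add: dist_norm)
    ultimately have "norm (v (m j) (s (m j) + \<theta> (\<rho> j)) - u (t + \<theta> (\<rho> j))) < e / 2"
      using norm_triangle_ineq4[of "v (m j) (s (m j) + \<theta> (\<rho> j)) - u (t + l)" "u (t + \<theta> (\<rho> j)) - u (t + l)"] by simp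
    then show False using n(3)[of "\<rho> j"] by (simp add: m_def)
  qed
  then obtain N where N: "\<And>n \<theta>. n \<ge> N \<Longrightarrow> \<theta> \<in> {-r..0} \<Longrightarrow> norm (v n (s n + \<theta>) - u (t + \<theta>)) < e / 2" by blast
  have "dist (Cnorm r (\<lambda>\<theta>. v n (s n + \<theta>) - u (t + \<theta>))) 0 < e" if "n \<ge> N" for n
  proof -
    have "Cnorm r (\<lambda>\<theta>. v n (s n + \<theta>) - u (t + \<theta>)) \<le> e / 2"
      using N[OF that] by (intro Cnorm_le r) (auto intro: less_imp_le)
    moreover have "0 \<le> Cnorm r (\<lambda>\<theta>. v n (s n + \<theta>) - u (t + \<theta>))"
      by (intro Cnorm_nonneg r Cspace_diff Cspace_segment u v)
    ultimately show ?thesis using e by (simp add: dist_real_def)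
  qed
  then show "\<forall>\<^sub>F n in sequentially. dist (Cnorm r (\<lambda>\<theta>. v n (s n + \<theta>) - u (t + \<theta>))) 0 < e"
    unfolding eventually_sequentially by blast
qed

text \<open>Only sequential continuity and growth are kept of the nonlinearity. \<open>k\<close>
  bundles all growth coefficients into one nonnegative integrable function, which need not be
  bounded.\<close>

locale delay_problem =
  fixes T :: "real \<Rightarrow> 'x::banach \<Rightarrow>\<^sub>L 'x" and \<omega> r a :: real
    and B :: "real \<Rightarrow> (real \<Rightarrow> 'x) \<Rightarrow> 'x" and k :: "real \<Rightarrow> real" and \<phi> :: "real \<Rightarrow> 'x"
  assumes r: "0 < r" and sg: "compact_C0_semigroup T \<omega>"
    and B: "seq_contC r B"
    and growth: "\<And>t \<psi>. \<psi> \<in> Cspace r \<Longrightarrow> norm (B t \<psi>) \<le> k t * (1 + Cnorm r \<psi>)"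
    and k_nonneg: "\<And>t. 0 \<le> k t"
    and k_int: "\<And>b. k integrable_on {a..b}"
    and \<phi>: "\<phi> \<in> Cspace r"
begin

section \<open>The semigroup\<close>

lemma T_0: "T 0 = id_blinfun"
  and T_add: "0 \<le> s \<Longrightarrow> 0 \<le> t \<Longrightarrow> T (s + t) = T s o\<^sub>L T t"
  and T_strong: "continuous_on {0..} (\<lambda>t. T t x)"
  and T_norm: "0 \<le> t \<Longrightarrow> norm (T t) \<le> exp (\<omega> * t)"
  and T_compact: "0 < t \<Longrightarrow> compact (closure (T t ` cball 0 1))"
  using sg unfolding compact_C0_semigroup_def by blast+

lemma T_bound:
  assumes "0 \<le> t" "t \<le> L"
  shows "norm (T t x) \<le> exp (\<bar>\<omega>\<bar> * L) * norm x"
proof -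
  have "\<omega> * t \<le> \<bar>\<omega>\<bar> * L" using assms by (intro mult_mono) auto
  then have "norm (T t) \<le> exp (\<bar>\<omega>\<bar> * L)" using T_norm[OF assms(1)] by (meson exp_le_cancel_iff order_trans)
  then show ?thesis by (meson norm_blinfun mult_right_mono norm_ge_zero order_trans)
qed

text \<open>The difference from the value at \<open>x\<close> is split at
  \<open>T (\<tau> s) (f x)\<close>: local norm bounds handle the change of the vector, strong
  continuity the change of time.\<close>

lemma T_continuous:
  assumes \<tau>: "continuous_on S \<tau>" "\<And>s. s \<in> S \<Longrightarrow> 0 \<le> \<tau> s" and f: "continuous_on S f"
  shows "continuous_on S (\<lambda>s. T (\<tau> s) (f s))"
  unfolding continuous_on_def
proof
  fix x assume x: "x \<in> S"
  have 1: "((\<lambda>s. T (\<tau> s) (f s - f x)) \<longlongrightarrow> 0) (at x within S)"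
  proof (rule Lim_null_comparison)
    show "\<forall>\<^sub>F s in at x within S. norm (T (\<tau> s) (f s - f x)) \<le> exp (\<omega> * \<tau> s) * norm (f s - f x)"
      unfolding eventually_at_filter
    proof (intro always_eventually allI impI)
      fix s assume "s \<in> S"
      from T_norm[OF \<tau>(2)[OF this]]
      show "norm (T (\<tau> s) (f s - f x)) \<le> exp (\<omega> * \<tau> s) * norm (f s - f x)"
        by (meson norm_blinfun mult_right_mono norm_ge_zero order_trans)
    qed
    have "((\<lambda>s. exp (\<omega> * \<tau> s) * norm (f s - f x)) \<longlongrightarrow> exp (\<omega> * \<tau> x) * norm (f x - f x)) (at x within S)"
      using \<tau>(1) f x by (intro tendsto_intros) (auto simp: continuous_on_def)
    then show "((\<lambda>s. exp (\<omega> * \<tau> s) * norm (f s - f x)) \<longlongrightarrow> 0) (at x within S)" by simp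
  qed
  have "continuous_on S (\<lambda>s. T (\<tau> s) (f x))"
    by (rule continuous_on_compose2[OF T_strong \<tau>(1)]) (use \<tau>(2) in auto)
  then have 2: "((\<lambda>s. T (\<tau> s) (f x)) \<longlongrightarrow> T (\<tau> x) (f x)) (at x within S)"
    using x by (simp add: continuous_on_def)
  show "((\<lambda>s. T (\<tau> s) (f s)) \<longlongrightarrow> T (\<tau> x) (f x)) (at x within S)"
    using tendsto_add[OF 1 2] by (simp add: blinfun.diff_right)
qed

text \<open>Joint continuity on the compact set of times and vectors is uniform. This stands in for
  norm continuity of the semigroup in the equicontinuity estimate.\<close>

lemma T_uniform_on_compact:
  assumes K: "compact K" and \<sigma>: "0 \<le> \<sigma>" and e: "e > 0"
  obtains \<delta> where "\<delta> > 0" "\<And>y \<sigma>'. y \<in> K \<Longrightarrow> 0 \<le> \<sigma>' \<Longrightarrow> \<bar>\<sigma>' - \<sigma>\<bar> < \<delta> \<Longrightarrow> norm (T \<sigma>' y - T \<sigma> y) < e"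
proof -
  have "continuous_on ({0..\<sigma> + 1} \<times> K) (\<lambda>p. T (fst p) (snd p))"
    by (intro T_continuous continuous_intros) auto
  then have "uniformly_continuous_on ({0..\<sigma> + 1} \<times> K) (\<lambda>p. T (fst p) (snd p))"
    using K by (intro compact_uniformly_continuous compact_Times) auto
  then obtain d where d: "d > 0" "\<And>p q. p \<in> {0..\<sigma> + 1} \<times> K \<Longrightarrow> q \<in> {0..\<sigma> + 1} \<times> K \<Longrightarrow> dist q p < d \<Longrightarrow>
      dist (T (fst q) (snd q)) (T (fst p) (snd p)) < e"
    using e unfolding uniformly_continuous_on_def by meson
  show ?thesis
  proof (rule that[of "min d 1"])
    fix y \<sigma>' assume "y \<in> K" "0 \<le> \<sigma>'" "\<bar>\<sigma>' - \<sigma>\<bar> < min d 1"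
    then have "dist (T \<sigma>' y) (T \<sigma> y) < e"
      using d(2)[of "(\<sigma>, y)" "(\<sigma>', y)"] \<sigma> by (auto simp: dist_Pair_Pair dist_real_def)
    then show "norm (T \<sigma>' y - T \<sigma> y) < e" by (simp add: dist_norm)
  qed (use d in auto)
qed

section \<open>The Duhamel operator: splitting, compactness, equicontinuity\<close>

definition duhamel :: "(real \<Rightarrow> 'x) \<Rightarrow> real \<Rightarrow> 'x" where
  "duhamel f t = integral {a..t} (\<lambda>s. T (t - s) (f s))"

lemma duhamel_before: "t \<le> a \<Longrightarrow> duhamel f t = 0"
  unfolding duhamel_def by (cases "t = a") auto

lemma duhamel_integrable:
  assumes "continuous_on UNIV f"
  shows "(\<lambda>s. T (t - s) (f s)) integrable_on {\<tau>..t}"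
  by (intro integrable_continuous_real T_continuous continuous_intros continuous_on_subset[OF assms]) auto

text \<open>The semigroup law lets everything before \<open>\<tau>\<close> enter through
  \<open>T (t - \<tau>)\<close> alone, a compact operator when \<open>\<tau> < t\<close>. This is
  the source of all compactness.\<close>

lemma duhamel_split:
  assumes f: "continuous_on UNIV f" and \<tau>: "a \<le> \<tau>" "\<tau> \<le> t"
  shows "duhamel f t = T (t - \<tau>) (duhamel f \<tau>) + integral {\<tau>..t} (\<lambda>s. T (t - s) (f s))"
proof -
  have "duhamel f t = integral {a..\<tau>} (\<lambda>s. T (t - s) (f s)) + integral {\<tau>..t} (\<lambda>s. T (t - s) (f s))"
    unfolding duhamel_def by (intro Henstock_Kurzweil_Integration.integral_combine[symmetric] \<tau> duhamel_integrable[OF f])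
  also have "integral {a..\<tau>} (\<lambda>s. T (t - s) (f s)) = integral {a..\<tau>} (\<lambda>s. T (t - \<tau>) (T (\<tau> - s) (f s)))"
  proof (rule integral_cong)
    fix s assume "s \<in> {a..\<tau>}"
    then show "T (t - s) (f s) = T (t - \<tau>) (T (\<tau> - s) (f s))"
      using T_add[of "t - \<tau>" "\<tau> - s"] \<tau> by simp
  qed
  also have "\<dots> = T (t - \<tau>) (duhamel f \<tau>)"
    unfolding duhamel_def using integral_linear[OF duhamel_integrable[OF f, of \<tau> a] blinfun.bounded_linear_right[of "T (t - \<tau>)"]]
    by (simp add: o_def)
  finally show ?thesis .
qed

lemma duhamel_tail_bound:
  assumes f: "continuous_on UNIV f" and \<tau>: "a \<le> \<tau>" "\<tau> \<le> t" "t \<le> b"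
    and c: "\<And>s. s \<in> {\<tau>..t} \<Longrightarrow> norm (f s) \<le> c * k s"
  shows "norm (integral {\<tau>..t} (\<lambda>s. T (t - s) (f s))) \<le> exp (\<bar>\<omega>\<bar> * (b - a)) * c * integral {\<tau>..t} k"
proof -
  have k: "k integrable_on {\<tau>..t}" by (rule integrable_subinterval_real[OF k_int[of t]]) (use \<tau> in auto)
  have "norm (integral {\<tau>..t} (\<lambda>s. T (t - s) (f s))) \<le> integral {\<tau>..t} (\<lambda>s. exp (\<bar>\<omega>\<bar> * (b - a)) * c * k s)"
  proof (rule integral_norm_bound_integral[OF duhamel_integrable[OF f]])
    show "(\<lambda>s. exp (\<bar>\<omega>\<bar> * (b - a)) * c * k s) integrable_on {\<tau>..t}"
      using integrable_cmul[OF k, of "exp (\<bar>\<omega>\<bar> * (b - a)) * c"] by simp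
    fix s assume s: "s \<in> {\<tau>..t}"
    have "norm (T (t - s) (f s)) \<le> exp (\<bar>\<omega>\<bar> * (b - a)) * norm (f s)"
      using s \<tau> by (intro T_bound) auto
    also have "\<dots> \<le> exp (\<bar>\<omega>\<bar> * (b - a)) * (c * k s)" using c[OF s] by (intro mult_left_mono) auto
    finally show "norm (T (t - s) (f s)) \<le> exp (\<bar>\<omega>\<bar> * (b - a)) * c * k s" by (simp add: mult.assoc)
  qed
  also have "\<dots> = exp (\<bar>\<omega>\<bar> * (b - a)) * c * integral {\<tau>..t} k"
    by (rule integral_mult_right)
  finally show ?thesis .
qed

definition cumulative_k where "cumulative_k t = integral {a..t} k"

lemma cumulative_k_diff: "a \<le> \<tau> \<Longrightarrow> \<tau> \<le> t \<Longrightarrow> integral {\<tau>..t} k = cumulative_k t - cumulative_k \<tau>"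
  unfolding cumulative_k_def using Henstock_Kurzweil_Integration.integral_combine[OF _ _ k_int[of t], of \<tau>] by simp

lemma cumulative_k_mono: "a \<le> \<tau> \<Longrightarrow> \<tau> \<le> t \<Longrightarrow> cumulative_k \<tau> \<le> cumulative_k t"
  using cumulative_k_diff[of \<tau> t] integral_nonneg[OF integrable_subinterval_real[OF k_int[of t]], of \<tau> t] k_nonneg by auto

lemma cumulative_k_continuous: "continuous_on {a..b} cumulative_k"
  unfolding cumulative_k_def by (rule indefinite_integral_continuous_1[OF k_int])

lemma cumulative_k_small:
  assumes t: "a \<le> t" and e: "e > 0"
  obtains \<delta> where "\<delta> > 0" "\<And>\<tau> s. a \<le> \<tau> \<Longrightarrow> \<tau> \<le> s \<Longrightarrow> \<bar>\<tau> - t\<bar> < \<delta> \<Longrightarrow> \<bar>s - t\<bar> < \<delta> \<Longrightarrow> cumulative_k s - cumulative_k \<tau> < e"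
proof -
  obtain d where d: "d > 0" "\<And>x. x \<in> {a..t + 1} \<Longrightarrow> dist x t < d \<Longrightarrow> dist (cumulative_k x) (cumulative_k t) < e / 2"
    using cumulative_k_continuous[of "t + 1"] t e unfolding continuous_on_iff
    by (metis atLeastAtMost_iff half_gt_zero le_add_same_cancel1 zero_le_one)
  show ?thesis
  proof (rule that[of "min d 1"])
    fix \<tau> s assume *: "a \<le> \<tau>" "\<tau> \<le> s" "\<bar>\<tau> - t\<bar> < min d 1" "\<bar>s - t\<bar> < min d 1"
    have "dist (cumulative_k s) (cumulative_k t) < e / 2" "dist (cumulative_k \<tau>) (cumulative_k t) < e / 2"
      using * by (intro d(2); auto simp: dist_real_def)+
    then show "cumulative_k s - cumulative_k \<tau> < e" unfolding dist_real_def by linarith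
  qed (use d in auto)
qed

text \<open>The constant is uniform in the index but may depend on \<open>b\<close>. A single
  function is treated as a constant sequence.\<close>

definition dominated :: "(nat \<Rightarrow> real \<Rightarrow> 'x) \<Rightarrow> bool" where
  "dominated fs \<longleftrightarrow> (\<forall>n. continuous_on UNIV (fs n)) \<and> (\<forall>b. \<exists>c\<ge>0. \<forall>n. \<forall>s\<in>{a..b}. norm (fs n s) \<le> c * k s)"

text \<open>For every \<open>e\<close> there is a finite net: stop at \<open>\<tau>\<close> so close
  to \<open>t\<close> that the tail is below \<open>e / 2\<close>, and cover the remaining term,
  which lies in a compact set, by balls of radius \<open>e / 2\<close>.\<close>

lemma duhamel_compact:
  assumes fs: "dominated fs"
  obtains K where "compact K" "\<And>n. duhamel (fs n) t \<in> K"
proof (cases "t \<le> a")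
  case True
  then show ?thesis using duhamel_before that[of "{0}"] by auto
next
  case False
  then have t: "a < t" by simp
  have cont: "continuous_on UNIV (fs n)" for n using fs by (simp add: dominated_def)
  obtain c where c: "c \<ge> 0" "\<And>n s. s \<in> {a..t} \<Longrightarrow> norm (fs n s) \<le> c * k s"
    using fs unfolding dominated_def by meson
  define E where "E = exp (\<bar>\<omega>\<bar> * (t - a))"
  have E: "E > 0" by (simp add: E_def)
  have net: "\<exists>F. finite F \<and> range (\<lambda>n. duhamel (fs n) t) \<subseteq> (\<Union>x\<in>F. ball x e)" if e: "e > 0" for e
  proof -
    \<comment> \<open>Chosen so that the tail estimate with factor \<open>E * c\<close> ends below
      \<open>e / 2\<close>; \<open>c + 1\<close> replaces \<open>c\<close>, which may be 0.\<close>
    have e': "e / (2 * E * (c + 1)) > 0" using e E c by simp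
    from cumulative_k_small[OF less_imp_le[OF t] e'] obtain \<delta> where \<delta>: "\<delta> > 0"
      "\<And>\<tau> s. a \<le> \<tau> \<Longrightarrow> \<tau> \<le> s \<Longrightarrow> \<bar>\<tau> - t\<bar> < \<delta> \<Longrightarrow> \<bar>s - t\<bar> < \<delta> \<Longrightarrow> cumulative_k s - cumulative_k \<tau> < e / (2 * E * (c + 1))" by blast
    define \<tau> where "\<tau> = max a (t - \<delta> / 2)"
    have \<tau>: "a \<le> \<tau>" "\<tau> < t" "\<bar>\<tau> - t\<bar> < \<delta>" using t \<delta>(1) by (auto simp: \<tau>_def)
    have tail: "norm (integral {\<tau>..t} (\<lambda>s. T (t - s) (fs n s))) < e / 2" for n
    proof -
      have "norm (integral {\<tau>..t} (\<lambda>s. T (t - s) (fs n s))) \<le> E * c * integral {\<tau>..t} k"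
        unfolding E_def using \<tau> c by (intro duhamel_tail_bound cont) auto
      also have "\<dots> = E * c * (cumulative_k t - cumulative_k \<tau>)" using \<tau> by (simp add: cumulative_k_diff)
      also have "\<dots> \<le> E * (c + 1) * (cumulative_k t - cumulative_k \<tau>)"
        using E cumulative_k_mono[of \<tau> t] \<tau> by (intro mult_right_mono) auto
      also have "\<dots> < E * (c + 1) * (e / (2 * E * (c + 1)))"
        using \<delta> \<tau> E c by (intro mult_strict_left_mono) auto
      also have "\<dots> = e / 2"
      proof -
        have "D * (e / (2 * D)) = e / 2" if "D \<noteq> 0" for D using that by simp
        from this[of "E * (c + 1)"] show ?thesis using E c(1) by (simp add: mult.assoc)
      qed
      finally show ?thesis .
    qed
    \<comment> \<open>A radius for the values at \<open>\<tau>\<close>. The added 1 makes it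
      positive, so that these values can be scaled into the unit ball on which compactness of
      \<open>T (t - \<tau>)\<close> is stated.\<close>
    define R where "R = E * c * cumulative_k \<tau> + 1"
    have "0 \<le> cumulative_k \<tau>" using cumulative_k_mono[OF order_refl \<tau>(1)] by (simp add: cumulative_k_def)
    then have R: "R > 0" using E c by (simp add: R_def add_nonneg_pos)
    have duhamel\<tau>: "norm (duhamel (fs n) \<tau>) \<le> R" for n
    proof -
      have "norm (integral {a..\<tau>} (\<lambda>s. T (\<tau> - s) (fs n s))) \<le> E * c * integral {a..\<tau>} k"
        unfolding E_def using \<tau> c by (intro duhamel_tail_bound cont) auto
      then show ?thesis by (simp add: duhamel_def R_def cumulative_k_def)
    qed
    define K where "K = (\<lambda>x. R *\<^sub>R x) ` closure (T (t - \<tau>) ` cball 0 1)"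
    have "compact K" unfolding K_def using \<tau> by (intro compact_scaling T_compact) auto
    then obtain F where F: "finite F" "K \<subseteq> (\<Union>x\<in>F. ball x (e / 2))"
      using e unfolding compact_eq_totally_bounded by (meson half_gt_zero)
    have "duhamel (fs n) t \<in> (\<Union>x\<in>F. ball x e)" for n
    proof -
      have "T (t - \<tau>) (duhamel (fs n) \<tau>) = R *\<^sub>R T (t - \<tau>) ((1 / R) *\<^sub>R duhamel (fs n) \<tau>)"
        using R by (simp add: blinfun.scaleR_right)
      moreover have "(1 / R) *\<^sub>R duhamel (fs n) \<tau> \<in> cball 0 1" using duhamel\<tau>[of n] R by (simp add: divide_simps)
      ultimately have "T (t - \<tau>) (duhamel (fs n) \<tau>) \<in> K"
        unfolding K_def using closure_subset by blast
      then obtain x where x: "x \<in> F" "dist x (T (t - \<tau>) (duhamel (fs n) \<tau>)) < e / 2" using F(2) by auto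
      have "duhamel (fs n) t = T (t - \<tau>) (duhamel (fs n) \<tau>) + integral {\<tau>..t} (\<lambda>s. T (t - s) (fs n s))"
        using \<tau> by (intro duhamel_split cont) auto
      then have "dist (T (t - \<tau>) (duhamel (fs n) \<tau>)) (duhamel (fs n) t) < e / 2"
        using tail[of n] by (simp add: dist_norm)
      then have "dist x (duhamel (fs n) t) < e" using x(2) dist_triangle_half_r dist_commute
        by (smt (verit) dist_triangle field_sum_of_halves)
      then show ?thesis using x(1) by auto
    qed
    then show ?thesis using F(1) by blast
  qed
  have "compact (closure (range (\<lambda>n. duhamel (fs n) t)))"
    unfolding compact_eq_totally_bounded
  proof (intro conjI allI impI)
    show "complete (closure (range (\<lambda>n. duhamel (fs n) t)))" by (simp add: complete_eq_closed)
    fix e :: real assume e: "0 < e"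
    then obtain F where F: "finite F" "range (\<lambda>n. duhamel (fs n) t) \<subseteq> (\<Union>x\<in>F. ball x (e / 2))"
      using net[of "e / 2"] by auto
    have "closure (range (\<lambda>n. duhamel (fs n) t)) \<subseteq> (\<Union>x\<in>F. cball x (e / 2))"
    proof (rule closure_minimal)
      show "range (\<lambda>n. duhamel (fs n) t) \<subseteq> (\<Union>x\<in>F. cball x (e / 2))" using F(2) ball_subset_cball by blast
      show "closed (\<Union>x\<in>F. cball x (e / 2))" using F(1) by (intro closed_UN) auto
    qed
    also have "\<dots> \<subseteq> (\<Union>x\<in>F. ball x e)" using e by (auto intro!: UN_mono)
    finally show "\<exists>F. finite F \<and> closure (range (\<lambda>n. duhamel (fs n) t)) \<subseteq> (\<Union>x\<in>F. ball x e)" using F(1) by blast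
  qed
  then show ?thesis by (rule that) (use closure_subset[of "range (\<lambda>n. duhamel (fs n) t)"] in auto)
qed

text \<open>Both values are compared with the image under the semigroup of the value at one slightly earlier
  time \<open>\<tau>\<close>, which stays in a compact set; this handles increments to the left of \<open>t\<close> as well.\<close>

lemma duhamel_equicontinuous:
  assumes fs: "dominated fs" and e: "e > 0"
  obtains \<delta> where "\<delta> > 0" "\<And>n s. \<bar>s - t\<bar> < \<delta> \<Longrightarrow> norm (duhamel (fs n) s - duhamel (fs n) t) < e"
proof (cases "t < a")
  case True
  then show ?thesis using e by (intro that[of "a - t"]) (auto simp: duhamel_before)
next
  case False
  then have t: "a \<le> t" by simp
  have cont: "continuous_on UNIV (fs n)" for n using fs by (simp add: dominated_def)
  obtain c where c: "c \<ge> 0" "\<And>n s. s \<in> {a..t + 1} \<Longrightarrow> norm (fs n s) \<le> c * k s"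
    using fs unfolding dominated_def by meson
  define E where "E = exp (\<bar>\<omega>\<bar> * (t + 1 - a))"
  have E: "E > 0" by (simp add: E_def)
  have e': "e / (4 * E * (c + 1)) > 0" using e E c by simp
  from cumulative_k_small[OF t e'] obtain \<delta> where \<delta>: "\<delta> > 0"
    "\<And>\<tau> s. a \<le> \<tau> \<Longrightarrow> \<tau> \<le> s \<Longrightarrow> \<bar>\<tau> - t\<bar> < \<delta> \<Longrightarrow> \<bar>s - t\<bar> < \<delta> \<Longrightarrow> cumulative_k s - cumulative_k \<tau> < e / (4 * E * (c + 1))" by blast
  define \<tau> where "\<tau> = max a (t - \<delta> / 2)"
  have \<tau>: "a \<le> \<tau>" "\<tau> \<le> t" "\<bar>\<tau> - t\<bar> < \<delta>" "a < t \<Longrightarrow> \<tau> < t" using t \<delta>(1) by (auto simp: \<tau>_def)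
  have tail: "norm (duhamel (fs n) s - T (s - \<tau>) (duhamel (fs n) \<tau>)) < e / 4"
    if s: "\<tau> \<le> s" "\<bar>s - t\<bar> < \<delta>" "s \<le> t + 1" for n s
  proof -
    have "duhamel (fs n) s - T (s - \<tau>) (duhamel (fs n) \<tau>) = integral {\<tau>..s} (\<lambda>x. T (s - x) (fs n x))"
      using duhamel_split[OF cont \<tau>(1) s(1)] by simp
    also have "norm \<dots> \<le> E * c * integral {\<tau>..s} k"
      unfolding E_def using \<tau> s c by (intro duhamel_tail_bound cont) auto
    finally have "norm (duhamel (fs n) s - T (s - \<tau>) (duhamel (fs n) \<tau>)) \<le> E * c * (cumulative_k s - cumulative_k \<tau>)"
      using \<tau> s by (simp add: cumulative_k_diff)
    also have "\<dots> \<le> E * (c + 1) * (cumulative_k s - cumulative_k \<tau>)"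
      using E cumulative_k_mono[of \<tau> s] \<tau> s by (intro mult_right_mono) auto
    also have "\<dots> < E * (c + 1) * (e / (4 * E * (c + 1)))"
      using \<delta> \<tau> s E c by (intro mult_strict_left_mono) auto
    also have "\<dots> = e / 4"
    proof -
      have "D * (e / (4 * D)) = e / 4" if "D \<noteq> 0" for D using that by simp
      from this[of "E * (c + 1)"] show ?thesis using E c(1) by (simp add: mult.assoc)
    qed
    finally show ?thesis .
  qed
  obtain K where K: "compact K" "\<And>n. duhamel (fs n) \<tau> \<in> K" using duhamel_compact[OF fs] by blast
  have "0 \<le> t - \<tau>" "e / 2 > 0" using \<tau> e by auto
  from T_uniform_on_compact[OF K(1) this] obtain \<delta>' where \<delta>': "\<delta>' > 0"
    "\<And>y \<sigma>'. y \<in> K \<Longrightarrow> 0 \<le> \<sigma>' \<Longrightarrow> \<bar>\<sigma>' - (t - \<tau>)\<bar> < \<delta>' \<Longrightarrow> norm (T \<sigma>' y - T (t - \<tau>) y) < e / 2" by blast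
  \<comment> \<open>For \<open>a < t\<close> the bound \<open>t - \<tau>\<close> keeps
    \<open>s\<close> to the right of \<open>\<tau>\<close>. For \<open>t = a\<close> also
    \<open>\<tau> = a\<close>, and points \<open>s\<close> to the left carry the value 0. The bound
    1 keeps \<open>s\<close> where \<open>c\<close> and \<open>E\<close> are valid.\<close>
  define d where "d = min (min \<delta> \<delta>') (if a < t then min 1 (t - \<tau>) else 1)"
  have d: "d > 0" "d \<le> \<delta>" "d \<le> \<delta>'" "d \<le> 1" "a < t \<Longrightarrow> d \<le> t - \<tau>"
    using \<delta>(1) \<delta>'(1) \<tau> by (auto simp: d_def)
  show ?thesis
  proof (rule that[OF d(1)])
    fix n s assume s: "\<bar>s - t\<bar> < d"
    show "norm (duhamel (fs n) s - duhamel (fs n) t) < e"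
    proof (cases "\<tau> \<le> s")
      case True
      have 1: "norm (duhamel (fs n) s - T (s - \<tau>) (duhamel (fs n) \<tau>)) < e / 4" using s d True by (intro tail) auto
      have 2: "norm (duhamel (fs n) t - T (t - \<tau>) (duhamel (fs n) \<tau>)) < e / 4" using \<tau> \<delta>(1) by (intro tail) auto
      have 3: "norm (T (s - \<tau>) (duhamel (fs n) \<tau>) - T (t - \<tau>) (duhamel (fs n) \<tau>)) < e / 2"
        using s d True by (intro \<delta>'(2) K) auto
      define y where "y = duhamel (fs n) s - T (s - \<tau>) (duhamel (fs n) \<tau>)"
      define y' where "y' = duhamel (fs n) t - T (t - \<tau>) (duhamel (fs n) \<tau>)"
      define y'' where "y'' = T (s - \<tau>) (duhamel (fs n) \<tau>) - T (t - \<tau>) (duhamel (fs n) \<tau>)"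
      have "duhamel (fs n) s - duhamel (fs n) t = (y - y') + y''"
        unfolding y_def y'_def y''_def by simp
      then have "norm (duhamel (fs n) s - duhamel (fs n) t) \<le> norm y + norm y' + norm y''"
        using norm_triangle_ineq[of "y - y'" y''] norm_triangle_ineq4[of y y'] by simp
      then show ?thesis using 1 2 3 unfolding y_def y'_def y''_def by linarith
    next
      case False
      have "t = a"
      proof (rule ccontr)
        assume "t \<noteq> a"
        then have "d \<le> t - \<tau>" using t d(5) by simp
        then show False using s False by linarith
      qed
      then have "s \<le> a" using False \<tau> by auto
      then show ?thesis using e \<open>t = a\<close> by (simp add: duhamel_before)
    qed
  qed
qed


lemma duhamel_continuous:
  assumes "dominated (\<lambda>_. f)"
  shows "continuous_on UNIV (duhamel f)"
  unfolding continuous_on_iff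
proof (intro ballI allI impI)
  fix t and e :: real assume "e > 0"
  show "\<exists>\<delta>>0. \<forall>s\<in>UNIV. dist s t < \<delta> \<longrightarrow> dist (duhamel f s) (duhamel f t) < e"
  proof (rule duhamel_equicontinuous[OF assms \<open>e > 0\<close>, of t])
    fix \<delta> :: real assume "\<delta> > 0" and \<delta>: "\<And>(n::nat) s. \<bar>s - t\<bar> < \<delta> \<Longrightarrow> norm (duhamel f s - duhamel f t) < e"
    from this(1) show ?thesis by (intro exI[of _ \<delta>]) (simp add: dist_norm \<delta>)
  qed
qed

section \<open>The equation with an additional delay\<close>

text \<open>One formula for the history on [a - r, a], its constant continuation to the left and the
  orbit of \<phi>(0) to the right. Being continuous on the whole line, it supplies segments that
  reach back before \<open>a - r\<close>.\<close>

definition free_part :: "real \<Rightarrow> 'x" where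
  "free_part t = T (max 0 (t - a)) (\<phi> (max (-r) (min 0 (t - a))))"

lemma free_part_continuous: "continuous_on UNIV free_part"
proof -
  have "continuous_on UNIV (\<lambda>t. \<phi> (max (-r) (min 0 (t - a))))"
    by (rule continuous_on_compose2[of "{-r..0}" \<phi>])
      (use \<phi> r in \<open>auto simp: Cspace_def intro!: continuous_intros\<close>)
  then show ?thesis unfolding free_part_def by (intro T_continuous continuous_intros) auto
qed

lemma free_part_before: "\<theta> \<in> {-r..0} \<Longrightarrow> free_part (a + \<theta>) = \<phi> \<theta>"
proof -
  assume "\<theta> \<in> {-r..0}"
  then have "max 0 (a + \<theta> - a) = 0" "max (-r) (min 0 (a + \<theta> - a)) = \<theta>" by auto
  then show "free_part (a + \<theta>) = \<phi> \<theta>" unfolding free_part_def by (simp only: T_0 blinfun_apply_id_blinfun)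
qed

lemma free_part_after: "a \<le> t \<Longrightarrow> free_part t = T (t - a) (\<phi> 0)"
  using r by (simp add: free_part_def)

lemma free_part_bounded:
  obtains Z where "0 \<le> Z" "\<And>x. x \<le> b \<Longrightarrow> norm (free_part x) \<le> Z"
proof (rule that)
  let ?Z = "exp (\<bar>\<omega>\<bar> * max 0 (b - a)) * Cnorm r \<phi>"
  show "0 \<le> ?Z" using Cnorm_nonneg[OF _ \<phi>] r by simp
  fix x assume "x \<le> b"
  then have "norm (free_part x) \<le> exp (\<bar>\<omega>\<bar> * max 0 (b - a)) * norm (\<phi> (max (-r) (min 0 (x - a))))"
    unfolding free_part_def by (intro T_bound) auto
  also have "\<dots> \<le> ?Z" using r by (intro mult_left_mono norm_le_Cnorm \<phi>) auto
  finally show "norm (free_part x) \<le> ?Z" .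
qed

definition rhs :: "(real \<Rightarrow> 'x) \<Rightarrow> real \<Rightarrow> real \<Rightarrow> 'x" where
  "rhs u d s = B s (\<lambda>\<theta>. u (s - d + \<theta>))"

lemma rhs_continuous:
  assumes u: "continuous_on UNIV u"
  shows "continuous_on UNIV (rhs u d)"
  unfolding continuous_on_sequentially
proof (intro allI ballI impI, elim conjE)
  fix x :: "nat \<Rightarrow> real" and t assume x: "x \<longlonglongrightarrow> t"
  have "(\<lambda>n. Cnorm r (\<lambda>\<theta>. u (x n - d + \<theta>) - u (t - d + \<theta>))) \<longlonglongrightarrow> 0"
  proof (rule Cnorm_segment_tendsto[where v = "\<lambda>_. u"])
    fix x e :: real assume "e > 0"
    then obtain \<delta> where "\<delta> > 0" "\<And>y. dist y x < \<delta> \<Longrightarrow> dist (u y) (u x) < e"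
      using u unfolding continuous_on_iff by (metis UNIV_I)
    then show "\<exists>N \<delta>. 0 < \<delta> \<and> (\<forall>n\<ge>N. \<forall>y. \<bar>y - x\<bar> < \<delta> \<longrightarrow> norm (u y - u x) < e)"
      by (auto simp: dist_norm)
  qed (use u r x in \<open>auto intro: tendsto_intros\<close>)
  then have "(\<lambda>n. B (x n) (\<lambda>\<theta>. u (x n - d + \<theta>))) \<longlonglongrightarrow> B t (\<lambda>\<theta>. u (t - d + \<theta>))"
    by (intro seq_contCD[OF B] Cspace_segment u x)
  then show "(rhs u d \<circ> x) \<longlonglongrightarrow> rhs u d t" by (simp add: rhs_def o_def)
qed

lemma rhs_bound:
  assumes u: "continuous_on UNIV u" and R: "\<And>x. x \<in> {s - d - r..s - d} \<Longrightarrow> norm (u x) \<le> R"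
  shows "norm (rhs u d s) \<le> (1 + R) * k s"
proof -
  have "norm (rhs u d s) \<le> k s * (1 + Cnorm r (\<lambda>\<theta>. u (s - d + \<theta>)))"
    unfolding rhs_def by (intro growth Cspace_segment u)
  also have "\<dots> \<le> k s * (1 + R)"
    using r R k_nonneg by (intro mult_left_mono add_left_mono Cnorm_le) auto
  finally show ?thesis by (simp add: mult.commute)
qed

text \<open>Causality with a gap: at time \<open>s\<close> nothing later than \<open>s - d\<close>
  is seen.\<close>

lemma rhs_cong:
  assumes "continuous_on UNIV u" "continuous_on UNIV u'" "\<And>x. x \<le> s - d \<Longrightarrow> u x = u' x"
  shows "rhs u d s = rhs u' d s"
  unfolding rhs_def using r assms by (intro seq_contC_cong[OF B] Cspace_segment) auto

lemma rhs_dominated: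
  assumes u: "continuous_on UNIV u"
  shows "dominated (\<lambda>_. rhs u d)"
  unfolding dominated_def
proof (intro conjI allI)
  show "continuous_on UNIV (rhs u d)" by (rule rhs_continuous[OF u])
  fix b
  have "bounded (u ` {a - d - r..b - d})"
    by (intro compact_imp_bounded compact_continuous_image continuous_on_subset[OF u]) auto
  then obtain R where R: "\<And>x. x \<in> {a - d - r..b - d} \<Longrightarrow> norm (u x) \<le> R"
    unfolding bounded_iff by blast
  have "norm (rhs u d s) \<le> (1 + max 0 R) * k s" if "s \<in> {a..b}" for s
    using that R by (intro rhs_bound[OF u]) (auto intro: max.coboundedI2)
  then show "\<exists>c\<ge>0. \<forall>n::nat. \<forall>s\<in>{a..b}. norm (rhs u d s) \<le> c * k s"
    by (intro exI[of _ "1 + max 0 R"]) auto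
qed

lemma duhamel_cong:
  assumes "\<And>s. a \<le> s \<Longrightarrow> s \<le> t \<Longrightarrow> f s = f' s"
  shows "duhamel f t = duhamel f' t"
  unfolding duhamel_def using assms by (intro integral_cong) auto

text \<open>Picard iteration becomes stationary instead of merely converging: an iterate at times up
  to \<open>a + (j + 1) d\<close> depends on the previous one only up to \<open>a + j d\<close>,
  where it is already final.\<close>

lemma delayed_solution_exists:
  assumes d: "d > 0"
  obtains u where "continuous_on UNIV u" "\<And>t. u t = free_part t + duhamel (rhs u d) t"
proof -
  define U where "U j = ((\<lambda>u t. free_part t + duhamel (rhs u d) t) ^^ j) free_part" for j
  have U_Suc: "U (Suc j) t = free_part t + duhamel (rhs (U j) d) t" for j t by (simp add: U_def)
  have U_cont: "continuous_on UNIV (U j)" for j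
  proof (induction j)
    case 0
    then show ?case using free_part_continuous by (simp add: U_def)
  next
    case (Suc j)
    have "continuous_on UNIV (\<lambda>t. free_part t + duhamel (rhs (U j) d) t)"
      by (intro continuous_intros free_part_continuous duhamel_continuous rhs_dominated Suc)
    then show ?case by (simp add: U_Suc[abs_def])
  qed
  have agree: "U (Suc j) t = U j t" if "t \<le> a + real j * d" for j t
    using that
  proof (induction j arbitrary: t)
    case 0
    then show ?case by (simp add: U_Suc duhamel_before) (simp add: U_def)
  next
    case (Suc j)
    have "duhamel (rhs (U (Suc j)) d) t = duhamel (rhs (U j) d) t"
      using Suc by (intro duhamel_cong rhs_cong U_cont) (auto simp: algebra_simps)
    then show ?case unfolding U_Suc[of "Suc j"] U_Suc[of j] by simp
  qed
  have agree': "U i t = U j t" if "t \<le> a + real j * d" "j \<le> i" for i j t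
    using that(2)
  proof (induction i rule: dec_induct)
    case (step i)
    have "real j * d \<le> real i * d" using step d by (intro mult_right_mono) auto
    then show ?case using agree[of t i] step that(1) by simp
  qed simp
  \<comment> \<open>At time \<open>t\<close> this selects an iterate that has become stationary
    there; before \<open>a\<close> it is iterate 0.\<close>
  define u where "u t = U (nat \<lceil>(t - a) / d\<rceil>) t" for t
  have u_eq: "u t = U j t" if "t \<le> a + real j * d" for j t
  proof -
    have "(t - a) / d \<le> real (nat \<lceil>(t - a) / d\<rceil>)" by linarith
    then have "t \<le> a + real (nat \<lceil>(t - a) / d\<rceil>) * d" using d by (simp add: divide_le_eq)
    then show ?thesis unfolding u_def using agree' that by (metis nat_le_linear)
  qed
  have ex: "\<exists>j. t < a + real j * d" for t
  proof -
    obtain j where "t - a < real j * d" using reals_Archimedean3[OF d] by blast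
    then show ?thesis by (intro exI[of _ j]) simp
  qed
  have u_cont: "continuous_on UNIV u"
  proof -
    have "isCont u t" for t
    proof -
      obtain j where j: "t < a + real j * d" using ex by blast
      have "continuous_on {..<a + real j * d} u"
        by (rule continuous_on_eq[OF continuous_on_subset[OF U_cont[of j]]]) (auto intro!: u_eq[symmetric])
      then show ?thesis using j by (simp add: continuous_on_eq_continuous_at)
    qed
    then show ?thesis by (simp add: continuous_at_imp_continuous_on)
  qed
  moreover have "u t = free_part t + duhamel (rhs u d) t" for t
  proof -
    obtain j where j: "t < a + real j * d" using ex by blast
    have "u t = U (Suc j) t" using j agree[of t j] u_eq[of t j] by simp
    also have "\<dots> = free_part t + duhamel (rhs (U j) d) t" by (rule U_Suc)
    also have "duhamel (rhs (U j) d) t = duhamel (rhs u d) t"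
      using j d by (intro duhamel_cong rhs_cong U_cont u_cont) (auto intro!: u_eq[symmetric])
    finally show ?thesis .
  qed
  ultimately show ?thesis by (rule that)
qed

text \<open>A Gronwall argument by finitely many steps, on each of which the integral of \<open>k\<close> is so small that
  the maximum of the solution over the step is absorbed by half of itself.\<close>

lemma delayed_solution_bound:
  assumes cont: "\<And>n. continuous_on UNIV (us n)" and sol: "\<And>n t. us n t = free_part t + duhamel (rhs (us n) (d n)) t"
    and d: "\<And>n. 0 \<le> d n"
  shows "\<exists>R. \<forall>(n::nat) x. x \<le> b \<longrightarrow> norm (us n x) \<le> R"
proof -
  obtain Z where Z: "0 \<le> Z" "\<And>x. x \<le> b \<Longrightarrow> norm (free_part x) \<le> Z" using free_part_bounded by blast
  show ?thesis
  proof (cases "b \<le> a")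
    case True
    then show ?thesis using Z sol duhamel_before by (intro exI[of _ Z]) auto
  next
    case False
    then have ab: "a < b" by simp
    \<comment> \<open>\<open>E\<close> bounds the semigroup on the whole of [a, b]. The threshold
      \<open>1 / (2 * E)\<close> below cancels it and leaves the factor 1/2 needed for
      absorption.\<close>
    define E where "E = exp (\<bar>\<omega>\<bar> * (b - a))"
    have E: "E > 0" by (simp add: E_def)
    have "uniformly_continuous_on {a..b} cumulative_k"
      by (intro compact_uniformly_continuous cumulative_k_continuous) auto
    then obtain \<delta> where \<delta>: "\<delta> > 0"
      "\<And>x y. x \<in> {a..b} \<Longrightarrow> y \<in> {a..b} \<Longrightarrow> dist y x < \<delta> \<Longrightarrow> dist (cumulative_k y) (cumulative_k x) < 1 / (2 * E)"
      unfolding uniformly_continuous_on_def using E by (metis divide_pos_pos mult_pos_pos zero_less_numeral zero_less_one)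
    define h where "h = \<delta> / 2"
    have h: "h > 0" "h < \<delta>" using \<delta> by (auto simp: h_def)
    have step: "\<exists>R\<ge>0. \<forall>n x. x \<le> min b (a + real j * h) \<longrightarrow> norm (us n x) \<le> R" for j
    proof (induction j)
      case 0
      show ?case
        using Z sol duhamel_before by (intro exI[of _ Z]) auto
    next
      case (Suc j)
      then obtain R where R: "0 \<le> R" "\<And>n x. x \<le> min b (a + real j * h) \<Longrightarrow> norm (us n x) \<le> R" by blast
      define \<tau> where "\<tau> = min b (a + real j * h)"
      define \<tau>' where "\<tau>' = min b (a + real (Suc j) * h)"
      have \<tau>: "a \<le> \<tau>" "\<tau> \<le> \<tau>'" "\<tau>' \<le> b" "\<tau>' - \<tau> < \<delta>"
        using ab h by (auto simp: \<tau>_def \<tau>'_def algebra_simps min_def)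
      \<comment> \<open>This is what solving
        \<open>m \<le> Z + E * (R + Z) + (1 + (R + m)) / 2\<close> for \<open>m\<close> gives, plus
        a further nonnegative slack that the estimate at the end of the step shows
        explicitly.\<close>
      define R' where "R' = 2 * (Z + E * (R + Z)) + 1 + R"
      have R': "R \<le> R'" using E R Z by (simp add: R'_def)
      have "norm (us n x) \<le> R'" if x: "x \<le> \<tau>'" for n x
      proof (cases "x \<le> \<tau>")
        case True
        then show ?thesis using R(2)[of x n] R' by (simp add: \<tau>_def)
      next
        case False
        have "\<exists>y\<in>{\<tau>..\<tau>'}. \<forall>x\<in>{\<tau>..\<tau>'}. norm (us n x) \<le> norm (us n y)"
          using \<tau> by (intro continuous_attains_sup continuous_intros continuous_on_subset[OF cont]) auto
        then obtain y where y: "y \<in> {\<tau>..\<tau>'}" "\<And>x. x \<in> {\<tau>..\<tau>'} \<Longrightarrow> norm (us n x) \<le> norm (us n y)" by blast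
        define m where "m = norm (us n y)"
        \<comment> \<open>The delayed segment reaches back across \<open>\<tau>\<close>, so both the
          old bound and the new maximum enter; their sum covers the two cases.\<close>
        have m: "norm (us n x) \<le> R + m" if "x \<le> y" for x
        proof (cases "x \<le> \<tau>")
          case True
          then show ?thesis using R(2)[of x n] by (simp add: \<tau>_def m_def add_increasing2)
        next
          case False
          then show ?thesis using y that R(1) by (auto simp: m_def add_increasing)
        qed
        have fc: "continuous_on UNIV (rhs (us n) (d n))" by (rule rhs_continuous[OF cont])
        have "norm (duhamel (rhs (us n) (d n)) \<tau>) \<le> R + Z"
        proof -
          have "duhamel (rhs (us n) (d n)) \<tau> = us n \<tau> - free_part \<tau>" using sol[of n \<tau>] by simp
          then show ?thesis using R(2)[of \<tau> n] Z(2)[of \<tau>] \<tau> norm_triangle_ineq4[of "us n \<tau>" "free_part \<tau>"]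
            by (simp add: \<tau>_def)
        qed
        then have 1: "norm (T (y - \<tau>) (duhamel (rhs (us n) (d n)) \<tau>)) \<le> E * (R + Z)"
          using T_bound[of "y - \<tau>" "b - a" "duhamel (rhs (us n) (d n)) \<tau>"] y(1) \<tau> E
          unfolding E_def by (smt (verit) mult_left_mono atLeastAtMost_iff)
        have "norm (integral {\<tau>..y} (\<lambda>s. T (y - s) (rhs (us n) (d n) s))) \<le> E * (1 + (R + m)) * integral {\<tau>..y} k"
          unfolding E_def using \<tau> y(1) d[of n] r
          by (intro duhamel_tail_bound[OF fc] rhs_bound cont m) auto
        also have "\<dots> = E * (1 + (R + m)) * (cumulative_k y - cumulative_k \<tau>)" using y(1) \<tau> by (simp add: cumulative_k_diff)
        also have "\<dots> \<le> E * (1 + (R + m)) * (1 / (2 * E))"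
        proof (intro mult_left_mono)
          have "dist (cumulative_k y) (cumulative_k \<tau>) < 1 / (2 * E)" using y(1) \<tau> by (intro \<delta>(2)) (auto simp: dist_real_def)
          then show "cumulative_k y - cumulative_k \<tau> \<le> 1 / (2 * E)" by (simp add: dist_real_def)
          show "0 \<le> E * (1 + (R + m))" using E R by (simp add: m_def)
        qed
        also have "\<dots> = (1 + (R + m)) / 2" using E by simp
        finally have 2: "norm (integral {\<tau>..y} (\<lambda>s. T (y - s) (rhs (us n) (d n) s))) \<le> (1 + (R + m)) / 2" .
        have "duhamel (rhs (us n) (d n)) y = T (y - \<tau>) (duhamel (rhs (us n) (d n)) \<tau>) + integral {\<tau>..y} (\<lambda>s. T (y - s) (rhs (us n) (d n) s))"
          using y(1) \<tau> by (intro duhamel_split fc) auto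
        with 1 2 have "norm (duhamel (rhs (us n) (d n)) y) \<le> E * (R + Z) + (1 + (R + m)) / 2"
          by (metis norm_triangle_mono)
        then have "m \<le> Z + (E * (R + Z) + (1 + (R + m)) / 2)"
          unfolding m_def sol[of n y] using Z(2)[of y] y(1) \<tau> by (intro norm_triangle_mono) auto
        moreover have "m \<le> 2 * (Z + x) + 1 + R" if "m \<le> Z + (x + (1 + (R + m)) / 2)" for x
          using that by (simp add: field_simps)
        ultimately have "m \<le> R'" unfolding R'_def by blast
        then show ?thesis using y(2)[of x] x False by (simp add: m_def)
      qed
      then show ?case using R(1) R' by (intro exI[of _ R']) (auto simp: \<tau>'_def)
    qed
    obtain j where "b - a < real j * h" using reals_Archimedean3[OF h(1)] by blast
    then have "min b (a + real j * h) = b" by simp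
    then show ?thesis using step[of j] by metis
  qed
qed


section \<open>Passage to the limit as the additional delay vanishes\<close>

lemma mild_solution_exists:
  "\<exists>u. continuous_on {a - r..} u \<and> (\<forall>Tend>a. mild_solution_on T B r a Tend \<phi> u)"
proof -
  define d where "d n = 1 / real (Suc n)" for n
  have d: "d n > 0" "d \<longlonglongrightarrow> 0" for n
    using LIMSEQ_Suc[OF lim_const_over_n[of "1::real"]] by (auto simp: d_def[abs_def])
  have "\<forall>n. \<exists>u. continuous_on UNIV u \<and> (\<forall>t. u t = free_part t + duhamel (rhs u (d n)) t)"
  proof
    fix n
    show "\<exists>u. continuous_on UNIV u \<and> (\<forall>t. u t = free_part t + duhamel (rhs u (d n)) t)"
      by (rule delayed_solution_exists[OF d(1)[of n]]) blast
  qed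
  then obtain us where us: "\<And>n. continuous_on UNIV (us n)" "\<And>n t. us n t = free_part t + duhamel (rhs (us n) (d n)) t"
    by metis
  define fs where "fs n = rhs (us n) (d n)" for n
  define w where "w n = duhamel (fs n)" for n
  have us_eq: "us n t = free_part t + w n t" for n t using us(2) by (simp add: w_def fs_def)
  have bnd: "\<exists>c\<ge>0. \<forall>n. \<forall>s\<in>{a..b}. norm (fs n s) \<le> c * k s" for b
  proof -
    have "\<exists>R. \<forall>n x. x \<le> b \<longrightarrow> norm (us n x) \<le> R"
      by (rule delayed_solution_bound[where us = us and d = d, OF us less_imp_le[OF d(1)]])
    then obtain R where R: "\<And>n x. x \<le> b \<Longrightarrow> norm (us n x) \<le> R" by blast
    have "0 \<le> R" using order_trans[OF norm_ge_zero R[of b 0]] by simp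
    moreover have "norm (fs n s) \<le> (1 + R) * k s" if "s \<in> {a..b}" for n s
      unfolding fs_def using that less_imp_le[OF d(1)[of n]] by (intro rhs_bound us R) auto
    ultimately show ?thesis by (intro exI[of _ "1 + R"]) auto
  qed
  have fs: "dominated fs"
    unfolding dominated_def using bnd rhs_continuous[OF us(1)] by (simp add: fs_def)
  have "\<forall>q::rat. \<exists>K. compact K \<and> (\<forall>n. w n (of_rat q) \<in> K)"
  proof
    fix q :: rat
    show "\<exists>K. compact K \<and> (\<forall>n. w n (of_rat q) \<in> K)"
      unfolding w_def by (rule duhamel_compact[OF fs, of "of_rat q"]) blast
  qed
  then obtain K where K: "\<And>q::rat. compact (K q)" "\<And>q n. w n (of_rat q) \<in> K q" by metis
  \<comment> \<open>Tychonoff in place of a diagonal argument: the restrictions to the rationals lie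
    in a product of compact sets. The index set is countable, so the product is metrizable and a
    subsequence converges at all rationals at once.\<close>
  have "compactin (product_topology (\<lambda>_. euclidean) UNIV) (PiE UNIV K)"
    using K(1) by (simp add: compactin_PiE)
  then have "seq_compact (PiE UNIV K)"
    by (simp add: euclidean_product_topology compact_eq_seq_compact_metric)
  moreover have "\<forall>n. (\<lambda>q. w n (of_rat q)) \<in> PiE UNIV K" using K(2) by auto
  ultimately obtain l \<sigma> where \<sigma>: "strict_mono \<sigma>" "((\<lambda>n q. w n (of_rat q)) \<circ> \<sigma>) \<longlonglongrightarrow> l"
    unfolding seq_compact_def by meson
  have lim_rat: "(\<lambda>n. w (\<sigma> n) (of_rat q)) \<longlonglongrightarrow> l q" for q
    using \<sigma>(2) continuous_on_tendsto_compose[OF continuous_on_product_coordinates[of q] \<sigma>(2)]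
    by (simp add: o_def)
  \<comment> \<open>Equicontinuity at \<open>t\<close>, uniform in the index, transfers convergence
    from a nearby rational.\<close>
  have "Cauchy (\<lambda>n. w (\<sigma> n) t)" for t
  proof (rule metric_CauchyI)
    fix e :: real assume "e > 0"
    then have e: "e / 3 > 0" by simp
    obtain \<delta> where \<delta>: "\<delta> > 0" "\<And>n s. \<bar>s - t\<bar> < \<delta> \<Longrightarrow> norm (w n s - w n t) < e / 3"
      unfolding w_def using duhamel_equicontinuous[OF fs e] by blast
    obtain q :: rat where q: "t < of_rat q" "of_rat q < t + \<delta>" using of_rat_dense[of t "t + \<delta>"] \<delta>(1) by auto
    have "Cauchy (\<lambda>n. w (\<sigma> n) (of_rat q))" by (rule LIMSEQ_imp_Cauchy[OF lim_rat])
    then obtain M where M: "\<And>m n. m \<ge> M \<Longrightarrow> n \<ge> M \<Longrightarrow> dist (w (\<sigma> m) (of_rat q)) (w (\<sigma> n) (of_rat q)) < e / 3"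
      using e unfolding Cauchy_def by blast
    have "dist (w (\<sigma> m) t) (w (\<sigma> n) t) < e" if "m \<ge> M" "n \<ge> M" for m n
    proof -
      have "dist (w (\<sigma> m) (of_rat q)) (w (\<sigma> m) t) < e / 3" "dist (w (\<sigma> n) (of_rat q)) (w (\<sigma> n) t) < e / 3"
        using q \<delta>(2)[of "of_rat q"] by (auto simp: dist_norm)
      with M[OF that] show ?thesis
        using dist_triangle3[of "w (\<sigma> m) t" "w (\<sigma> n) t" "w (\<sigma> m) (of_rat q)"]
          dist_triangle[of "w (\<sigma> m) (of_rat q)" "w (\<sigma> n) t" "w (\<sigma> n) (of_rat q)"] by linarith
    qed
    then show "\<exists>M. \<forall>m\<ge>M. \<forall>n\<ge>M. dist (w (\<sigma> m) t) (w (\<sigma> n) t) < e" by blast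
  qed
  then have "\<forall>t. \<exists>y. (\<lambda>n. w (\<sigma> n) t) \<longlonglongrightarrow> y" using convergent_eq_Cauchy by blast
  then obtain w' where w': "\<And>t. (\<lambda>n. w (\<sigma> n) t) \<longlonglongrightarrow> w' t" by metis
  define u where "u t = free_part t + w' t" for t
  have lim: "(\<lambda>n. us (\<sigma> n) t) \<longlonglongrightarrow> u t" for t
    unfolding us_eq u_def by (intro tendsto_intros w')
  have equi: "\<exists>\<delta>>0. \<forall>n s. \<bar>s - t\<bar> < \<delta> \<longrightarrow> norm (us n s - us n t) < e" if e: "e > 0" for t e
  proof -
    have e': "e / 2 > 0" using e by simp
    obtain \<delta> where \<delta>: "\<delta> > 0" "\<And>n s. \<bar>s - t\<bar> < \<delta> \<Longrightarrow> norm (w n s - w n t) < e / 2"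
      unfolding w_def using duhamel_equicontinuous[OF fs e'] by blast
    obtain \<delta>' where \<delta>': "\<delta>' > 0" "\<And>s. dist s t < \<delta>' \<Longrightarrow> dist (free_part s) (free_part t) < e / 2"
      using free_part_continuous e' unfolding continuous_on_iff by (metis UNIV_I)
    have "norm (us n s - us n t) < e" if "\<bar>s - t\<bar> < min \<delta> \<delta>'" for n s
    proof -
      have "us n s - us n t = (free_part s - free_part t) + (w n s - w n t)" by (simp add: us_eq)
      moreover have "norm (free_part s - free_part t) < e / 2" "norm (w n s - w n t) < e / 2"
        using \<delta>(2) \<delta>'(2)[of s] that by (auto simp: dist_norm)
      ultimately show ?thesis using norm_triangle_ineq[of "free_part s - free_part t" "w n s - w n t"] by simp
    qed
    then show ?thesis using \<delta>(1) \<delta>'(1) by (intro exI[of _ "min \<delta> \<delta>'"]) auto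
  qed
  \<comment> \<open>Pointwise convergence and equicontinuity combined into the form that gives
    convergence of segments, even at the moving times \<open>s - d (\<sigma> n)\<close>.\<close>
  have conv: "\<exists>N \<delta>. \<delta> > 0 \<and> (\<forall>n\<ge>N. \<forall>y. \<bar>y - x\<bar> < \<delta> \<longrightarrow> norm (us (\<sigma> n) y - u x) < e)" if "e > 0" for x e
  proof -
    have e: "e / 2 > 0" using that by simp
    obtain \<delta> where \<delta>: "\<delta> > 0" "\<And>n s. \<bar>s - x\<bar> < \<delta> \<Longrightarrow> norm (us n s - us n x) < e / 2"
      using equi[OF e] by blast
    obtain N where N: "\<And>n. n \<ge> N \<Longrightarrow> norm (us (\<sigma> n) x - u x) < e / 2"
      using LIMSEQ_D[OF lim e] by blast
    have "norm (us (\<sigma> n) y - u x) < e" if "n \<ge> N" "\<bar>y - x\<bar> < \<delta>" for n y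
      using N[OF that(1)] \<delta>(2)[OF that(2), of "\<sigma> n"]
        norm_triangle_ineq[of "us (\<sigma> n) y - us (\<sigma> n) x" "us (\<sigma> n) x - u x"] by simp
    then show ?thesis using \<delta>(1) by blast
  qed
  have u_cont: "continuous_on UNIV u"
    unfolding continuous_on_iff
  proof (intro ballI allI impI)
    fix t e :: real assume "e > 0"
    then have e: "e / 2 > 0" by simp
    obtain \<delta> where \<delta>: "\<delta> > 0" "\<And>n s. \<bar>s - t\<bar> < \<delta> \<Longrightarrow> norm (us n s - us n t) < e / 2"
      using equi[OF e] by blast
    have "dist (u s) (u t) < e" if "dist s t < \<delta>" for s
    proof -
      have "(\<lambda>n. norm (us (\<sigma> n) s - us (\<sigma> n) t)) \<longlonglongrightarrow> norm (u s - u t)"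
        by (intro tendsto_intros lim)
      moreover have "\<forall>n. norm (us (\<sigma> n) s - us (\<sigma> n) t) \<le> e / 2"
        using \<delta>(2)[of s] that by (auto simp: dist_real_def intro: less_imp_le)
      ultimately have "norm (u s - u t) \<le> e / 2"
        by (intro tendsto_upperbound) auto
      then show ?thesis using \<open>e > 0\<close> by (simp add: dist_norm)
    qed
    then show "\<exists>\<delta>>0. \<forall>s\<in>UNIV. dist s t < \<delta> \<longrightarrow> dist (u s) (u t) < e" using \<delta>(1) by blast
  qed
  define f where "f = rhs u 0"
  have f_cont: "continuous_on UNIV f" unfolding f_def by (rule rhs_continuous[OF u_cont])
  have fs_lim: "(\<lambda>n. fs (\<sigma> n) s) \<longlonglongrightarrow> f s" for s
  proof -
    have ds: "(\<lambda>n. d (\<sigma> n)) \<longlonglongrightarrow> 0"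
      using LIMSEQ_subseq_LIMSEQ[OF d(2) \<sigma>(1)] by (simp add: o_def)
    have "(\<lambda>n. s - d (\<sigma> n)) \<longlonglongrightarrow> s - 0" by (intro tendsto_intros ds)
    then have "(\<lambda>n. Cnorm r (\<lambda>\<theta>. us (\<sigma> n) (s - d (\<sigma> n) + \<theta>) - u (s - 0 + \<theta>))) \<longlonglongrightarrow> 0"
      using r by (intro Cnorm_segment_tendsto conv u_cont us(1)) auto
    then show ?thesis
      unfolding fs_def f_def rhs_def by (intro seq_contCD[OF B] Cspace_segment us(1) u_cont tendsto_const)
  qed
  have duhamel_lim: "(\<lambda>n. w (\<sigma> n) t) \<longlonglongrightarrow> duhamel f t" if t: "a \<le> t" for t
  proof -
    define E where "E = exp (\<bar>\<omega>\<bar> * (t - a))"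
    obtain c where c: "c \<ge> 0" "\<And>n s. s \<in> {a..t} \<Longrightarrow> norm (fs n s) \<le> c * k s" using bnd by meson
    have cont: "continuous_on UNIV (fs n)" for n using fs by (simp add: dominated_def)
    \<comment> \<open>Dominated convergence is applied to these real functions, with majorant
      \<open>2 * c * k\<close>; the bound \<open>E\<close> on the semigroup then carries the result
      over to the integrals in the Banach space.\<close>
    define g where "g n s = norm (fs (\<sigma> n) s - f s)" for n s
    have g_int: "g n integrable_on {a..t}" for n
      unfolding g_def[abs_def]
      by (intro integrable_continuous_real continuous_intros continuous_on_subset[OF cont] continuous_on_subset[OF f_cont]) auto
    have f_bound: "norm (f s) \<le> c * k s" if "s \<in> {a..t}" for s
      using tendsto_upperbound[OF tendsto_norm[OF fs_lim]] c(2)[OF that] by (simp add: eventually_sequentially)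
    have "(\<lambda>n. integral {a..t} (g n)) \<longlonglongrightarrow> integral {a..t} (\<lambda>_. 0)"
    proof (rule dominated_convergence(2))
      show "(\<lambda>s. (2 * c) *\<^sub>R k s) integrable_on {a..t}" by (intro integrable_cmul k_int)
      show "norm (g n s) \<le> (2 * c) *\<^sub>R k s" if "s \<in> {a..t}" for n s
        using norm_triangle_ineq4[of "fs (\<sigma> n) s" "f s"] c(2)[OF that, of "\<sigma> n"] f_bound[OF that]
        by (simp add: g_def)
      show "(\<lambda>n. g n s) \<longlonglongrightarrow> 0" if "s \<in> {a..t}" for s
        using tendsto_norm[OF tendsto_diff[OF fs_lim[of s] tendsto_const[of "f s"]]] by (simp add: g_def)
    qed (rule g_int)
    then have lim0: "(\<lambda>n. E * integral {a..t} (g n)) \<longlonglongrightarrow> E * 0" by (intro tendsto_intros) simp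
    have "(\<lambda>n. w (\<sigma> n) t - duhamel f t) \<longlonglongrightarrow> 0"
    proof (rule Lim_null_comparison)
      show "(\<lambda>n. E * integral {a..t} (g n)) \<longlonglongrightarrow> 0" using lim0 by simp
      have "norm (w (\<sigma> n) t - duhamel f t) \<le> E * integral {a..t} (g n)" for n
      proof -
        have "w (\<sigma> n) t - duhamel f t = integral {a..t} (\<lambda>s. T (t - s) (fs (\<sigma> n) s) - T (t - s) (f s))"
          unfolding w_def duhamel_def by (intro integral_diff[symmetric] duhamel_integrable cont f_cont)
        moreover have "norm (integral {a..t} (\<lambda>s. T (t - s) (fs (\<sigma> n) s) - T (t - s) (f s)))
            \<le> integral {a..t} (\<lambda>s. E *\<^sub>R g n s)"
        proof (rule integral_norm_bound_integral)
          show "(\<lambda>s. T (t - s) (fs (\<sigma> n) s) - T (t - s) (f s)) integrable_on {a..t}"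
            by (intro integrable_diff duhamel_integrable cont f_cont)
          show "(\<lambda>s. E *\<^sub>R g n s) integrable_on {a..t}" by (intro integrable_cmul g_int)
          fix s assume "s \<in> {a..t}"
          then show "norm (T (t - s) (fs (\<sigma> n) s) - T (t - s) (f s)) \<le> E *\<^sub>R g n s"
            using T_bound[of "t - s" "t - a" "fs (\<sigma> n) s - f s"] by (simp add: E_def g_def blinfun.diff_right)
        qed
        ultimately show ?thesis by simp
      qed
      then show "\<forall>\<^sub>F n in sequentially. norm (w (\<sigma> n) t - duhamel f t) \<le> E * integral {a..t} (g n)"
        by (intro always_eventually) blast
    qed
    then show ?thesis by (simp add: LIM_zero_iff)
  qed
  have u_eq: "u t = free_part t + duhamel f t" if "a \<le> t" for t
    using LIMSEQ_unique[OF w' duhamel_lim[OF that]] by (simp add: u_def)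
  have "mild_solution_on T B r a Tend \<phi> u" for Tend
    unfolding mild_solution_on_def
  proof (intro conjI ballI)
    show "continuous_on {a - r..Tend} u" by (rule continuous_on_subset[OF u_cont]) simp
    fix \<theta> assume \<theta>: "\<theta> \<in> {-r..0}"
    have "(\<lambda>n. w (\<sigma> n) (a + \<theta>)) \<longlonglongrightarrow> 0" using \<theta> by (simp add: w_def duhamel_before)
    then have "w' (a + \<theta>) = 0" by (rule LIMSEQ_unique[OF w'])
    then show "u (a + \<theta>) = \<phi> \<theta>" using free_part_before[OF \<theta>] by (simp add: u_def)
  next
    fix t assume "t \<in> {a..Tend}"
    then have t: "a \<le> t" by simp
    have "u t - T (t - a) (\<phi> 0) = duhamel f t" using u_eq[OF t] free_part_after[OF t] by simp
    moreover have "f = (\<lambda>s. B s (\<lambda>\<theta>. u (s + \<theta>)))" by (auto simp: f_def rhs_def)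
    ultimately show "((\<lambda>s. T (t - s) (B s (\<lambda>\<theta>. u (s + \<theta>)))) has_integral (u t - T (t - a) (\<phi> 0))) {a..t}"
      using integrable_integral[OF duhamel_integrable[OF f_cont, of t a]] by (simp add: duhamel_def)
  qed
  then show ?thesis using continuous_on_subset[OF u_cont] by blast
qed

end

section \<open>Continuity of the delay functional\<close>

lemma norm_suminf_tail_le:
  fixes h :: "nat \<Rightarrow> real" and x :: "nat \<Rightarrow> 'x::banach"
  assumes tail: "\<And>m. (\<Sum>k\<in>{N..<m}. \<bar>h k\<bar>) \<le> \<epsilon>" and C: "\<And>k. norm (x k) \<le> C"
  shows "summable (\<lambda>k. \<bar>h k\<bar>)"
    and "norm ((\<Sum>k. h k *\<^sub>R x k) - (\<Sum>k<N. h k *\<^sub>R x k)) \<le> C * \<epsilon>"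
proof -
  have C0: "0 \<le> C" using order_trans[OF norm_ge_zero C[of 0]] by simp
  show h: "summable (\<lambda>k. \<bar>h k\<bar>)"
  proof (rule summableI_nonneg_bounded)
    fix n
    have "(\<Sum>k<n. \<bar>h k\<bar>) \<le> (\<Sum>k\<in>{..<N} \<union> {N..<n}. \<bar>h k\<bar>)" by (intro sum_mono2) auto
    also have "\<dots> = (\<Sum>k<N. \<bar>h k\<bar>) + (\<Sum>k\<in>{N..<n}. \<bar>h k\<bar>)" by (intro sum.union_disjoint) auto
    also have "\<dots> \<le> (\<Sum>k<N. \<bar>h k\<bar>) + \<epsilon>" using tail by simp
    finally show "(\<Sum>k<n. \<bar>h k\<bar>) \<le> (\<Sum>k<N. \<bar>h k\<bar>) + \<epsilon>" .
  qed simp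
  have "summable (\<lambda>k. h k *\<^sub>R x k)"
  proof (rule summable_comparison_test[OF _ summable_mult[OF h, of C]])
    show "\<exists>N. \<forall>n\<ge>N. norm (h n *\<^sub>R x n) \<le> C * \<bar>h n\<bar>"
      using mult_right_mono[OF C abs_ge_zero] by (intro exI[of _ 0]) (simp add: mult.commute)
  qed
  then have lim: "(\<lambda>m. norm ((\<Sum>k<m. h k *\<^sub>R x k) - (\<Sum>k<N. h k *\<^sub>R x k)))
      \<longlonglongrightarrow> norm ((\<Sum>k. h k *\<^sub>R x k) - (\<Sum>k<N. h k *\<^sub>R x k))"
    by (intro tendsto_intros summable_LIMSEQ)
  have "norm ((\<Sum>k<m. h k *\<^sub>R x k) - (\<Sum>k<N. h k *\<^sub>R x k)) \<le> C * \<epsilon>" if "m \<ge> N" for m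
  proof -
    have "(\<Sum>k<m. h k *\<^sub>R x k) = (\<Sum>k<N. h k *\<^sub>R x k) + (\<Sum>k\<in>{N..<m}. h k *\<^sub>R x k)"
      using sum.atLeastLessThan_concat[of 0 N m "\<lambda>k. h k *\<^sub>R x k"] that by (simp add: lessThan_atLeast0)
    then have "norm ((\<Sum>k<m. h k *\<^sub>R x k) - (\<Sum>k<N. h k *\<^sub>R x k)) = norm (\<Sum>k\<in>{N..<m}. h k *\<^sub>R x k)" by simp
    also have "\<dots> \<le> (\<Sum>k\<in>{N..<m}. C * \<bar>h k\<bar>)"
      using mult_right_mono[OF C abs_ge_zero] by (intro sum_norm_le) (simp add: mult.commute)
    also have "\<dots> \<le> C * \<epsilon>" using tail[of m] C0 by (simp add: sum_distrib_left[symmetric] mult_left_mono)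
    finally show ?thesis .
  qed
  then show "norm ((\<Sum>k. h k *\<^sub>R x k) - (\<Sum>k<N. h k *\<^sub>R x k)) \<le> C * \<epsilon>"
    by (intro tendsto_upperbound[OF lim]) (auto simp: eventually_sequentially)
qed

lemma suminf_scaleR_tendsto:
  fixes hs :: "nat \<Rightarrow> nat \<Rightarrow> real" and xs :: "nat \<Rightarrow> nat \<Rightarrow> 'x::banach"
  assumes hs: "\<And>k. (\<lambda>n. hs n k) \<longlonglongrightarrow> h k" and xs: "\<And>k. (\<lambda>n. xs n k) \<longlonglongrightarrow> x k"
    and C: "\<And>n k. norm (xs n k) \<le> C" "\<And>k. norm (x k) \<le> C"
    and tail: "\<And>\<epsilon>. \<epsilon> > 0 \<Longrightarrow> \<exists>N. \<forall>m. (\<Sum>k\<in>{N..<m}. \<bar>h k\<bar>) \<le> \<epsilon> \<and> (\<forall>n. (\<Sum>k\<in>{N..<m}. \<bar>hs n k\<bar>) \<le> \<epsilon>)"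
  shows "(\<lambda>n. \<Sum>k. hs n k *\<^sub>R xs n k) \<longlonglongrightarrow> (\<Sum>k. h k *\<^sub>R x k)"
proof (rule tendstoI)
  fix e :: real assume e: "e > 0"
  have C0: "0 \<le> C" using order_trans[OF norm_ge_zero C(2)[of 0]] by simp
  \<comment> \<open>Two tails and the finite sum get \<open>e / 3\<close> each; \<open>C + 1\<close>
    is positive even if \<open>C\<close> is 0.\<close>
  define e' where "e' = e / (3 * (C + 1))"
  have e': "e' > 0" "C * e' \<le> e / 3"
  proof -
    show "e' > 0" using e C0 by (simp add: e'_def)
    then have "C * e' \<le> (C + 1) * e'" by (intro mult_right_mono) auto
    also have "\<dots> = e / 3"
    proof -
      have "d * (e / (3 * d)) = e / 3" if "d \<noteq> 0" for d using that by simp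
      from this[of "C + 1"] show ?thesis using C0 by (simp add: e'_def)
    qed
    finally show "C * e' \<le> e / 3" .
  qed
  obtain N where N: "\<And>m. (\<Sum>k\<in>{N..<m}. \<bar>h k\<bar>) \<le> e'" "\<And>n m. (\<Sum>k\<in>{N..<m}. \<bar>hs n k\<bar>) \<le> e'"
    using tail[OF e'(1)] by blast
  have "(\<lambda>n. \<Sum>k<N. hs n k *\<^sub>R xs n k) \<longlonglongrightarrow> (\<Sum>k<N. h k *\<^sub>R x k)"
    by (intro tendsto_intros hs xs)
  from tendstoD[OF this, of "e / 3"] e
  have "\<forall>\<^sub>F n in sequentially. dist (\<Sum>k<N. hs n k *\<^sub>R xs n k) (\<Sum>k<N. h k *\<^sub>R x k) < e / 3" by simp
  then show "\<forall>\<^sub>F n in sequentially. dist (\<Sum>k. hs n k *\<^sub>R xs n k) (\<Sum>k. h k *\<^sub>R x k) < e"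
  proof eventually_elim
    case (elim n)
    have "dist (\<Sum>k. hs n k *\<^sub>R xs n k) (\<Sum>k<N. hs n k *\<^sub>R xs n k) \<le> e / 3"
      using norm_suminf_tail_le(2)[where h = "hs n" and x = "xs n", OF N(2) C(1)] e'(2) by (simp add: dist_norm)
    moreover have "dist (\<Sum>k. h k *\<^sub>R x k) (\<Sum>k<N. h k *\<^sub>R x k) \<le> e / 3"
      using norm_suminf_tail_le(2)[where h = h and x = x, OF N(1) C(2)] e'(2) by (simp add: dist_norm)
    ultimately show ?case using elim
      dist_triangle[of "\<Sum>k. hs n k *\<^sub>R xs n k" "\<Sum>k. h k *\<^sub>R x k" "\<Sum>k<N. hs n k *\<^sub>R xs n k"]
      dist_triangle2[of "\<Sum>k<N. hs n k *\<^sub>R xs n k" "\<Sum>k. h k *\<^sub>R x k" "\<Sum>k<N. h k *\<^sub>R x k"] by linarith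
  qed
qed

section \<open>Splitting the delay functional\<close>

lemma RS_integral_bound:
  fixes Q :: "real \<Rightarrow> 'x::banach"
  assumes Q: "continuous_on {a..b} Q" and dom: "var_dom f v a b" and ab: "a \<le> b"
    and C: "\<And>s. s \<in> {a..b} \<Longrightarrow> norm (Q s) \<le> C"
  shows "norm (RS_integral Q f a b) \<le> C * (v b - v a)"
proof -
  obtain I where I: "has_RS_integral Q f a b I" by (rule has_RS_integral_exists[OF Q dom ab])
  show ?thesis
    unfolding RS_integral_eqI[OF I ab] by (rule has_RS_integral_bound[OF I dom ab C])
qed

lemma RS_integral_decomposition:
  fixes Q :: "real \<Rightarrow> 'x::banach"
  assumes ab: "a < b" and dom: "var_dom f v a b" and Q: "continuous_on {a..b} Q"
    and jumps: "\<And>y. y \<in> {a..b} \<Longrightarrow> jump_at (jump_part f a b) a b y = (\<Sum>k. if y = q k then h k else 0)"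
    and h: "summable (\<lambda>k. \<bar>h k\<bar>)" and q: "\<And>k. q k \<in> {a..b}"
  obtains I V where "var_dom (cont_part f a b) V a b" "V b - V a \<le> 2 * (v b - v a)"
    "has_RS_integral Q (cont_part f a b) a b I"
    "RS_integral Q f a b = I + (\<Sum>k. h k *\<^sub>R Q (q k))"
proof -
  interpret bv_function f v a b by unfold_locales (fact ab, fact dom)
  obtain I where I: "has_RS_integral Q (cont_part f a b) a b I"
    by (rule has_RS_integral_exists[OF Q cont_part_variation(1) less_imp_le[OF ab]])
  have "bounded (Q ` {a..b})" using Q by (intro compact_imp_bounded compact_continuous_image) auto
  then obtain K where K: "\<And>y. y \<in> {a..b} \<Longrightarrow> norm (Q y) \<le> K" unfolding bounded_iff by blast
  have "infsum (\<lambda>y. jump_at (jump_part f a b) a b y *\<^sub>R Q y) {a..b}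
      = infsum (\<lambda>y. (\<Sum>k. if y = q k then h k else 0) *\<^sub>R Q y) {a..b}"
    by (intro infsum_cong) (simp add: jumps)
  also have "\<dots> = (\<Sum>k. h k *\<^sub>R Q (q k))" by (rule infsum_point_masses[OF h q K])
  finally have "has_RS_integral Q (jump_part f a b) a b (\<Sum>k. h k *\<^sub>R Q (q k))"
    using has_RS_integral_jump_part[OF Q] by simp
  from has_RS_integral_add[OF I this]
  have "has_RS_integral Q f a b (I + (\<Sum>k. h k *\<^sub>R Q (q k)))" by (simp add: cont_part_def)
  then have "RS_integral Q f a b = I + (\<Sum>k. h k *\<^sub>R Q (q k))"
    using ab by (intro RS_integral_eqI) auto
  then show ?thesis using that[OF cont_part_variation I] by blast
qed

locale delay_functional =
  fixes r L C\<^sub>1 C\<^sub>2 M :: real and p :: "real \<Rightarrow> 'x::banach \<Rightarrow> 'x"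
    and g :: "real \<Rightarrow> real \<Rightarrow> (real \<Rightarrow> 'x) \<Rightarrow> real"
    and \<eta> h :: "nat \<Rightarrow> real \<Rightarrow> (real \<Rightarrow> 'x) \<Rightarrow> real"
  assumes r: "0 < r" and L: "0 \<le> L"
    and p_lip: "\<And>t s u v. norm (p t u - p s v) \<le> L * (\<bar>s - t\<bar> + norm (u - v))"
    and C12: "0 \<le> C\<^sub>1" "0 \<le> C\<^sub>2"
    and p_growth: "\<And>s u. norm (p s u) \<le> C\<^sub>1 * norm u + C\<^sub>2"
    and A1: "\<And>t \<psi>. \<psi> \<in> Cspace r \<Longrightarrow>
               has_bounded_variation (\<lambda>\<theta>. g \<theta> t \<psi>) (-r) 0
             \<and> total_variation (\<lambda>\<theta>. g \<theta> t \<psi>) (-r) 0 \<le> M"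
    and A2: "\<And>\<theta>. \<theta> \<in> {-r..0} \<Longrightarrow> contC r (\<lambda>t \<psi>. cont_part (\<lambda>\<sigma>. g \<sigma> t \<psi>) (-r) 0 \<theta>)"
    and A3_range: "\<And>k t \<psi>. \<psi> \<in> Cspace r \<Longrightarrow> \<eta> k t \<psi> \<in> {0..r}"
    and A3_eta_cont: "\<And>k. contC r (\<eta> k)"
    and A3_h_cont: "\<And>k. contC r (h k)"
    and A3_jumps: "\<And>t \<psi> \<theta>. \<psi> \<in> Cspace r \<Longrightarrow> \<theta> \<in> {-r..0} \<Longrightarrow>
               jump_at (jump_part (\<lambda>\<sigma>. g \<sigma> t \<psi>) (-r) 0) (-r) 0 \<theta>
             = (\<Sum>k. if \<theta> = - \<eta> k t \<psi> then h k t \<psi> else 0)"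
    and A3_unif: "\<And>R \<epsilon>. \<epsilon> > 0 \<Longrightarrow> \<exists>N. \<forall>t \<psi>. \<psi> \<in> Cspace r \<and> \<bar>t\<bar> \<le> R \<and> Cnorm r \<psi> \<le> R \<longrightarrow>
               (\<forall>m n. N \<le> m \<longrightarrow> (\<Sum>k\<in>{m..<n}. \<bar>h k t \<psi>\<bar>) < \<epsilon>)"
begin

definition F where "F t \<psi> = RS_integral (\<lambda>\<theta>. p t (\<psi> \<theta>)) (\<lambda>\<theta>. g \<theta> t \<psi>) (-r) 0"

lemma p_continuous:
  assumes "\<psi> \<in> Cspace r"
  shows "continuous_on {-r..0} (\<lambda>\<theta>. p t (\<psi> \<theta>))"
proof -
  have "L-lipschitz_on UNIV (p t)"
    using p_lip[of t _ t] L by (intro lipschitz_onI) (auto simp: dist_norm)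
  then have "continuous_on UNIV (p t)" by (rule lipschitz_on_continuous_on)
  moreover have "continuous_on {-r..0} \<psi>" using assms by (simp add: Cspace_def)
  ultimately show ?thesis by (rule continuous_on_compose2) simp
qed

lemma p_bound:
  assumes "\<psi> \<in> Cspace r" "\<theta> \<in> {-r..0}"
  shows "norm (p t (\<psi> \<theta>)) \<le> C\<^sub>1 * Cnorm r \<psi> + C\<^sub>2"
  using p_growth[of t "\<psi> \<theta>"] mult_left_mono[OF norm_le_Cnorm[OF assms] C12(1)] by linarith

lemma g_variation:
  assumes "\<psi> \<in> Cspace r"
  obtains v where "var_dom (\<lambda>\<theta>. g \<theta> t \<psi>) v (-r) 0" "v 0 - v (-r) \<le> M"
proof -
  have bv: "has_bounded_variation (\<lambda>\<theta>. g \<theta> t \<psi>) (-r) 0"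
    and tv: "total_variation (\<lambda>\<theta>. g \<theta> t \<psi>) (-r) 0 \<le> M" using A1[OF assms, of t] by auto
  have "-r \<le> 0" using r by simp
  from bounded_variation_imp_var_dom[OF bv this]
  obtain v where "var_dom (\<lambda>\<theta>. g \<theta> t \<psi>) v (-r) 0"
    "v 0 - v (-r) \<le> total_variation (\<lambda>\<theta>. g \<theta> t \<psi>) (-r) 0" by blast
  with tv show ?thesis by (intro that[of v]) auto
qed

lemma M_nonneg: "0 \<le> M"
proof -
  have "(\<lambda>_. 0) \<in> Cspace r" by (simp add: Cspace_def)
  then obtain v where v: "var_dom (\<lambda>\<theta>. g \<theta> 0 (\<lambda>_. 0)) v (-r) 0" "v 0 - v (-r) \<le> M"
    by (rule g_variation)
  then show ?thesis using var_domD[OF v(1), of "-r" 0] r by auto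
qed

lemma F_bound:
  assumes "\<psi> \<in> Cspace r"
  shows "norm (F t \<psi>) \<le> (C\<^sub>1 * Cnorm r \<psi> + C\<^sub>2) * M"
proof -
  obtain v where v: "var_dom (\<lambda>\<theta>. g \<theta> t \<psi>) v (-r) 0" "v 0 - v (-r) \<le> M"
    by (rule g_variation[OF assms])
  have "norm (F t \<psi>) \<le> (C\<^sub>1 * Cnorm r \<psi> + C\<^sub>2) * (v 0 - v (-r))"
    unfolding F_def using r by (intro RS_integral_bound p_continuous assms v p_bound) auto
  also have "\<dots> \<le> (C\<^sub>1 * Cnorm r \<psi> + C\<^sub>2) * M"
    using v(2) C12 Cnorm_nonneg[OF _ assms] r by (intro mult_left_mono) auto
  finally show ?thesis .
qed

lemma F_decomposition:
  assumes \<psi>: "\<psi> \<in> Cspace r"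
  shows "\<exists>I V. var_dom (cont_part (\<lambda>\<theta>. g \<theta> t \<psi>) (-r) 0) V (-r) 0 \<and> V 0 - V (-r) \<le> 2 * M
    \<and> has_RS_integral (\<lambda>\<theta>. p t (\<psi> \<theta>)) (cont_part (\<lambda>\<theta>. g \<theta> t \<psi>) (-r) 0) (-r) 0 I
    \<and> F t \<psi> = I + (\<Sum>k. h k t \<psi> *\<^sub>R p t (\<psi> (- \<eta> k t \<psi>)))"
proof -
  obtain v where v: "var_dom (\<lambda>\<theta>. g \<theta> t \<psi>) v (-r) 0" "v 0 - v (-r) \<le> M"
    by (rule g_variation[OF \<psi>])
  \<comment> \<open>Uniformity on a bounded set containing this single (t, \<psi>) is used only to
    obtain absolute summability there.\<close>
  obtain N where N: "\<And>m. (\<Sum>k\<in>{N..<m}. \<bar>h k t \<psi>\<bar>) \<le> 1"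
    using A3_unif[of 1 "max \<bar>t\<bar> (Cnorm r \<psi>)"] \<psi> by (meson less_imp_le max.cobounded1 max.cobounded2 order_refl zero_less_one)
  have h: "summable (\<lambda>k. \<bar>h k t \<psi>\<bar>)"
    by (rule norm_suminf_tail_le(1)[where x = "\<lambda>_. 0 :: real" and C = 0, OF N]) simp
  show ?thesis
  proof (rule RS_integral_decomposition[OF _ v(1) p_continuous[OF \<psi>, of t] A3_jumps[OF \<psi>] h])
    show "- r < 0" using r by simp
    show "- \<eta> k t \<psi> \<in> {-r..0}" for k using A3_range[OF \<psi>, of k t] by auto
    fix I V assume *: "var_dom (cont_part (\<lambda>\<theta>. g \<theta> t \<psi>) (- r) 0) V (- r) 0"
      "V 0 - V (- r) \<le> 2 * (v 0 - v (- r))"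
      "has_RS_integral (\<lambda>\<theta>. p t (\<psi> \<theta>)) (cont_part (\<lambda>\<theta>. g \<theta> t \<psi>) (- r) 0) (- r) 0 I"
      "RS_integral (\<lambda>\<theta>. p t (\<psi> \<theta>)) (\<lambda>\<theta>. g \<theta> t \<psi>) (- r) 0 = I + (\<Sum>k. h k t \<psi> *\<^sub>R p t (\<psi> (- \<eta> k t \<psi>)))"
    have "V 0 - V (-r) \<le> 2 * M"
      by (rule order_trans[OF *(2)]) (use v(2) in simp)
    then show ?thesis using * unfolding F_def by blast
  qed auto
qed

lemma F_seq_cont: "seq_contC r F"
  unfolding seq_contC_def
proof (intro allI impI)
  fix t :: real and \<psi> :: "real \<Rightarrow> 'x" and s :: "nat \<Rightarrow> real" and \<psi>s :: "nat \<Rightarrow> real \<Rightarrow> 'x"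
  assume \<psi>: "\<psi> \<in> Cspace r" and \<psi>s': "\<forall>n. \<psi>s n \<in> Cspace r" and s: "s \<longlonglongrightarrow> t"
    and conv: "(\<lambda>n. Cnorm r (\<lambda>\<theta>. \<psi>s n \<theta> - \<psi> \<theta>)) \<longlonglongrightarrow> 0"
  have \<psi>s: "\<psi>s n \<in> Cspace r" for n using \<psi>s' by simp
  have r0: "0 \<le> r" using r by simp
  \<comment> \<open>A modulus for \<open>p\<close> along the sequence that is uniform in \<theta>;
    it serves both the uniform limit of the integrands and the evaluation at moving jump
    points.\<close>
  define D where "D n = L * (\<bar>t - s n\<bar> + Cnorm r (\<lambda>\<theta>. \<psi>s n \<theta> - \<psi> \<theta>))" for n
  have D: "D \<longlonglongrightarrow> 0"
  proof -
    have "(\<lambda>n. L * (\<bar>t - s n\<bar> + Cnorm r (\<lambda>\<theta>. \<psi>s n \<theta> - \<psi> \<theta>))) \<longlonglongrightarrow> L * (\<bar>t - t\<bar> + 0)"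
      by (intro tendsto_intros s conv)
    then show ?thesis by (simp add: D_def[abs_def])
  qed
  have pD: "norm (p (s n) (\<psi>s n \<theta>) - p t (\<psi> \<theta>)) \<le> D n" if "\<theta> \<in> {-r..0}" for n \<theta>
  proof -
    have "norm (p (s n) (\<psi>s n \<theta>) - p t (\<psi> \<theta>)) \<le> L * (\<bar>t - s n\<bar> + norm (\<psi>s n \<theta> - \<psi> \<theta>))" by (rule p_lip)
    also have "\<dots> \<le> D n"
      unfolding D_def using norm_le_Cnorm[OF Cspace_diff[OF \<psi>s \<psi>] that] L by (intro mult_left_mono add_left_mono) auto
    finally show ?thesis .
  qed
  have unif: "uniform_limit {-r..0} (\<lambda>n \<theta>. p (s n) (\<psi>s n \<theta>)) (\<lambda>\<theta>. p t (\<psi> \<theta>)) sequentially"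
  proof (rule uniform_limitI)
    fix e :: real assume "e > 0"
    from order_tendstoD(2)[OF D this]
    show "\<forall>\<^sub>F n in sequentially. \<forall>\<theta>\<in>{-r..0}. dist (p (s n) (\<psi>s n \<theta>)) (p t (\<psi> \<theta>)) < e"
      by eventually_elim (simp add: dist_norm order.strict_trans1[OF pD])
  qed
  obtain I V where I: "var_dom (cont_part (\<lambda>\<theta>. g \<theta> t \<psi>) (-r) 0) V (-r) 0" "V 0 - V (-r) \<le> 2 * M"
     "has_RS_integral (\<lambda>\<theta>. p t (\<psi> \<theta>)) (cont_part (\<lambda>\<theta>. g \<theta> t \<psi>) (-r) 0) (-r) 0 I"
     "F t \<psi> = I + (\<Sum>k. h k t \<psi> *\<^sub>R p t (\<psi> (- \<eta> k t \<psi>)))"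
    using F_decomposition[OF \<psi>] by blast
  define dec where "dec n I V \<longleftrightarrow> var_dom (cont_part (\<lambda>\<theta>. g \<theta> (s n) (\<psi>s n)) (-r) 0) V (-r) 0 \<and> V 0 - V (-r) \<le> 2 * M
    \<and> has_RS_integral (\<lambda>\<theta>. p (s n) (\<psi>s n \<theta>)) (cont_part (\<lambda>\<theta>. g \<theta> (s n) (\<psi>s n)) (-r) 0) (-r) 0 I
    \<and> F (s n) (\<psi>s n) = I + (\<Sum>k. h k (s n) (\<psi>s n) *\<^sub>R p (s n) (\<psi>s n (- \<eta> k (s n) (\<psi>s n))))" for n I V
  have "\<exists>I V. dec n I V" for n
    unfolding dec_def by (rule F_decomposition[OF \<psi>s])
  then obtain Is Vs where "\<And>n. dec n (Is n) (Vs n)" by metis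
  then have Is: "\<And>n. var_dom (cont_part (\<lambda>\<theta>. g \<theta> (s n) (\<psi>s n)) (-r) 0) (Vs n) (-r) 0"
     "\<And>n. Vs n 0 - Vs n (-r) \<le> 2 * M"
     "\<And>n. has_RS_integral (\<lambda>\<theta>. p (s n) (\<psi>s n \<theta>)) (cont_part (\<lambda>\<theta>. g \<theta> (s n) (\<psi>s n)) (-r) 0) (-r) 0 (Is n)"
     "\<And>n. F (s n) (\<psi>s n) = Is n + (\<Sum>k. h k (s n) (\<psi>s n) *\<^sub>R p (s n) (\<psi>s n (- \<eta> k (s n) (\<psi>s n))))"
    unfolding dec_def by blast+
  have 1: "Is \<longlonglongrightarrow> I"
  proof (rule has_RS_integral_limit[OF _ p_continuous[OF \<psi>] unif I(1) Is(1) I(2) Is(2) _ I(3) Is(3)])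
    show "-r \<le> 0" using r by simp
    show "(\<lambda>n. cont_part (\<lambda>\<theta>. g \<theta> (s n) (\<psi>s n)) (-r) 0 x) \<longlonglongrightarrow> cont_part (\<lambda>\<theta>. g \<theta> t \<psi>) (-r) 0 x" if "x \<in> {-r..0}" for x
      by (rule seq_contCD[OF contC_imp_seq_contC[OF A2[OF that] r0] \<psi> \<psi>s s conv])
  qed
  \<comment> \<open>One bounded set containing the whole sequence and its limit, on which the tails
    of the jump series are uniformly small.\<close>
  obtain R where R: "\<bar>t\<bar> \<le> R" "Cnorm r \<psi> \<le> R" "\<And>n. \<bar>s n\<bar> \<le> R" "\<And>n. Cnorm r (\<psi>s n) \<le> R"
  proof -
    have "Bseq s" "Bseq (\<lambda>n. Cnorm r (\<lambda>\<theta>. \<psi>s n \<theta> - \<psi> \<theta>))"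
      using s conv by (auto intro: convergent_imp_Bseq convergentI)
    then obtain c c' where c: "\<And>n. \<bar>s n\<bar> \<le> c" "\<And>n. \<bar>Cnorm r (\<lambda>\<theta>. \<psi>s n \<theta> - \<psi> \<theta>)\<bar> \<le> c'"
      unfolding Bseq_def by (metis real_norm_def)
    have 3: "Cnorm r (\<psi>s n) \<le> c' + Cnorm r \<psi>" for n
    proof (rule Cnorm_le[OF r0])
      fix \<theta> assume \<theta>: "\<theta> \<in> {-r..0}"
      have "norm (\<psi>s n \<theta>) \<le> norm (\<psi>s n \<theta> - \<psi> \<theta>) + norm (\<psi> \<theta>)"
        using norm_triangle_ineq[of "\<psi>s n \<theta> - \<psi> \<theta>" "\<psi> \<theta>"] by simp
      then show "norm (\<psi>s n \<theta>) \<le> c' + Cnorm r \<psi>"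
        using norm_le_Cnorm[OF Cspace_diff[OF \<psi>s \<psi>] \<theta>, of n] norm_le_Cnorm[OF \<psi> \<theta>] c(2)[of n] by linarith
    qed
    have 4: "0 \<le> c" "0 \<le> c'" using order_trans[OF abs_ge_zero c(1)[of 0]] order_trans[OF abs_ge_zero c(2)[of 0]] .
    have 5: "0 \<le> Cnorm r \<psi>" by (rule Cnorm_nonneg[OF r0 \<psi>])
    show ?thesis
    proof (rule that[of "\<bar>t\<bar> + c + (c' + Cnorm r \<psi>)"])
      show "\<bar>s n\<bar> \<le> \<bar>t\<bar> + c + (c' + Cnorm r \<psi>)" for n using c(1)[of n] 4 5 by linarith
      show "Cnorm r (\<psi>s n) \<le> \<bar>t\<bar> + c + (c' + Cnorm r \<psi>)" for n using 3[of n] 4 by linarith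
    qed (use 4 5 in linarith)+
  qed
  have 2: "(\<lambda>n. \<Sum>k. h k (s n) (\<psi>s n) *\<^sub>R p (s n) (\<psi>s n (- \<eta> k (s n) (\<psi>s n))))
      \<longlonglongrightarrow> (\<Sum>k. h k t \<psi> *\<^sub>R p t (\<psi> (- \<eta> k t \<psi>)))"
  proof (rule suminf_scaleR_tendsto[where C = "C\<^sub>1 * R + C\<^sub>2"])
    fix k
    show "(\<lambda>n. h k (s n) (\<psi>s n)) \<longlonglongrightarrow> h k t \<psi>"
      by (rule seq_contCD[OF contC_imp_seq_contC[OF A3_h_cont r0] \<psi> \<psi>s s conv])
    have \<eta>: "(\<lambda>n. \<eta> k (s n) (\<psi>s n)) \<longlonglongrightarrow> \<eta> k t \<psi>"
      by (rule seq_contCD[OF contC_imp_seq_contC[OF A3_eta_cont r0] \<psi> \<psi>s s conv])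
    have in1: "- \<eta> k t \<psi> \<in> {-r..0}" using A3_range[OF \<psi>, of k t] by auto
    have in2: "- \<eta> k (s n) (\<psi>s n) \<in> {-r..0}" for n using A3_range[OF \<psi>s, of k "s n" n] by auto
    \<comment> \<open>The function and the evaluation point both move. First the function is
      replaced by its limit at the moving point, then continuity of the limit moves the
      point.\<close>
    have "(\<lambda>n. p (s n) (\<psi>s n (- \<eta> k (s n) (\<psi>s n))) - p t (\<psi> (- \<eta> k (s n) (\<psi>s n)))) \<longlonglongrightarrow> 0"
      by (rule Lim_null_comparison[OF _ D]) (intro always_eventually allI pD in2)
    moreover have "(\<lambda>n. p t (\<psi> (- \<eta> k (s n) (\<psi>s n)))) \<longlonglongrightarrow> p t (\<psi> (- \<eta> k t \<psi>))"
      by (rule continuous_on_tendsto_compose[OF p_continuous[OF \<psi>, of t] tendsto_minus[OF \<eta>] in1]) (simp add: in2 del: atLeastAtMost_iff)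
    ultimately show "(\<lambda>n. p (s n) (\<psi>s n (- \<eta> k (s n) (\<psi>s n)))) \<longlonglongrightarrow> p t (\<psi> (- \<eta> k t \<psi>))"
      using tendsto_add by fastforce
    have "C\<^sub>1 * Cnorm r \<psi> \<le> C\<^sub>1 * R" using R(2) C12 by (intro mult_left_mono) auto
    then show "norm (p t (\<psi> (- \<eta> k t \<psi>))) \<le> C\<^sub>1 * R + C\<^sub>2"
      using p_bound[OF \<psi> in1, of t] by linarith
    show "norm (p (s n) (\<psi>s n (- \<eta> k (s n) (\<psi>s n)))) \<le> C\<^sub>1 * R + C\<^sub>2" for n
    proof -
      have "C\<^sub>1 * Cnorm r (\<psi>s n) \<le> C\<^sub>1 * R" using R(4) C12 by (intro mult_left_mono) auto
      then show ?thesis using p_bound[OF \<psi>s in2, of "s n" n n] by linarith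
    qed
  next
    fix e :: real assume "e > 0"
    from A3_unif[OF this, of R] obtain N where N: "\<And>t \<psi> m n. \<psi> \<in> Cspace r \<Longrightarrow> \<bar>t\<bar> \<le> R \<Longrightarrow> Cnorm r \<psi> \<le> R \<Longrightarrow> N \<le> m \<Longrightarrow>
      (\<Sum>k\<in>{m..<n}. \<bar>h k t \<psi>\<bar>) < e" by blast
    show "\<exists>N. \<forall>m. (\<Sum>k = N..<m. \<bar>h k t \<psi>\<bar>) \<le> e \<and> (\<forall>n. (\<Sum>k = N..<m. \<bar>h k (s n) (\<psi>s n)\<bar>) \<le> e)"
      using N[OF \<psi> R(1,2)] N[OF \<psi>s R(3,4)] by (intro exI[of _ N]) (auto intro: less_imp_le)
  qed
  show "(\<lambda>n. F (s n) (\<psi>s n)) \<longlonglongrightarrow> F t \<psi>"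
    unfolding I(4) Is(4) by (intro tendsto_add 1 2)
qed

end

theorem theorem3:
  fixes T :: "real \<Rightarrow> 'x::banach \<Rightarrow>\<^sub>L 'x"
    and \<omega> r a L\<^sub>p C\<^sub>1 C\<^sub>2 M\<^sub>V\<^sub>g :: real
    and G :: "real \<Rightarrow> 'x \<Rightarrow> 'x \<Rightarrow> 'x"
    and p :: "real \<Rightarrow> 'x \<Rightarrow> 'x"
    and g :: "real \<Rightarrow> real \<Rightarrow> (real \<Rightarrow> 'x) \<Rightarrow> real"
    and \<eta> h :: "nat \<Rightarrow> real \<Rightarrow> (real \<Rightarrow> 'x) \<Rightarrow> real"
    and k\<^sub>1 k\<^sub>2 :: "real \<Rightarrow> real"
    and \<phi> :: "real \<Rightarrow> 'x"
  defines "B \<equiv> (\<lambda>t \<psi>. G t (\<psi> 0) (RS_integral (\<lambda>\<theta>. p t (\<psi> \<theta>)) (\<lambda>\<theta>. g \<theta> t \<psi>) (-r) 0))"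
  assumes r_pos: "r > 0"
    and semigroup: "compact_C0_semigroup T \<omega>"
    and G_cont: "continuous_on UNIV (\<lambda>(t, u, v). G t u v)"
    and Lp: "L\<^sub>p \<ge> 0"
    and p_lip: "\<And>t s u v. norm (p t u - p s v) \<le> L\<^sub>p * (\<bar>s - t\<bar> + norm (u - v))"
    and C12: "C\<^sub>1 \<ge> 0" "C\<^sub>2 \<ge> 0"
    and p_growth: "\<And>s u. norm (p s u) \<le> C\<^sub>1 * norm u + C\<^sub>2"
    and A1: "\<And>t \<psi>. \<psi> \<in> Cspace r \<Longrightarrow>
               has_bounded_variation (\<lambda>\<theta>. g \<theta> t \<psi>) (-r) 0
             \<and> total_variation (\<lambda>\<theta>. g \<theta> t \<psi>) (-r) 0 \<le> M\<^sub>V\<^sub>g"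
    and A2: "\<And>\<theta>. \<theta> \<in> {-r..0} \<Longrightarrow> contC r (\<lambda>t \<psi>. cont_part (\<lambda>\<sigma>. g \<sigma> t \<psi>) (-r) 0 \<theta>)"
    and A3_range: "\<And>k t \<psi>. \<psi> \<in> Cspace r \<Longrightarrow> \<eta> k t \<psi> \<in> {0..r}"
    and A3_eta_cont: "\<And>k. contC r (\<eta> k)"
    and A3_h_cont: "\<And>k. contC r (h k)"
    and A3_jumps: "\<And>t \<psi> \<theta>. \<psi> \<in> Cspace r \<Longrightarrow> \<theta> \<in> {-r..0} \<Longrightarrow>
               jump_at (jump_part (\<lambda>\<sigma>. g \<sigma> t \<psi>) (-r) 0) (-r) 0 \<theta>
             = (\<Sum>k. if \<theta> = - \<eta> k t \<psi> then h k t \<psi> else 0)"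
    and A3_unif: "\<And>R \<epsilon>. \<epsilon> > 0 \<Longrightarrow> \<exists>N. \<forall>t \<psi>. \<psi> \<in> Cspace r \<and> \<bar>t\<bar> \<le> R \<and> Cnorm r \<psi> \<le> R \<longrightarrow>
               (\<forall>m n. N \<le> m \<longrightarrow> (\<Sum>k\<in>{m..<n}. \<bar>h k t \<psi>\<bar>) < \<epsilon>)"
    and G_growth: "\<And>t u v. norm (G t u v) \<le> k\<^sub>1 t * (norm u + norm v) + k\<^sub>2 t"
    and k_loc_int: "\<And>b. k\<^sub>1 absolutely_integrable_on {a..b}" "\<And>b. k\<^sub>2 absolutely_integrable_on {a..b}"
    and \<phi>C: "\<phi> \<in> Cspace r"
  shows "\<exists>u. continuous_on {a - r..} u \<and> (\<forall>Tend>a. mild_solution_on T B r a Tend \<phi> u)"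
proof -
  interpret delay_functional r L\<^sub>p C\<^sub>1 C\<^sub>2 M\<^sub>V\<^sub>g p g \<eta> h
    by unfold_locales (fact r_pos Lp p_lip C12 p_growth A1 A2 A3_range A3_eta_cont A3_h_cont A3_jumps A3_unif)+
  have B_eq: "B t \<psi> = G t (\<psi> 0) (F t \<psi>)" for t \<psi> by (simp add: B_def F_def)
  \<comment> \<open>Collects the coefficients of \<open>norm (\<psi> 0) + norm (F t \<psi>) \<le> N
    + (C\<^sub>1 * N + C\<^sub>2) * M\<^sub>V\<^sub>g\<close>, where \<open>N\<close> is the norm of
    \<psi>, into one multiple of \<open>1 + N\<close>. Absolute values in \<open>k\<close> give a
    nonnegative coefficient whatever the signs of \<open>k\<^sub>1\<close> and
    \<open>k\<^sub>2\<close>.\<close>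
  define c where "c = 1 + M\<^sub>V\<^sub>g * C\<^sub>1 + M\<^sub>V\<^sub>g * C\<^sub>2"
  define k where "k t = \<bar>k\<^sub>1 t\<bar> * c + \<bar>k\<^sub>2 t\<bar>" for t
  have c: "c \<ge> 0" using M_nonneg C12 by (simp add: c_def)
  have "seq_contC r B"
    unfolding seq_contC_def
  proof (intro allI impI)
    fix t :: real and \<psi> :: "real \<Rightarrow> 'x" and s :: "nat \<Rightarrow> real" and \<psi>s :: "nat \<Rightarrow> real \<Rightarrow> 'x"
    assume \<psi>: "\<psi> \<in> Cspace r" and \<psi>s: "\<forall>n. \<psi>s n \<in> Cspace r" and s: "s \<longlonglongrightarrow> t"
      and conv: "(\<lambda>n. Cnorm r (\<lambda>\<theta>. \<psi>s n \<theta> - \<psi> \<theta>)) \<longlonglongrightarrow> 0"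
    have "(\<lambda>n. \<psi>s n 0 - \<psi> 0) \<longlonglongrightarrow> 0"
    proof (rule Lim_null_comparison[OF _ conv], intro always_eventually allI)
      fix n
      show "norm (\<psi>s n 0 - \<psi> 0) \<le> Cnorm r (\<lambda>\<theta>. \<psi>s n \<theta> - \<psi> \<theta>)"
        using norm_le_Cnorm[OF Cspace_diff[of "\<psi>s n" r \<psi>], of 0] \<psi> \<psi>s r_pos by auto
    qed
    then have "(\<lambda>n. \<psi>s n 0) \<longlonglongrightarrow> \<psi> 0" by (simp add: LIM_zero_iff)
    moreover have "(\<lambda>n. F (s n) (\<psi>s n)) \<longlonglongrightarrow> F t \<psi>"
      by (rule seq_contCD[OF F_seq_cont \<psi> _ s conv]) (use \<psi>s in blast)
    ultimately have "(\<lambda>n. (s n, \<psi>s n 0, F (s n) (\<psi>s n))) \<longlonglongrightarrow> (t, \<psi> 0, F t \<psi>)"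
      by (intro tendsto_Pair s)
    from continuous_on_tendsto_compose[OF G_cont this]
    show "(\<lambda>n. B (s n) (\<psi>s n)) \<longlonglongrightarrow> B t \<psi>" by (simp add: B_eq)
  qed
  moreover have "norm (B t \<psi>) \<le> k t * (1 + Cnorm r \<psi>)" if \<psi>: "\<psi> \<in> Cspace r" for t \<psi>
  proof -
    define N where "N = Cnorm r \<psi>"
    have N: "0 \<le> N" using Cnorm_nonneg[OF _ \<psi>] r_pos by (simp add: N_def)
    have "norm (\<psi> 0) + norm (F t \<psi>) \<le> N + (C\<^sub>1 * N + C\<^sub>2) * M\<^sub>V\<^sub>g"
      unfolding N_def using r_pos by (intro add_mono F_bound \<psi> norm_le_Cnorm) auto
    also have "\<dots> \<le> c * (1 + N)"
      using N M_nonneg C12 by (simp add: c_def algebra_simps)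
    finally have 1: "norm (\<psi> 0) + norm (F t \<psi>) \<le> c * (1 + N)" .
    have "norm (B t \<psi>) \<le> k\<^sub>1 t * (norm (\<psi> 0) + norm (F t \<psi>)) + k\<^sub>2 t"
      unfolding B_eq by (rule G_growth)
    also have "\<dots> \<le> \<bar>k\<^sub>1 t\<bar> * (norm (\<psi> 0) + norm (F t \<psi>)) + \<bar>k\<^sub>2 t\<bar>"
      by (intro add_mono mult_right_mono) auto
    also have "\<dots> \<le> \<bar>k\<^sub>1 t\<bar> * (c * (1 + N)) + \<bar>k\<^sub>2 t\<bar> * (1 + N)"
      using 1 N by (intro add_mono mult_left_mono) (auto simp: mult_le_cancel_left1)
    also have "\<dots> = k t * (1 + N)" by (simp add: k_def algebra_simps)
    finally show ?thesis by (simp add: N_def)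
  qed
  moreover have "0 \<le> k t" for t using c by (simp add: k_def)
  moreover have "k integrable_on {a..b}" for b
  proof -
    have 1: "(\<lambda>t. \<bar>k\<^sub>1 t\<bar>) integrable_on {a..b}" and 2: "(\<lambda>t. \<bar>k\<^sub>2 t\<bar>) integrable_on {a..b}"
      using k_loc_int[of b] by (auto simp: absolutely_integrable_on_def)
    show ?thesis
      unfolding k_def[abs_def] using integrable_add[OF integrable_cmul[OF 1, of c] 2] by (simp add: mult.commute)
  qed
  ultimately interpret delay_problem T \<omega> r a B k \<phi>
    by unfold_locales (use r_pos semigroup \<phi>C in auto)
  show ?thesis by (rule mild_solution_exists)
qed

end
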